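(* Let $f\in C_b^3(\mathbb{R}^d,\mathbb{R}^{d\times m})$. For any given $T>0$ and $\beta\in(1/3,1/2)$ there exists a sequence of positive numbers $(\delta_i)_{i\in\mathbb{N}}$ converging to zero (one may take the dyadic numbers $\delta_i=2^{-i}$) such that the following holds: if the sequence of initial conditions $(\xi_{\delta_i})_{i\in\mathbb{N}}\subset\mathbb{R}^d$ converges to $\xi\in\mathbb{R}^d$, then for every $\omega\in\Omega$ $$\varphi_{\delta_i}(\cdot,\omega,\xi_{\delta_i})\to\varphi_0(\cdot,\omega,\xi)\quad\text{in } C^\beta([0,T],\mathbb{R}^d)\text{ as } i\to\infty,$$ where $\varphi_0$ is the random dynamical system generated by the rough differential equation $dY=f(Y)\,d\boldsymbol{\omega}$, $Y(0)=\xi$, and $\varphi_\delta$ is the random dynamical system generated by the random ordinary differential equation $dY_\delta=f(Y_\delta)\,d\omega_\delta$, $Y_\delta(0)=\xi_\delta$.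
   Context: Canonical Brownian motion: $\Omega\subset C_0(\mathbb{R},\mathbb{R}^m)$ is a set of full Wiener measure of continuous paths $\omega:\mathbb{R}\to\mathbb{R}^m$ with $\omega(0)=0$ that are $\beta$-Hölder on every $[-T,T]$ for every $\beta<1/2$, invariant under the Wiener shift $\theta_t\omega(\cdot)=\omega(\cdot+t)-\omega(t)$; $\mathcal{F}$ is the trace of the Borel $\sigma$-algebra (compact-open topology), $\mathbb{P}_{1/2}$ the two-sided Wiener measure (independent components). Approximation: for $\delta\in(0,1]$, $\omega_\delta(t)=\frac1\delta\int_0^t(\omega(\delta+r)-\omega(r))\,dr$, $t\in\mathbb{R}$, with lift $\boldsymbol{\omega}_\delta=(\omega_\delta,\mathbb{W}_\delta)$, $\mathbb{W}_\delta(s,t)=\int_s^t(\omega_\delta(r)-\omega_\delta(s))\otimes\omega_\delta'(r)\,dr$, $s\le t$. Rough paths: for $\beta\in(1/3,1/2)$ a $\beta$-rough path on $[T_1,T_2]$ is a pair $(X,\mathbb{X})$ with $X:[T_1,T_2]\to\mathbb{R}^m$ $\beta$-Hölder, $\mathbb{X}:\{(s,t):T_1\le s\le t\le T_2\}\to\mathbb{R}^{m\times m}$ with $\sup_{s<t}|\mathbb{X}(s,t)|/(t-s)^{2\beta}<\infty$ and $\mathbb{X}(s,t)-\mathbb{X}(s,u)-\mathbb{X}(u,t)=(X(u)-X(s))\otimes(X(t)-X(u))$ for $s\le u\le t$. The rough path metric is $$\rho_{\beta,T_1,T_2}((X,\mathbb{X}),(Y,\mathbb{Y}))=\sup_{T_1\le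 s<t\le T_2}\Big(\frac{|X(t)-X(s)-Y(t)+Y(s)|}{(t-s)^\beta}+\frac{|\mathbb{X}(s,t)-\mathbb{Y}(s,t)|}{(t-s)^{2\beta}}\Big).$$ Brownian rough path and version convention: $\boldsymbol{\omega}=(\omega,\mathbb{W})$ is the (geometric, Stratonovich) Brownian rough path: for $i<j$, $\mathbb{W}^{i,j}(s,t)=\int_s^t(\omega^i(r)-\omega^i(s))\,d\omega^j(r)$ as an $L_2$-limit of Riemann sums, $\mathbb{W}^{i,i}(s,t)=\frac12(\omega^i(t)-\omega^i(s))^2$, $\mathbb{W}^{j,i}(s,t)=-\mathbb{W}^{i,j}(s,t)+(\omega^i(t)-\omega^i(s))(\omega^j(t)-\omega^j(s))$. The version used is: on the $\theta$-invariant measurable set $\Omega'\subset\Omega$ of full measure of those $\omega$ for which $(\boldsymbol{\omega}_{2^{-i}})_{i}$ converges with respect to $\rho_{\beta,-n,n}$ for all $n\in\mathbb{N}$ and all $\beta\in(1/3,1/2)$, $\boldsymbol{\omega}$ is this limit; for $\omega\notin\Omega'$ the path $\omega$ is replaced by the zero path, so that $\boldsymbol{\omega}$, $\omega_\delta$ and $\boldsymbol{\omega}_\delta$ are all zero there. Rough integral and equation: $Y\in C^\beta([0,T],\mathbb{R}^d)$ is controlled by $\omega$, written $(Y,Y')\in\mathscr{D}^{2\beta}_\omega([0,T],\mathbb{R}^d)$, if there are $Y'\in C^\beta([0,T],\mathbb{R}^{d\times m})$ and a $2\beta$-Hölder remainder $R^Y$ (i.e. $\sup_{s<t}|R^Y(s,t)|/(t-s)^{2\beta}<\infty$)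 with $Y(t)-Y(s)=Y'(s)(\omega(t)-\omega(s))+R^Y(s,t)$. Then $\int_s^tf(Y(r))\,d\boldsymbol{\omega}(r)=\lim_{|\mathcal{P}|\to0}\sum_{[u,v]\in\mathcal{P}}\big(f(Y(u))(\omega(v)-\omega(u))+f'(Y(u))Y'(u)\mathbb{W}(u,v)\big)$ over partitions $\mathcal{P}$ of $[s,t]$. For $f\in C^3_b$ (bounded with bounded derivatives up to order 3) the equation $Y(t)=\xi+\int_0^tf(Y(s))\,d\boldsymbol{\omega}(s)$ has a unique solution $(Y,Y')\in\mathscr{D}^{2\beta}_\omega([0,T],\mathbb{R}^d)$ with $Y'=f(Y)$ for every $T>0$, and $\varphi_0(t,\omega,\xi):=Y(t)$. Similarly $\varphi_\delta(t,\omega,\xi_\delta):=Y_\delta(t)$, the unique solution of $Y_\delta(t)=\xi_\delta+\int_0^tf(Y_\delta(s))\omega_\delta'(s)\,ds$. *)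

theory Defs
  imports "HOL-Probability.Probability"
begin

definition holder_on :: "real \<Rightarrow> real set \<Rightarrow> (real \<Rightarrow> 'a::real_normed_vector) \<Rightarrow> bool" where
  "holder_on \<beta> I X \<longleftrightarrow> (\<exists>C. \<forall>s\<in>I. \<forall>t\<in>I. norm (X t - X s) \<le> C * \<bar>t - s\<bar> powr \<beta>)"

text \<open>Suprema that may be infinite are taken in \<^typ>\<open>ennreal\<close>; there a supremum over the empty set is 0.\<close>

definition holder_norm :: "real \<Rightarrow> real \<Rightarrow> real \<Rightarrow> (real \<Rightarrow> 'a::real_normed_vector) \<Rightarrow> ennreal" where
  "holder_norm \<beta> T1 T2 Y =
     (SUP t\<in>{T1..T2}. ennreal (norm (Y t))) +
     (SUP (s, t)\<in>{(s, t). T1 \<le> s \<and> s < t \<and> t \<le> T2}.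
        ennreal (norm (Y t - Y s) / (t - s) powr \<beta>))"

definition converges_in_holder ::
  "real \<Rightarrow> real \<Rightarrow> real \<Rightarrow> (nat \<Rightarrow> real \<Rightarrow> 'a::real_normed_vector) \<Rightarrow> (real \<Rightarrow> 'a) \<Rightarrow> bool" where
  "converges_in_holder \<beta> T1 T2 Y Z \<longleftrightarrow>
     (\<forall>i. holder_on \<beta> {T1..T2} (Y i)) \<and> holder_on \<beta> {T1..T2} Z \<and>
     (\<lambda>i. holder_norm \<beta> T1 T2 (\<lambda>t. Y i t - Z t)) \<longlonglongrightarrow> 0"

definition tensor :: "real^'m \<Rightarrow> real^'n \<Rightarrow> real^'n^'m" where
  "tensor x y = (\<chi> i j. x $ i * y $ j)"

text \<open>A second-order process is a function of two times; only its values at \<open>s \<le> t\<close> matter.\<close>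

definition rough_path ::
  "real \<Rightarrow> real \<Rightarrow> real \<Rightarrow> (real \<Rightarrow> real^'m) \<Rightarrow> (real \<Rightarrow> real \<Rightarrow> real^'m^'m) \<Rightarrow> bool" where
  "rough_path \<beta> T1 T2 X W \<longleftrightarrow>
     holder_on \<beta> {T1..T2} X \<and>
     (\<exists>C. \<forall>s t. T1 \<le> s \<and> s < t \<and> t \<le> T2 \<longrightarrow> norm (W s t) \<le> C * (t - s) powr (2 * \<beta>)) \<and>
     (\<forall>s u t. T1 \<le> s \<and> s \<le> u \<and> u \<le> t \<and> t \<le> T2 \<longrightarrow>
        W s t - W s u - W u t = tensor (X u - X s) (X t - X u))"

definition rough_dist ::
  "real \<Rightarrow> real \<Rightarrow> real \<Rightarrow> (real \<Rightarrow> real^'m) \<times> (real \<Rightarrow> real \<Rightarrow> real^'m^'m) \<Rightarrow>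
   (real \<Rightarrow> real^'m) \<times> (real \<Rightarrow> real \<Rightarrow> real^'m^'m) \<Rightarrow> ennreal" where
  "rough_dist \<beta> T1 T2 = (\<lambda>(X, V) (Y, W).
     SUP (s, t)\<in>{(s, t). T1 \<le> s \<and> s < t \<and> t \<le> T2}.
       ennreal (norm (X t - X s - Y t + Y s) / (t - s) powr \<beta>
                + norm (V s t - W s t) / (t - s) powr (2 * \<beta>)))"

definition C0 :: "(real \<Rightarrow> real^'m) set" where
  "C0 = {\<omega>. continuous_on UNIV \<omega> \<and> \<omega> 0 = 0}"

definition compact_open :: "(real \<Rightarrow> real^'m) topology" where
  "compact_open = topology_generated_by {{\<omega> \<in> C0. \<omega> ` K \<subseteq> U} | K U. compact K \<and> open U}"

text \<open>Wiener measure is characterised by its increments over consecutive intervals: all their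
  coordinates are jointly independent and centred normal with variance the interval length.\<close>

definition two_sided_wiener_measure :: "(real \<Rightarrow> real^'m) measure \<Rightarrow> bool" where
  "two_sided_wiener_measure P \<longleftrightarrow>
     prob_space P \<and> space P = C0 \<and> sets P = sigma_sets C0 {U. openin compact_open U} \<and>
     (\<forall>s t i. s < t \<longrightarrow>
        distributed P lborel (\<lambda>\<omega>. (\<omega> t - \<omega> s) $ i) (normal_density 0 (sqrt (t - s)))) \<and>
     (\<forall>n (t :: nat \<Rightarrow> real). strict_mono t \<longrightarrow>
        prob_space.indep_vars P (\<lambda>_. borel) (\<lambda>(k, i) \<omega>. (\<omega> (t (Suc k)) - \<omega> (t k)) $ i)
          ({..<n} \<times> (UNIV :: 'm set)))"

definition wiener_shift :: "real \<Rightarrow> (real \<Rightarrow> real^'m) \<Rightarrow> real \<Rightarrow> real^'m" where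
  "wiener_shift t \<omega> = (\<lambda>s. \<omega> (s + t) - \<omega> t)"

definition canonical_path_set :: "(real \<Rightarrow> real^'m) measure \<Rightarrow> (real \<Rightarrow> real^'m) set \<Rightarrow> bool" where
  "canonical_path_set P \<Omega> \<longleftrightarrow>
     \<Omega> \<subseteq> C0 \<and> (AE \<omega> in P. \<omega> \<in> \<Omega>) \<and>
     (\<forall>\<omega>\<in>\<Omega>. \<forall>T>0. \<forall>\<beta>. 0 < \<beta> \<and> \<beta> < 1/2 \<longrightarrow> holder_on \<beta> {-T..T} \<omega>) \<and>
     (\<forall>t. wiener_shift t ` \<Omega> = \<Omega>)"

text \<open>The interval integral is oriented, so the formula also covers negative times.\<close>

definition smooth_approx :: "real \<Rightarrow> (real \<Rightarrow> real^'m) \<Rightarrow> real \<Rightarrow> real^'m" where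
  "smooth_approx \<delta> \<omega> t = (1 / \<delta>) *\<^sub>R (LBINT r=ereal 0..ereal t. \<omega> (\<delta> + r) - \<omega> r)"

definition smooth_area :: "real \<Rightarrow> (real \<Rightarrow> real^'m) \<Rightarrow> real \<Rightarrow> real \<Rightarrow> real^'m^'m" where
  "smooth_area \<delta> \<omega> s t =
     integral {s..t} (\<lambda>r. tensor (smooth_approx \<delta> \<omega> r - smooth_approx \<delta> \<omega> s)
                                 (vector_derivative (smooth_approx \<delta> \<omega>) (at r)))"

definition smooth_lift ::
  "real \<Rightarrow> (real \<Rightarrow> real^'m) \<Rightarrow> (real \<Rightarrow> real^'m) \<times> (real \<Rightarrow> real \<Rightarrow> real^'m^'m)" where
  "smooth_lift \<delta> \<omega> = (smooth_approx \<delta> \<omega>, smooth_area \<delta> \<omega>)"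

definition good_paths :: "(real \<Rightarrow> real^'m) set \<Rightarrow> (real \<Rightarrow> real^'m) set" where
  "good_paths \<Omega> = {\<omega>\<in>\<Omega>. \<forall>(n::nat) \<beta>. 1/3 < \<beta> \<and> \<beta> < 1/2 \<longrightarrow>
     (\<exists>X W. rough_path \<beta> (- real n) (real n) X W \<and>
        (\<lambda>i::nat. rough_dist \<beta> (- real n) (real n) (smooth_lift (1 / 2 ^ i) \<omega>) (X, W)) \<longlonglongrightarrow> 0)}"

text \<open>Version convention: off the good paths everything is computed from the zero path.\<close>

definition path_version :: "(real \<Rightarrow> real^'m) set \<Rightarrow> (real \<Rightarrow> real^'m) \<Rightarrow> real \<Rightarrow> real^'m" where
  "path_version \<Omega> \<omega> = (if \<omega> \<in> good_paths \<Omega> then \<omega> else (\<lambda>_. 0))"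

text \<open>
  The second level of the Brownian rough path, in the version given by the limit of the dyadic
  approximations; almost surely this is the Stratonovich iterated integral. The convergence
  determines the values at \<open>s < t\<close>, Chen's relation forces 0 at \<open>s = t\<close>, and the values
  at \<open>s > t\<close> are set to 0, so the description is unique.
\<close>

definition brownian_area :: "(real \<Rightarrow> real^'m) set \<Rightarrow> (real \<Rightarrow> real^'m) \<Rightarrow> real \<Rightarrow> real \<Rightarrow> real^'m^'m" where
  "brownian_area \<Omega> \<omega> = (THE W.
     (\<forall>s t. t < s \<longrightarrow> W s t = 0) \<and>
     (\<forall>(n::nat) \<beta>. 1/3 < \<beta> \<and> \<beta> < 1/2 \<longrightarrow>
        rough_path \<beta> (- real n) (real n) (path_version \<Omega> \<omega>) W \<and>
        (\<lambda>i::nat. rough_dist \<beta> (- real n) (real n)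
            (smooth_lift (1 / 2 ^ i) (path_version \<Omega> \<omega>)) (path_version \<Omega> \<omega>, W)) \<longlonglongrightarrow> 0))"

definition C3_b :: "('a::real_normed_vector \<Rightarrow> 'b::real_normed_vector) \<Rightarrow> bool" where
  "C3_b f \<longleftrightarrow>
     (\<exists>(f1 :: 'a \<Rightarrow> 'a \<Rightarrow>\<^sub>L 'b) (f2 :: 'a \<Rightarrow> 'a \<Rightarrow>\<^sub>L 'a \<Rightarrow>\<^sub>L 'b) (f3 :: 'a \<Rightarrow> 'a \<Rightarrow>\<^sub>L 'a \<Rightarrow>\<^sub>L 'a \<Rightarrow>\<^sub>L 'b).
        (\<forall>x. (f has_derivative blinfun_apply (f1 x)) (at x)) \<and>
        (\<forall>x. (f1 has_derivative blinfun_apply (f2 x)) (at x)) \<and>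
        (\<forall>x. (f2 has_derivative blinfun_apply (f3 x)) (at x)) \<and>
        continuous_on UNIV f3 \<and>
        bounded (range f) \<and> bounded (range f1) \<and> bounded (range f2) \<and> bounded (range f3))"

definition controlled ::
  "real \<Rightarrow> (real \<Rightarrow> real^'m) \<Rightarrow> real \<Rightarrow> (real \<Rightarrow> real^'d) \<Rightarrow> (real \<Rightarrow> real^'m^'d) \<Rightarrow> bool" where
  "controlled \<beta> X T Y Y' \<longleftrightarrow>
     holder_on \<beta> {0..T} Y \<and> holder_on \<beta> {0..T} Y' \<and>
     (\<exists>C. \<forall>s t. 0 \<le> s \<and> s < t \<and> t \<le> T \<longrightarrow>
        norm (Y t - Y s - Y' s *v (X t - X s)) \<le> C * (t - s) powr (2 * \<beta>))"

text \<open>A partition of \<open>[s, t]\<close> is the strictly increasing list of its points, endpoints included.\<close>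

definition partitions :: "real \<Rightarrow> real \<Rightarrow> real list set" where
  "partitions s t = {p. p \<noteq> [] \<and> sorted_wrt (<) p \<and> hd p = s \<and> last p = t}"

text \<open>
  In the second-order term \<open>f'(Y(u)) Y'(u) W(u,v)\<close> the two derivatives pair with the first index of
  \<open>W\<close> and the columns of \<open>f\<close> with the second: its \<open>k\<close>-th entry is
  \<open>\<Sum>\<^sub>i \<Sum>\<^sub>j (Df(Y(u)) (Y'(u) e\<^sub>i))\<^sub>k\<^sub>j W(u,v)\<^sub>i\<^sub>j\<close>.
\<close>

definition rough_sum ::
  "(real^'d \<Rightarrow> real^'m^'d) \<Rightarrow> (real \<Rightarrow> real^'d) \<Rightarrow> (real \<Rightarrow> real^'m^'d) \<Rightarrow>
   (real \<Rightarrow> real^'m) \<Rightarrow> (real \<Rightarrow> real \<Rightarrow> real^'m^'m) \<Rightarrow> real list \<Rightarrow> real^'d" where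
  "rough_sum f Y Y' X W p =
     (\<Sum>k<length p - 1. let u = p ! k; v = p ! Suc k in
        f (Y u) *v (X v - X u) +
        (\<Sum>i\<in>UNIV. frechet_derivative f (at (Y u)) (column i (Y' u)) *v row i (W u v)))"

definition has_rough_integral ::
  "(real^'d \<Rightarrow> real^'m^'d) \<Rightarrow> (real \<Rightarrow> real^'d) \<Rightarrow> (real \<Rightarrow> real^'m^'d) \<Rightarrow>
   (real \<Rightarrow> real^'m) \<Rightarrow> (real \<Rightarrow> real \<Rightarrow> real^'m^'m) \<Rightarrow> real \<Rightarrow> real \<Rightarrow> real^'d \<Rightarrow> bool" where
  "has_rough_integral f Y Y' X W s t I \<longleftrightarrow>
     (\<forall>\<epsilon>>0. \<exists>\<eta>>0. \<forall>p\<in>partitions s t.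
        (\<forall>k<length p - 1. p ! Suc k - p ! k < \<eta>) \<longrightarrow> norm (rough_sum f Y Y' X W p - I) < \<epsilon>)"

definition rde_solution ::
  "real \<Rightarrow> (real^'d \<Rightarrow> real^'m^'d) \<Rightarrow> (real \<Rightarrow> real^'m) \<Rightarrow> (real \<Rightarrow> real \<Rightarrow> real^'m^'m) \<Rightarrow>
   real^'d \<Rightarrow> real \<Rightarrow> (real \<Rightarrow> real^'d) \<Rightarrow> bool" where
  "rde_solution \<beta> f X W \<xi> T Y \<longleftrightarrow>
     controlled \<beta> X T Y (\<lambda>t. f (Y t)) \<and>
     (\<forall>t\<in>{0..T}. has_rough_integral f Y (\<lambda>r. f (Y r)) X W 0 t (Y t - \<xi>))"

definition ode_solution ::
  "(real^'d \<Rightarrow> real^'m^'d) \<Rightarrow> (real \<Rightarrow> real^'m) \<Rightarrow> real^'d \<Rightarrow> real \<Rightarrow> (real \<Rightarrow> real^'d) \<Rightarrow> bool" where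
  "ode_solution f X \<xi> T Y \<longleftrightarrow>
     continuous_on {0..T} Y \<and>
     (\<forall>t\<in>{0..T}. ((\<lambda>s. f (Y s) *v vector_derivative X (at s)) has_integral (Y t - \<xi>)) {0..t})"

text \<open>Solutions live on \<open>[0, \<infinity>)\<close>; the value 0 at negative times makes them unique as functions.\<close>

definition \<phi>\<^sub>0 ::
  "(real \<Rightarrow> real^'m) set \<Rightarrow> real \<Rightarrow> (real^'d \<Rightarrow> real^'m^'d) \<Rightarrow> real \<Rightarrow> (real \<Rightarrow> real^'m) \<Rightarrow> real^'d \<Rightarrow> real^'d" where
  "\<phi>\<^sub>0 \<Omega> \<beta> f t \<omega> \<xi> =
     (THE Y. (\<forall>s<0. Y s = 0) \<and>
        (\<forall>T>0. rde_solution \<beta> f (path_version \<Omega> \<omega>) (brownian_area \<Omega> \<omega>) \<xi> T Y)) t"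

definition \<phi>\<^sub>\<delta> ::
  "(real \<Rightarrow> real^'m) set \<Rightarrow> (real^'d \<Rightarrow> real^'m^'d) \<Rightarrow> real \<Rightarrow> real \<Rightarrow> (real \<Rightarrow> real^'m) \<Rightarrow> real^'d \<Rightarrow> real^'d" where
  "\<phi>\<^sub>\<delta> \<Omega> f \<delta> t \<omega> \<xi> =
     (THE Y. (\<forall>s<0. Y s = 0) \<and>
        (\<forall>T>0. ode_solution f (smooth_approx \<delta> (path_version \<Omega> \<omega>)) \<xi> T Y)) t"

end

theory Submission
  imports Defs
begin

text \<open>
  Everything is deterministic: for a fixed path, the theorem is the continuity of the Ito--Lyons map.
  With \<open>F y a = f(y) a\<close> and \<open>G y w = \<Sum>\<^sub>i Df(y)(f(y) e\<^sub>i) w\<^sub>i\<close>, solutions are measured, following Davie, by the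
  third-order remainder \<open>J(s,t) = Y(t) - Y(s) - F (Y s) (X(t) - X(s)) - G (Y s) (W(s,t))\<close>: Chen's relation
  expresses the defect \<open>J(s,t) - J(s,u) - J(u,t)\<close> by terms of order \<open>3\<beta> > 1\<close>, so that halving intervals
  bounds \<open>J(s,t)\<close> by \<open>K (t - s)\<^bsup>3\<beta>\<^esup>\<close>, with \<open>K\<close> depending only on the size of the rough path.
  Applied to the difference of two remainders, the same halving shows that the solution depends Lipschitz
  continuously on the initial value and the rough path. This single estimate gives uniqueness, shows
  that the solutions along the smooth approximations form a Cauchy sequence, whose limit
  satisfies the same remainder bound and hence solves the rough equation, and yields the
  convergence in \<open>C\<^sup>\<beta>\<close>.
\<close>

section \<open>A priori estimate\<close>

text \<open>The defect of \<open>J\<close> involves the bound L on \<open>J\<close> that halving is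
  meant to improve; L becomes q L + B only because the terms depending on L carry an extra power of
  the interval length. This forces the estimates onto short intervals. Their length depends on the
  size M of the driver, not on the individual path, which makes the bounds uniform along the
  approximations. The iteration needs a finite bound to start from. For smooth drivers it is L (t -
  s)^2, with L depending on the approximation; as 3\<beta> < 2, it is harmless at small scales. A
  rough solution offers only the exponents \<beta> and 2\<beta>, so its bound on \<open>J\<close>
  comes from sewing: sums of \<open>J\<close> over dyadic partitions stay near \<open>J\<close>
  itself, while the integral equation makes them vanish. Comparing two remainders uses second
  differences of Df and of Df f, hence a Lipschitz second derivative of f: this is where the class
  C^3_b enters. The flows and the Brownian area are definite descriptions, so unique existence, for
  all times and all exponents at once, is part of the work.\<close>

text \<open>Iterating the affine map L \<mapsto> r L + B from any start converges to its fixed point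
  B / (1 - r). The initial constant \<open>L0\<close> must be finite but leaves no trace in the
  result.\<close>

lemma bound_by_contraction:
  fixes g w :: "'x \<Rightarrow> real"
  assumes step: "\<And>L. 0 \<le> L \<Longrightarrow> (\<And>x. x \<in> S \<Longrightarrow> g x \<le> L * w x) \<Longrightarrow> (\<And>x. x \<in> S \<Longrightarrow> g x \<le> (r * L + B) * w x)"
    and init: "\<And>x. x \<in> S \<Longrightarrow> g x \<le> L0 * w x"
    and "0 \<le> r" "r < 1" "0 \<le> B" "0 \<le> L0" "\<And>x. x \<in> S \<Longrightarrow> 0 \<le> w x" "x \<in> S"
  shows "g x \<le> B / (1 - r) * w x"
proof -
  have ind: "\<forall>x\<in>S. g x \<le> (L0 * r ^ n + B / (1 - r)) * w x" for n
  proof (induction n)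
    case 0
    have "L0 * w x \<le> (L0 * r ^ 0 + B / (1 - r)) * w x" if "x \<in> S" for x
      using that assms by (intro mult_right_mono) auto
    then show ?case using init by force
  next
    case (Suc n)
    have "0 \<le> L0 * r ^ n + B / (1 - r)" using assms by auto
    moreover have "r * (L0 * r ^ n + B / (1 - r)) + B = L0 * r ^ Suc n + B / (1 - r)"
      using \<open>r < 1\<close> by (simp add: field_simps)
    ultimately show ?case using step[of "L0 * r ^ n + B / (1 - r)"] Suc by simp
  qed
  have "(\<lambda>n. (L0 * r ^ n + B / (1 - r)) * w x) \<longlonglongrightarrow> (L0 * 0 + B / (1 - r)) * w x"
    using assms by (intro tendsto_intros LIMSEQ_realpow_zero) auto
  then show ?thesis
    by (intro LIMSEQ_le_const[of "\<lambda>n. (L0 * r ^ n + B / (1 - r)) * w x"]) (use ind \<open>x \<in> S\<close> in auto)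
qed

lemma norm_le_defect:
  fixes a b c :: "'x::real_normed_vector"
  assumes "norm (a - b - c) \<le> B"
  shows "norm a \<le> norm b + norm c + B"
  using assms norm_triangle_ineq[of "a - b - c" "b + c"] norm_triangle_ineq[of b c] by simp

text \<open>The halving estimates see the equation only through these bounds. In the application
  \<open>F x\<close> is f(x), \<open>H x v a\<close> is (Df(x) v) a, and \<open>G x\<close>
  contracts Df(x) f(x) with the second level. \<open>G_tens\<close> matches Chen's tensor term with
  the first-order Taylor term of \<open>F\<close>; the four-point bounds \<open>G_lip2\<close> and
  \<open>taylor_lip\<close> serve to compare two solutions.\<close>

locale rough_coefficients =
  fixes F :: "'e::real_normed_vector \<Rightarrow> 'v::real_normed_vector \<Rightarrow> 'e"
    and G :: "'e \<Rightarrow> 'a::real_normed_vector \<Rightarrow> 'e"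
    and H :: "'e \<Rightarrow> 'e \<Rightarrow> 'v \<Rightarrow> 'e"
    and tens :: "'v \<Rightarrow> 'v \<Rightarrow> 'a"
    and c \<beta> :: real
  assumes beta: "1/3 < \<beta>" "\<beta> < 1/2" and c1: "1 \<le> c"
    and linear_F: "linear (F x)" and linear_G: "linear (G x)"
    and linear_H1: "linear (\<lambda>v. H x v a)" and linear_H2: "linear (H x v)"
    and F_bound: "norm (F x a) \<le> c * norm a"
    and F_lip: "norm (F x a - F y a) \<le> c * norm (x - y) * norm a"
    and G_bound: "norm (G x w) \<le> c * norm w"
    and G_lip: "norm (G x w - G y w) \<le> c * norm (x - y) * norm w"
    and G_lip2: "norm ((G y w - G x w) - (G y' w - G x' w))
      \<le> c * ((norm (x - x') + norm (y - y')) * norm (y - x) + norm ((y - x) - (y' - x'))) * norm w"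
    and H_bound: "norm (H x v a) \<le> c * norm v * norm a"
    and H_lip: "norm (H x v a - H y v a) \<le> c * norm (x - y) * norm v * norm a"
    and taylor_bound: "norm (F y a - F x a - H x (y - x) a) \<le> c * norm (y - x) ^ 2 * norm a"
    and taylor_lip: "norm ((F y a - F x a - H x (y - x) a) - (F y' a - F x' a - H x' (y' - x') a))
      \<le> c * ((norm (x - x') + norm (y - y')) * norm (y - x) ^ 2
              + norm ((y - x) - (y' - x')) * (norm (y - x) + norm (y' - x'))) * norm a"
    and G_tens: "G x (tens a b) = H x (F x a) b"
begin

lemmas lin_simps =
  linear_diff[OF linear_F] linear_diff[OF linear_G] linear_diff[OF linear_H1] linear_diff[OF linear_H2]
  linear_add[OF linear_F] linear_add[OF linear_G] linear_add[OF linear_H1] linear_add[OF linear_H2]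

section \<open>Drivers, remainders and their defect under subdivision\<close>

text \<open>Writing (t - s)^(2\<beta>) as the square of \<open>(t - s) powr \<beta>\<close> makes
  all later estimates polynomial in one quantity p and admits s = t, where the bound forces
  \<open>W s s = 0\<close>.\<close>

definition driver :: "real \<Rightarrow> real \<Rightarrow> (real \<Rightarrow> 'v) \<Rightarrow> (real \<Rightarrow> real \<Rightarrow> 'a) \<Rightarrow> bool" where
  "driver T M X W \<longleftrightarrow>
     (\<forall>s t. 0 \<le> s \<and> s \<le> t \<and> t \<le> T \<longrightarrow>
        norm (X t - X s) \<le> M * (t - s) powr \<beta> \<and> norm (W s t) \<le> M * ((t - s) powr \<beta>) ^ 2) \<and>
     (\<forall>s u t. 0 \<le> s \<and> s \<le> u \<and> u \<le> t \<and> t \<le> T \<longrightarrow>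
        W s t - W s u - W u t = tens (X u - X s) (X t - X u))"

definition J :: "(real \<Rightarrow> 'v) \<Rightarrow> (real \<Rightarrow> real \<Rightarrow> 'a) \<Rightarrow> (real \<Rightarrow> 'e) \<Rightarrow> real \<Rightarrow> real \<Rightarrow> 'e" where
  "J X W Y s t = Y t - Y s - F (Y s) (X t - X s) - G (Y s) (W s t)"

text \<open>The remainder of Y as a path controlled by X with derivative \<open>F (Y s)\<close>. It
  is of order 2\<beta> and equals \<open>J\<close> plus the area term
  \<open>G (Y s) (W s t)\<close>.\<close>

definition R :: "(real \<Rightarrow> 'v) \<Rightarrow> (real \<Rightarrow> 'e) \<Rightarrow> real \<Rightarrow> real \<Rightarrow> 'e" where
  "R X Y s t = Y t - Y s - F (Y s) (X t - X s)"

definition davie where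
  "davie T K h X W Y \<longleftrightarrow>
     (\<forall>s t. 0 \<le> s \<and> s \<le> t \<and> t \<le> T \<and> t - s \<le> h \<longrightarrow> norm (J X W Y s t) \<le> K * ((t - s) powr \<beta>) ^ 3)"

text \<open>Chen's relation produces \<open>G (Y s)\<close> of a tensor, which by
  \<open>G_tens\<close> is \<open>H (Y s)\<close> applied to the linear part of Y u - Y s. What
  remains is a Taylor remainder of \<open>F\<close>, the remainder \<open>R\<close> under
  \<open>H\<close>, and an increment of \<open>G\<close>, of orders 2\<beta> + \<beta>, 2\<beta> +
  \<beta> and \<beta> + 2\<beta>.\<close>

lemma J_defect:
  assumes "driver T M X W" "0 \<le> s" "s \<le> u" "u \<le> t" "t \<le> T"
  shows "J X W Y s t - J X W Y s u - J X W Y u t =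
    (F (Y u) (X t - X u) - F (Y s) (X t - X u) - H (Y s) (Y u - Y s) (X t - X u))
    + H (Y s) (R X Y s u) (X t - X u) + (G (Y u) (W u t) - G (Y s) (W u t))"
proof -
  have W: "W s t = W s u + W u t + tens (X u - X s) (X t - X u)"
    using assms unfolding driver_def by (smt (verit) add_diff_cancel_left' diff_diff_add diff_add_cancel)
  have F: "F (Y s) (X t - X s) = F (Y s) (X t - X u) + F (Y s) (X u - X s)"
    by (simp flip: linear_add[OF linear_F])
  have H: "H (Y s) (R X Y s u) (X t - X u) =
     H (Y s) (Y u - Y s) (X t - X u) - H (Y s) (F (Y s) (X u - X s)) (X t - X u)"
    unfolding R_def linear_diff[OF linear_H1] by simp
  show ?thesis
    unfolding J_def W F H linear_add[OF linear_G] G_tens by simp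
qed

text \<open>Two halves of an interval of length x contribute 2 (x/2)^(3\<beta>) = q x^(3\<beta>).
  The factor 2^(1 - 3\<beta>) is below 1 exactly because \<beta> > 1/3.\<close>

definition q :: real where "q = 2 * ((1/2) powr \<beta>) ^ 3"

lemma q_bounds: "0 < q" "q < 1"
proof -
  show "0 < q" unfolding q_def by simp
  have "((1/2::real) powr \<beta>) ^ 3 = (1/2) powr (3 * \<beta>)"
    by (simp add: powr_powr flip: powr_realpow)  (simp add: mult.commute)
  also have "\<dots> < (1/2) powr 1"
    using beta by (intro powr_less_mono') auto
  finally show "q < 1" unfolding q_def by simp
qed

lemma half_powr: "(x / 2) powr \<beta> = (1/2) powr \<beta> * x powr \<beta>" if "0 \<le> x"
  using powr_mult[of "1/2" x \<beta>] that by simp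

lemma halving: "2 * ((x / 2) powr \<beta>) ^ 3 = q * (x powr \<beta>) ^ 3" if "0 \<le> x"
  unfolding half_powr[OF that] q_def power_mult_distrib by simp

text \<open>Where K p \<le> 1, the term K p^3 is at most p^2 and is absorbed into the second-order
  bound. The resulting constants are free of K, so that K can afterwards be chosen in terms of M
  alone.\<close>

lemma increment_bounds:
  assumes d: "driver T M X W" and M: "1 \<le> M" and K: "0 \<le> K" and s: "0 \<le> s" "s \<le> u" "u \<le> T"
    and J: "norm (J X W Y s u) \<le> K * ((u - s) powr \<beta>) ^ 3"
    and p1: "(u - s) powr \<beta> \<le> 1" and Kp: "K * (u - s) powr \<beta> \<le> 1"
  shows "norm (Y u - Y s) \<le> (2 * c * M + 1) * (u - s) powr \<beta>"
    and "norm (R X Y s u) \<le> (c * M + 1) * ((u - s) powr \<beta>) ^ 2"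
proof -
  define p where "p = (u - s) powr \<beta>"
  have p: "0 \<le> p" "p \<le> 1" "K * p \<le> 1" using p1 Kp by (auto simp: p_def)
  have X: "norm (X u - X s) \<le> M * p" and W: "norm (W s u) \<le> M * p^2"
    using d s by (auto simp: driver_def p_def)
  have FX: "norm (F (Y s) (X u - X s)) \<le> c * (M * p)"
    using F_bound[of "Y s" "X u - X s"] X c1 by (meson mult_left_mono order_trans zero_le_one)
  have GW: "norm (G (Y s) (W s u)) \<le> c * (M * p^2)"
    using G_bound[of "Y s" "W s u"] W c1 by (meson mult_left_mono order_trans zero_le_one)
  have "K * p^3 = (K * p) * p^2" by (simp add: power2_eq_square power3_eq_cube)
  also have "\<dots> \<le> 1 * p^2" using p by (intro mult_right_mono) auto
  finally have K3: "K * p^3 \<le> p^2" by simp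
  have p2: "p^2 \<le> p" using p by (simp add: power2_eq_square mult_left_le)
  have J': "norm (J X W Y s u) \<le> p^2" using J K3 by (simp add: p_def)
  have "R X Y s u = J X W Y s u + G (Y s) (W s u)" by (simp add: R_def J_def)
  then have "norm (R X Y s u) \<le> norm (J X W Y s u) + norm (G (Y s) (W s u))"
    by (metis norm_triangle_ineq)
  then have R: "norm (R X Y s u) \<le> (c * M + 1) * p^2" using J' GW by (simp add: algebra_simps)
  then show "norm (R X Y s u) \<le> (c * M + 1) * ((u - s) powr \<beta>) ^ 2" by (simp add: p_def)
  have "Y u - Y s = R X Y s u + F (Y s) (X u - X s)" by (simp add: R_def)
  then have "norm (Y u - Y s) \<le> norm (R X Y s u) + norm (F (Y s) (X u - X s))"
    by (metis norm_triangle_ineq)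
  also have "\<dots> \<le> (c * M + 1) * p^2 + c * (M * p)" using R FX by simp
  also have "\<dots> \<le> (c * M + 1) * p + c * (M * p)" using p2 c1 M by (intro add_right_mono mult_left_mono) auto
  also have "\<dots> = (2 * c * M + 1) * p" by (simp add: algebra_simps)
  finally show "norm (Y u - Y s) \<le> (2 * c * M + 1) * (u - s) powr \<beta>" by (simp add: p_def)
qed

text \<open>The constant of \<open>defect_bound\<close> for the b = 2 c M + 1 and b' = c M + 1
  supplied by \<open>increment_bounds\<close>.\<close>

definition defect_const :: "real \<Rightarrow> real" where
  "defect_const M = c * M * ((2 * c * M + 1)^2 + (c * M + 1) + (2 * c * M + 1))"

text \<open>Each of the three terms of \<open>J_defect\<close> is of third order. The constants b
  and b' stay general because they come from different sources: small scales, global bounds, or the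
  definition of a controlled path.\<close>

lemma defect_bound:
  assumes d: "driver T M X W" and M: "0 \<le> M" and b: "0 \<le> b" "0 \<le> b'" and s: "0 \<le> s" "s \<le> u" "u \<le> t" "t \<le> T"
    and Y: "norm (Y u - Y s) \<le> b * (u - s) powr \<beta>"
    and R: "norm (R X Y s u) \<le> b' * ((u - s) powr \<beta>) ^ 2"
  shows "norm (J X W Y s t - J X W Y s u - J X W Y u t) \<le> c * M * (b^2 + b' + b) * ((t - s) powr \<beta>) ^ 3"
proof -
  define p where "p = (t - s) powr \<beta>"
  have p: "0 \<le> p" "(u - s) powr \<beta> \<le> p" "(t - u) powr \<beta> \<le> p"
    using s beta by (auto simp: p_def intro!: powr_mono2)
  have p2: "((u - s) powr \<beta>)^2 \<le> p^2" "((t - u) powr \<beta>)^2 \<le> p^2" using p by (auto intro: power_mono)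
  have Y: "norm (Y u - Y s) \<le> b * p" using Y p b by (meson mult_left_mono order_trans)
  have R: "norm (R X Y s u) \<le> b' * p^2" using R p2 b by (meson mult_left_mono order_trans)
  have "norm (X t - X u) \<le> M * (t - u) powr \<beta>" "norm (W u t) \<le> M * ((t - u) powr \<beta>)^2"
    using d s by (auto simp: driver_def)
  then have X: "norm (X t - X u) \<le> M * p" and W: "norm (W u t) \<le> M * p^2"
    using p p2 M by (meson mult_left_mono order_trans)+
  have "norm (F (Y u) (X t - X u) - F (Y s) (X t - X u) - H (Y s) (Y u - Y s) (X t - X u))
      \<le> c * norm (Y u - Y s)^2 * norm (X t - X u)" by (rule taylor_bound)
  also have "\<dots> \<le> c * (b * p)^2 * (M * p)"
    using X Y c1 b p M by (intro mult_mono power_mono) auto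
  finally have 1: "norm (F (Y u) (X t - X u) - F (Y s) (X t - X u) - H (Y s) (Y u - Y s) (X t - X u)) \<le> c * (b * p)^2 * (M * p)" .
  have "norm (H (Y s) (R X Y s u) (X t - X u)) \<le> c * norm (R X Y s u) * norm (X t - X u)" by (rule H_bound)
  also have "\<dots> \<le> c * (b' * p^2) * (M * p)"
    using X R c1 b p M by (intro mult_mono power_mono) auto
  finally have 2: "norm (H (Y s) (R X Y s u) (X t - X u)) \<le> c * (b' * p^2) * (M * p)" .
  have "norm (G (Y u) (W u t) - G (Y s) (W u t)) \<le> c * norm (Y u - Y s) * norm (W u t)" by (rule G_lip)
  also have "\<dots> \<le> c * (b * p) * (M * p^2)"
    using W Y c1 b p M by (intro mult_mono power_mono) auto
  finally have 3: "norm (G (Y u) (W u t) - G (Y s) (W u t)) \<le> c * (b * p) * (M * p^2)" .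
  have "norm (J X W Y s t - J X W Y s u - J X W Y u t) \<le> c * (b * p)^2 * (M * p) + c * (b' * p^2) * (M * p) + c * (b * p) * (M * p^2)"
    unfolding J_defect[OF d s] by (intro norm_triangle_le add_mono 1 2 3)
  also have "\<dots> = c * M * (b^2 + b' + b) * p ^ 3"
    by (simp add: algebra_simps power2_eq_square power3_eq_cube)
  finally show ?thesis by (simp add: p_def)
qed

text \<open>K is the fixed point of K \<mapsto> q K + \<open>defect_const M\<close>, so passing from
  the halves to the whole interval reproduces the same constant.\<close>

lemma davie_double:
  assumes d: "driver T M X W" and M: "1 \<le> M" and K: "K = defect_const M / (1 - q)"
    and h: "0 \<le> h" "h powr \<beta> \<le> 1" "K * h powr \<beta> \<le> 1" and D: "davie T K h X W Y"
  shows "davie T K (2 * h) X W Y"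
  unfolding davie_def
proof clarify
  fix s t :: real assume st: "0 \<le> s" "s \<le> t" "t \<le> T" "t - s \<le> 2 * h"
  define u where "u = (s + t) / 2"
  have u: "s \<le> u" "u \<le> t" "u - s = (t - s) / 2" "t - u = (t - s) / 2" "u - s \<le> h" "t - u \<le> h"
    using st by (auto simp: u_def field_simps)
  have C0: "0 \<le> defect_const M" using c1 M unfolding defect_const_def by (intro mult_nonneg_nonneg add_nonneg_nonneg) auto
  have K0: "0 \<le> K" unfolding K using q_bounds C0 by auto
  have p: "(u - s) powr \<beta> \<le> h powr \<beta>" using u beta by (intro powr_mono2) auto
  have J1: "norm (J X W Y s u) \<le> K * ((u - s) powr \<beta>) ^ 3" and J2: "norm (J X W Y u t) \<le> K * ((t - u) powr \<beta>) ^ 3"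
    using D st u by (auto simp: davie_def)
  have K1: "K * (u - s) powr \<beta> \<le> 1" using p K0 h by (meson mult_left_mono order_trans)
  have uT: "u \<le> T" "(u - s) powr \<beta> \<le> 1" using u st p h by auto
  note b = increment_bounds[OF d M K0 st(1) u(1) uT(1) J1 uT(2) K1]
  have "norm (J X W Y s t - J X W Y s u - J X W Y u t) \<le> defect_const M * ((t - s) powr \<beta>) ^ 3"
    unfolding defect_const_def by (rule defect_bound[OF d _ _ _ st(1) u(1,2) st(3) b]) (use c1 M in auto)
  then have "norm (J X W Y s t) \<le> norm (J X W Y s u) + norm (J X W Y u t) + defect_const M * ((t - s) powr \<beta>) ^ 3"
    by (rule norm_le_defect)
  also have "\<dots> \<le> K * (2 * (((t - s) / 2) powr \<beta>) ^ 3) + defect_const M * ((t - s) powr \<beta>) ^ 3"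
    using J1 J2 u by simp
  also have "\<dots> = (K * q + defect_const M) * ((t - s) powr \<beta>) ^ 3"
    using halving[of "t - s"] st by (simp add: algebra_simps)
  also have "K * q + defect_const M = K" using q_bounds unfolding K by (simp add: field_simps)
  finally show "norm (J X W Y s t) \<le> K * ((t - s) powr \<beta>) ^ 3" .
qed

lemma defect_const_ge1: "1 \<le> defect_const M" if "1 \<le> M"
proof -
  have "1 * 1 \<le> c * M" using c1 that by (intro mult_mono) auto
  moreover from this have "1 * 1 \<le> c * M * ((2 * c * M + 1)^2 + (c * M + 1) + (2 * c * M + 1))"
    by (intro mult_mono) (auto intro!: add_increasing add_nonneg_nonneg simp: mult.commute)
  ultimately show ?thesis unfolding defect_const_def by simp
qed

text \<open>The estimate propagates from scale \<open>h\<close> to \<open>2 h\<close> without loss as long as \<open>K h\<^sup>\<beta> \<le> 1\<close>, so a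
  non-quantitative bound at small scales already yields a bound depending on \<open>M\<close> only.\<close>

lemma apriori:
  assumes "1 \<le> M"
  obtains K h where "0 < K" "0 < h"
    "\<And>T X W Y L. driver T M X W \<Longrightarrow>
      (\<And>s t. 0 \<le> s \<Longrightarrow> s \<le> t \<Longrightarrow> t \<le> T \<Longrightarrow> norm (J X W Y s t) \<le> L * (t - s)\<^sup>2) \<Longrightarrow> davie T K h X W Y"
proof
  define K where "K = defect_const M / (1 - q)"
  have K1: "1 \<le> K"
    using defect_const_ge1[OF assms] q_bounds by (simp add: K_def pos_le_divide_eq)
  show "0 < K" using K1 by simp
  \<comment> \<open>Chosen so that K h^\<beta> = 1; since K \<ge> 1 this also gives h^\<beta> \<le>
    1, the other smallness condition of \<open>davie_double\<close>.\<close>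
  define h where "h = K powr (- 1 / \<beta>)"
  show h0: "0 < h" using K1 by (simp add: h_def)
  have "h powr \<beta> = K powr (- 1 / \<beta> * \<beta>)" unfolding h_def by (rule powr_powr)
  also have "- 1 / \<beta> * \<beta> = - 1" using beta by simp
  finally have hb: "h powr \<beta> = 1 / K" using K1 by (simp add: powr_minus_divide)
  fix T X W Y L
  assume d: "driver T M X W"
    and L: "\<And>s t. 0 \<le> s \<Longrightarrow> s \<le> t \<Longrightarrow> t \<le> T \<Longrightarrow> norm (J X W Y s t) \<le> L * (t - s)\<^sup>2"
  have dbl: "davie T K (h / 2 ^ n) X W Y \<Longrightarrow> davie T K h X W Y" for n
  proof (induction n)
    case (Suc n)
    have "h / 2 ^ Suc n \<le> h / 1" using h0 by (intro divide_left_mono) (auto intro!: one_le_power simp del: power_Suc)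
    then have "(h / 2 ^ Suc n) powr \<beta> \<le> h powr \<beta>"
      using h0 beta by (intro powr_mono2) auto
    then have p: "(h / 2 ^ Suc n) powr \<beta> \<le> 1 / K" by (simp add: hb)
    moreover have "1 / K \<le> 1" using K1 by simp
    ultimately have 1: "(h / 2 ^ Suc n) powr \<beta> \<le> 1" by linarith
    have 2: "K * (h / 2 ^ Suc n) powr \<beta> \<le> 1" using p K1 by (simp add: pos_le_divide_eq mult.commute)
    have "davie T K (2 * (h / 2 ^ Suc n)) X W Y"
      by (rule davie_double[OF d assms K_def _ 1 2 Suc.prems]) (use h0 in simp)
    then show ?case using Suc.IH by simp
  qed simp
  \<comment> \<open>The exponent 2 - 3\<beta> is positive, so at a small enough scale h / 2^n any L
    is beaten by K. The depth n depends on L, whereas K and h do not.\<close>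
  have "(1/2::real) powr (2 - 3 * \<beta>) < 1"
    using powr_less_mono'[of "1/2" 0 "2 - 3 * \<beta>"] beta by simp
  then have "(\<lambda>n. \<bar>L\<bar> * (h powr (2 - 3 * \<beta>) * ((1/2) powr (2 - 3 * \<beta>)) ^ n)) \<longlonglongrightarrow> \<bar>L\<bar> * (h powr (2 - 3 * \<beta>) * 0)"
    by (intro tendsto_mult_left LIMSEQ_realpow_zero) auto
  moreover have "(h / 2 ^ n) powr (2 - 3 * \<beta>) = h powr (2 - 3 * \<beta>) * ((1/2) powr (2 - 3 * \<beta>)) ^ n" for n
  proof -
    have "((1/2::real) ^ n) powr (2 - 3 * \<beta>) = ((1/2) powr (2 - 3 * \<beta>)) ^ n"
      by (subst powr_realpow[symmetric]) (auto simp only: powr_powr powr_power mult.commute)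
    then show ?thesis
      using h0 powr_mult[of h "(1/2) ^ n" "2 - 3 * \<beta>"] by (simp add: power_one_over)
  qed
  ultimately have "(\<lambda>n. \<bar>L\<bar> * (h / 2 ^ n) powr (2 - 3 * \<beta>)) \<longlonglongrightarrow> 0"
    by simp
  then have "\<forall>\<^sub>F n in sequentially. \<bar>L\<bar> * (h / 2 ^ n) powr (2 - 3 * \<beta>) < K"
    using K1 by (intro order_tendstoD) auto
  then obtain n where n: "\<bar>L\<bar> * (h / 2 ^ n) powr (2 - 3 * \<beta>) < K"
    by (auto simp: eventually_sequentially)
  have "davie T K (h / 2 ^ n) X W Y"
    unfolding davie_def
  proof clarify
    fix s t :: real assume st: "0 \<le> s" "s \<le> t" "t \<le> T" "t - s \<le> h / 2 ^ n"
    have "norm (J X W Y s t) \<le> \<bar>L\<bar> * (t - s)\<^sup>2"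
      using L[OF st(1-3)] by (meson abs_ge_self mult_right_mono order_trans zero_le_power2)
    also have "(t - s)\<^sup>2 = (t - s) powr (2 - 3 * \<beta>) * ((t - s) powr \<beta>) ^ 3"
    proof (cases "s = t")
      case False
      then have "0 < t - s" using st by simp
      moreover have "((t - s) powr \<beta>) ^ 3 = (t - s) powr (3 * \<beta>)" using False by (simp add: powr_power)
      ultimately show ?thesis using powr_realpow[of "t - s" 2] by (simp flip: powr_add)
    qed simp
    also have "\<bar>L\<bar> * ((t - s) powr (2 - 3 * \<beta>) * ((t - s) powr \<beta>) ^ 3)
        \<le> \<bar>L\<bar> * ((h / 2 ^ n) powr (2 - 3 * \<beta>) * ((t - s) powr \<beta>) ^ 3)"
      using st beta by (intro mult_left_mono mult_right_mono powr_mono2) auto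
    also have "\<dots> \<le> K * ((t - s) powr \<beta>) ^ 3"
      unfolding mult.assoc[symmetric] using n by (intro mult_right_mono) auto
    finally show "norm (J X W Y s t) \<le> K * ((t - s) powr \<beta>) ^ 3" .
  qed
  then show "davie T K h X W Y" by (rule dbl)
qed

section \<open>Comparison of two remainders over one subdivision\<close>

text \<open>A bound \<rho> on each of the two terms of the rough path distance over [0,T], stated
  without suprema and with s = t included.\<close>

definition close where
  "close T \<rho> X W X' W' \<longleftrightarrow>
     (\<forall>s t. 0 \<le> s \<and> s \<le> t \<and> t \<le> T \<longrightarrow>
        norm ((X t - X s) - (X' t - X' s)) \<le> \<rho> * (t - s) powr \<beta> \<and>
        norm (W s t - W' s t) \<le> \<rho> * ((t - s) powr \<beta>)\<^sup>2)"

lemma F_diff_bound: "norm (F x a - F y b) \<le> c * norm (x - y) * norm a + c * norm (a - b)"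
proof -
  have "F x a - F y b = (F x a - F y a) + F y (a - b)" by (simp add: lin_simps)
  then show ?thesis using F_lip[of x a y] F_bound[of y "a - b"] norm_triangle_le add_mono by metis
qed

lemma G_diff_bound: "norm (G x a - G y b) \<le> c * norm (x - y) * norm a + c * norm (a - b)"
proof -
  have "G x a - G y b = (G x a - G y a) + G y (a - b)" by (simp add: lin_simps)
  then show ?thesis using G_lip[of x a y] G_bound[of y "a - b"] norm_triangle_le add_mono by metis
qed

text \<open>The splitting Y = \<open>R\<close> + \<open>F\<close>, \<open>R\<close> =
  \<open>J\<close> + \<open>G\<close> is applied to differences. Here l, the constant about to be
  improved, is not absorbed but kept in E with a factor p; on short intervals this factor makes its
  contribution small.\<close>

lemma increment_diff_bounds:
  assumes d: "driver T M X W" "driver T M X' W'" and cl: "close T \<rho> X W X' W'"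
    and M: "1 \<le> M" and nn: "0 \<le> \<rho>" "0 \<le> D" "0 \<le> l" and s: "0 \<le> s" "s \<le> u" "u \<le> T"
    and D: "norm (Y s - Y' s) \<le> D"
    and J: "norm (J X W Y s u - J X' W' Y' s u) \<le> l * ((u - s) powr \<beta>) ^ 3"
    and p1: "(u - s) powr \<beta> \<le> 1"
  defines "p \<equiv> (u - s) powr \<beta>"
  defines "E \<equiv> 2 * c * M * (D + \<rho>) + l * p"
  shows "norm ((Y u - Y s) - (Y' u - Y' s)) \<le> E * p"
    and "norm (R X Y s u - R X' Y' s u) \<le> E * p\<^sup>2"
proof -
  have p: "0 \<le> p" "p \<le> 1" using p1 by (auto simp: p_def)
  have X: "norm (X u - X s) \<le> M * p" and W: "norm (W s u) \<le> M * p^2"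
    using d s by (auto simp: driver_def p_def)
  have dX: "norm ((X u - X s) - (X' u - X' s)) \<le> \<rho> * p" and dW: "norm (W s u - W' s u) \<le> \<rho> * p^2"
    using cl s by (auto simp: close_def p_def)
  have cM: "c \<le> c * M" using c1 M by simp
  have "norm (F (Y s) (X u - X s) - F (Y' s) (X' u - X' s)) \<le> c * norm (Y s - Y' s) * norm (X u - X s) + c * norm ((X u - X s) - (X' u - X' s))"
    by (rule F_diff_bound)
  also have "\<dots> \<le> c * D * (M * p) + c * (\<rho> * p)"
    using X dX D c1 nn p by (intro add_mono mult_mono mult_left_mono) auto
  also have "\<dots> = c * M * D * p + c * \<rho> * p" by simp
  also have "\<dots> \<le> c * M * D * p + c * M * \<rho> * p"
    using cM nn p by (intro add_left_mono mult_right_mono) auto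
  also have "\<dots> = c * M * (D + \<rho>) * p" by (simp add: algebra_simps)
  finally have F: "norm (F (Y s) (X u - X s) - F (Y' s) (X' u - X' s)) \<le> c * M * (D + \<rho>) * p" .
  have "norm (G (Y s) (W s u) - G (Y' s) (W' s u)) \<le> c * norm (Y s - Y' s) * norm (W s u) + c * norm (W s u - W' s u)"
    by (rule G_diff_bound)
  also have "\<dots> \<le> c * D * (M * p^2) + c * (\<rho> * p^2)"
    using W dW D c1 nn p by (intro add_mono mult_mono mult_left_mono) auto
  also have "\<dots> = c * M * D * p^2 + c * \<rho> * p^2" by simp
  also have "\<dots> \<le> c * M * D * p^2 + c * M * \<rho> * p^2"
    using cM nn p by (intro add_left_mono mult_right_mono) auto
  also have "\<dots> = c * M * (D + \<rho>) * p^2" by (simp add: algebra_simps)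
  finally have G: "norm (G (Y s) (W s u) - G (Y' s) (W' s u)) \<le> c * M * (D + \<rho>) * p^2" .
  have "R X Y s u - R X' Y' s u = (J X W Y s u - J X' W' Y' s u) + (G (Y s) (W s u) - G (Y' s) (W' s u))"
    by (simp add: R_def J_def)
  then have "norm (R X Y s u - R X' Y' s u) \<le> l * p^3 + c * M * (D + \<rho>) * p^2"
    using J G norm_triangle_le add_mono unfolding p_def by metis
  then have R: "norm (R X Y s u - R X' Y' s u) \<le> (c * M * (D + \<rho>) + l * p) * p^2"
    by (simp add: algebra_simps power2_eq_square power3_eq_cube)
  have cMD: "0 \<le> c * M * (D + \<rho>)" using c1 M nn by simp
  show "norm (R X Y s u - R X' Y' s u) \<le> E * p^2"
  proof (rule order_trans[OF R], rule mult_right_mono)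
    have "E = 2 * (c * M * (D + \<rho>)) + l * p" by (simp add: E_def)
    then show "c * M * (D + \<rho>) + l * p \<le> E" using cMD by linarith
  qed simp
  have "p^2 \<le> p" using p by (simp add: power2_eq_square mult_left_le)
  then have R1: "norm (R X Y s u - R X' Y' s u) \<le> (c * M * (D + \<rho>) + l * p) * p"
    using R cMD nn p by (meson mult_left_mono order_trans add_nonneg_nonneg mult_nonneg_nonneg)
  have "(Y u - Y s) - (Y' u - Y' s) = (R X Y s u - R X' Y' s u) + (F (Y s) (X u - X s) - F (Y' s) (X' u - X' s))"
    by (simp add: R_def)
  then have "norm ((Y u - Y s) - (Y' u - Y' s)) \<le> (c * M * (D + \<rho>) + l * p) * p + c * M * (D + \<rho>) * p"
    using R1 F norm_triangle_le add_mono by metis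
  also have "\<dots> = E * p" by (simp add: E_def algebra_simps)
  finally show "norm ((Y u - Y s) - (Y' u - Y' s)) \<le> E * p" .
qed

text \<open>The difference of two defects is linear in E, the size of the difference of solutions
  and drivers, and still of third order in time. Linearity in E is what turns the halving argument
  into a Lipschitz estimate.\<close>

lemma defect_diff_bound:
  assumes d: "driver T M X W" "driver T M X' W'" and cl: "close T \<rho> X W X' W'"
    and M: "1 \<le> M" and nn: "0 \<le> \<rho>" "0 \<le> D" "0 \<le> E" "1 \<le> b"
    and s: "0 \<le> s" "s \<le> u" "u \<le> t" "t \<le> T"
    and D: "norm (Y s - Y' s) \<le> D" "norm (Y u - Y' u) \<le> D"
    and E: "D \<le> E" "\<rho> \<le> E"
  defines "p \<equiv> (t - s) powr \<beta>"
  assumes Y: "norm (Y u - Y s) \<le> b * p" "norm (Y' u - Y' s) \<le> b * p"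
    and R: "norm (R X' Y' s u) \<le> b * p\<^sup>2" "norm (R X Y s u) \<le> b * p\<^sup>2"
    and dY: "norm ((Y u - Y s) - (Y' u - Y' s)) \<le> E * p"
    and dR: "norm (R X Y s u - R X' Y' s u) \<le> E * p\<^sup>2"
  shows "norm ((J X W Y s t - J X' W' Y' s t) - (J X W Y s u - J X' W' Y' s u) - (J X W Y u t - J X' W' Y' u t))
     \<le> 12 * c * b\<^sup>2 * M * E * p ^ 3"
proof -
  define a a' w w' where "a = X t - X u" and "a' = X' t - X' u" and "w = W u t" and "w' = W' u t"
  have p: "0 \<le> p" "(t - u) powr \<beta> \<le> p"
    using s beta by (auto simp: p_def intro!: powr_mono2)
  have p2: "((t - u) powr \<beta>)^2 \<le> p^2" using p by (auto intro: power_mono)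
  have "norm a \<le> M * (t - u) powr \<beta>" "norm w \<le> M * ((t - u) powr \<beta>)^2"
    "norm w' \<le> M * ((t - u) powr \<beta>)^2"
    using d s by (auto simp: driver_def a_def w_def w'_def)
  then have a: "norm a \<le> M * p" and w: "norm w \<le> M * p^2"
    using p p2 M by (meson mult_left_mono order_trans zero_le_one)+
  have "norm (a - a') \<le> \<rho> * (t - u) powr \<beta>" "norm (w - w') \<le> \<rho> * ((t - u) powr \<beta>)^2"
    using cl s by (auto simp: close_def a_def a'_def w_def w'_def)
  then have da: "norm (a - a') \<le> E * p" and dw: "norm (w - w') \<le> E * p^2"
    using mult_mono[OF E(2) p(2)] mult_mono[OF E(2) p2] nn p by auto
  have b0: "0 \<le> b" using nn by simp
  define t1 where "t1 = F (Y u) a - F (Y s) a - H (Y s) (Y u - Y s) a"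
  define t1' where "t1' = F (Y' u) a' - F (Y' s) a' - H (Y' s) (Y' u - Y' s) a'"
  define t2 where "t2 = H (Y s) (R X Y s u) a"
  define t2' where "t2' = H (Y' s) (R X' Y' s u) a'"
  define t3 where "t3 = G (Y u) w - G (Y s) w"
  define t3' where "t3' = G (Y' u) w' - G (Y' s) w'"
  \<comment> \<open>Here and for the next two pairs, the solutions are exchanged with the driver
    increment fixed; the change of the increment is then split off by linearity.\<close>
  have "t1 - t1' = ((F (Y u) a - F (Y s) a - H (Y s) (Y u - Y s) a) - (F (Y' u) a - F (Y' s) a - H (Y' s) (Y' u - Y' s) a))
     + (F (Y' u) (a - a') - F (Y' s) (a - a') - H (Y' s) (Y' u - Y' s) (a - a'))"
    by (simp add: lin_simps t1_def t1'_def)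
  then have "norm (t1 - t1') \<le> c * ((norm (Y s - Y' s) + norm (Y u - Y' u)) * norm (Y u - Y s) ^ 2
              + norm ((Y u - Y s) - (Y' u - Y' s)) * (norm (Y u - Y s) + norm (Y' u - Y' s))) * norm a
      + c * norm (Y' u - Y' s) ^ 2 * norm (a - a')"
    using taylor_lip taylor_bound norm_triangle_le add_mono by metis
  also have "\<dots> \<le> c * ((E + E) * (b * p)^2 + (E * p) * (b * p + b * p)) * (M * p) + c * (b * p)^2 * (E * p)"
    using c1 M nn b0 p D E Y a da dY
    by (intro add_mono mult_mono mult_left_mono power_mono add_nonneg_nonneg mult_nonneg_nonneg) auto
  also have "\<dots> = c * E * p^3 * (2 * b^2 * M + 2 * b * M + b^2)"
    by (simp add: algebra_simps power2_eq_square power3_eq_cube)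
  finally have 1: "norm (t1 - t1') \<le> c * E * p^3 * (2 * b^2 * M + 2 * b * M + b^2)" .
  have "t2 - t2' = (H (Y s) (R X Y s u) a - H (Y' s) (R X Y s u) a) + H (Y' s) (R X Y s u - R X' Y' s u) a
     + H (Y' s) (R X' Y' s u) (a - a')"
    by (simp add: lin_simps t2_def t2'_def)
  then have "norm (t2 - t2') \<le> c * norm (Y s - Y' s) * norm (R X Y s u) * norm a
     + c * norm (R X Y s u - R X' Y' s u) * norm a + c * norm (R X' Y' s u) * norm (a - a')"
    using H_lip H_bound norm_triangle_le add_mono by metis
  also have "\<dots> \<le> c * E * (b * p^2) * (M * p) + c * (E * p^2) * (M * p) + c * (b * p^2) * (E * p)"
    using c1 M nn b0 p D E R a da dR
    by (intro add_mono mult_mono mult_left_mono mult_nonneg_nonneg) auto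
  also have "\<dots> = c * E * p^3 * (b * M + M + b)"
    by (simp add: algebra_simps power2_eq_square power3_eq_cube)
  finally have 2: "norm (t2 - t2') \<le> c * E * p^3 * (b * M + M + b)" .
  have "t3 - t3' = ((G (Y u) w - G (Y s) w) - (G (Y' u) w - G (Y' s) w)) + (G (Y' u) (w - w') - G (Y' s) (w - w'))"
    by (simp add: lin_simps t3_def t3'_def)
  then have "norm (t3 - t3') \<le> c * ((norm (Y s - Y' s) + norm (Y u - Y' u)) * norm (Y u - Y s) + norm ((Y u - Y s) - (Y' u - Y' s))) * norm w
      + c * norm (Y' u - Y' s) * norm (w - w')"
    using G_lip2 G_lip norm_triangle_le add_mono by metis
  also have "\<dots> \<le> c * ((E + E) * (b * p) + E * p) * (M * p^2) + c * (b * p) * (E * p^2)"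
    using c1 M nn b0 p D E Y w dw dY
    by (intro add_mono mult_mono mult_left_mono add_nonneg_nonneg mult_nonneg_nonneg) auto
  also have "\<dots> = c * E * p^3 * (2 * b * M + M + b)"
    by (simp add: algebra_simps power2_eq_square power3_eq_cube)
  finally have 3: "norm (t3 - t3') \<le> c * E * p^3 * (2 * b * M + M + b)" .
  have "1 * b \<le> b * b" "1 * 1 \<le> b * b" using nn by (intro mult_mono; simp)+
  then have bb: "b \<le> b^2" "1 \<le> b^2" by (auto simp: power2_eq_square)
  have bM: "b \<le> b^2 * M" "b^2 \<le> b^2 * M" "b * M \<le> b^2 * M" "M \<le> b^2 * M"
    using mult_mono[of b "b^2" 1 M] mult_mono[of "b^2" "b^2" 1 M] mult_mono[of b "b^2" M M] mult_mono[of 1 "b^2" M M] bb M b0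
    by auto
  have "(J X W Y s t - J X' W' Y' s t) - (J X W Y s u - J X' W' Y' s u) - (J X W Y u t - J X' W' Y' u t)
    = (J X W Y s t - J X W Y s u - J X W Y u t) - (J X' W' Y' s t - J X' W' Y' s u - J X' W' Y' u t)"
    by simp
  also have "\<dots> = (t1 - t1') + (t2 - t2') + (t3 - t3')"
    unfolding J_defect[OF d(1) s] J_defect[OF d(2) s]
    by (simp add: a_def a'_def w_def w'_def t1_def t1'_def t2_def t2'_def t3_def t3'_def)
  also have "norm \<dots> \<le> c * E * p^3 * (2 * b^2 * M + 2 * b * M + b^2) + c * E * p^3 * (b * M + M + b) + c * E * p^3 * (2 * b * M + M + b)"
    by (intro norm_triangle_le add_mono 1 2 3)
  also have "\<dots> = c * E * p^3 * (2 * (b^2 * M) + 5 * (b * M) + b^2 + 2 * M + 2 * b)"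
    by (simp add: algebra_simps)
  \<comment> \<open>As b and M are at least 1, each monomial is at most b^2 M, and 2 + 5 + 1 + 2 + 2
    = 12.\<close>
  also have "2 * (b^2 * M) + 5 * (b * M) + b^2 + 2 * M + 2 * b \<le> 12 * (b^2 * M)"
    using bM by linarith
  then have "c * E * p^3 * (2 * (b^2 * M) + 5 * (b * M) + b^2 + 2 * M + 2 * b) \<le> c * E * p^3 * (12 * (b^2 * M))"
    using c1 nn p by (intro mult_left_mono) auto
  finally show ?thesis by (simp add: mult_ac)
qed

end

section \<open>Stability\<close>

context rough_coefficients
begin

text \<open>Two nested contractions on a short interval: a bound B for the sup norm of the
  difference controls its third-order remainder by halving and hence its increments, and these
  increments in turn improve B. The length l depends only on M, K and h, so the estimate can be
  chained.\<close>

lemma stability_local: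
  assumes M: "1 \<le> M" and K: "0 < K" and h: "0 < h"
  obtains l C where "0 < l" "1 \<le> C"
    "\<And>T \<rho> X W X' W' Y Y' a s t. driver T M X W \<Longrightarrow> driver T M X' W' \<Longrightarrow> close T \<rho> X W X' W' \<Longrightarrow>
      davie T K h X W Y \<Longrightarrow> davie T K h X' W' Y' \<Longrightarrow> 0 \<le> \<rho> \<Longrightarrow>
      0 \<le> a \<Longrightarrow> a \<le> s \<Longrightarrow> s \<le> t \<Longrightarrow> t \<le> T \<Longrightarrow> t \<le> a + l \<Longrightarrow>
      norm (Y s - Y' s) \<le> 2 * norm (Y a - Y' a) + \<rho> \<and>
      norm ((Y t - Y s) - (Y' t - Y' s)) \<le> C * (norm (Y a - Y' a) + \<rho>) * (t - s) powr \<beta>"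
proof -
  define b where "b = 2 * c * M + 1"
  define C2 where "C2 = 12 * c * b\<^sup>2 * M"
  define C3 where "C3 = C2 * (2 * c * M)"
  define C4 where "C4 = 2 * c * M + 2 * C3 / (1 - q)"
  have cM: "1 \<le> c * M" using c1 M mult_mono[of 1 c 1 M] by simp
  have b: "1 \<le> b" "c * M + 1 \<le> b" using cM unfolding b_def mult.assoc by linarith+
  have C2: "0 < C2" unfolding C2_def using b c1 M by (intro mult_pos_pos) auto
  have C3: "0 < C3" unfolding C3_def using C2 c1 M by (intro mult_pos_pos) auto
  have "0 \<le> 2 * C3 / (1 - q)" using C3 q_bounds by simp
  then have C4: "1 \<le> C4" using cM unfolding C4_def by linarith
  \<comment> \<open>The four entries yield, in order: p \<le> 1; the condition K p \<le> 1 of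
    \<open>increment_bounds\<close>; rate (1 + q) / 2 for the contraction of remainders; rate 1/2
    for the contraction of the sup norm.\<close>
  define e where "e = min (min 1 (1 / K)) (min ((1 - q) / (2 * C2)) (1 / (2 * C4)))"
  have e0: "0 < e" using K C2 C4 q_bounds by (auto simp: e_def)
  have e: "e \<le> 1" "K * e \<le> 1" "C2 * e \<le> (1 - q) / 2" "C4 * e \<le> 1 / 2"
  proof -
    have "e \<le> 1 / K" "e \<le> (1 - q) / (2 * C2)" "e \<le> 1 / (2 * C4)" "e \<le> 1" by (auto simp: e_def)
    then show "e \<le> 1" "K * e \<le> 1" "C2 * e \<le> (1 - q) / 2" "C4 * e \<le> 1 / 2"
      using K C2 C4 by (auto simp: field_simps)
  qed
  define l where "l = min h (e powr (1 / \<beta>))"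
  have l: "0 < l" "l \<le> h" using e0 h by (auto simp: l_def)
  have "(e powr (1 / \<beta>)) powr \<beta> = e" using e0 beta by (simp add: powr_powr)
  then have le: "l powr \<beta> \<le> e"
    using powr_mono2[of \<beta> l "e powr (1 / \<beta>)"] beta l by (simp add: l_def)
  have local: "norm (Y s - Y' s) \<le> 2 * norm (Y a - Y' a) + \<rho> \<and>
      norm ((Y t - Y s) - (Y' t - Y' s)) \<le> (2 * C4) * (norm (Y a - Y' a) + \<rho>) * (t - s) powr \<beta>"
    if d: "driver T M X W" "driver T M X' W'" and cl: "close T \<rho> X W X' W'"
      and D: "davie T K h X W Y" "davie T K h X' W' Y'" and \<rho>: "0 \<le> \<rho>"
      and st: "0 \<le> a" "a \<le> s" "s \<le> t" "t \<le> T" "t \<le> a + l"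
    for T \<rho> X W X' W' Y Y' a s t
  proof -
    define z where "z = min T (a + l)"
    define \<Delta> where "\<Delta> r = Y r - Y' r" for r
    have p: "(t - s) powr \<beta> \<le> e" if "a \<le> s" "s \<le> t" "t \<le> z" for s t
      using powr_mono2[of \<beta> "t - s" l] that beta le by (auto simp: z_def)
    have p1: "(t - s) powr \<beta> \<le> 1" if "a \<le> s" "s \<le> t" "t \<le> z" for s t
      using p[OF that] e by simp
    have pK: "K * (t - s) powr \<beta> \<le> 1" if "a \<le> s" "s \<le> t" "t \<le> z" for s t
      using order_trans[OF mult_left_mono[OF p[OF that]] e(2)] K by simp
    have Jb: "norm (J X W Y s t) \<le> K * ((t - s) powr \<beta>) ^ 3" "norm (J X' W' Y' s t) \<le> K * ((t - s) powr \<beta>) ^ 3"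
      if "a \<le> s" "s \<le> t" "t \<le> z" for s t
      using D that st(1) l by (auto simp: davie_def z_def)
    have b0: "0 \<le> b" using b by simp
    have YR: "norm (Y t - Y s) \<le> b * (t - s) powr \<beta>" "norm (Y' t - Y' s) \<le> b * (t - s) powr \<beta>"
      "norm (R X Y s t) \<le> b * ((t - s) powr \<beta>)\<^sup>2" "norm (R X' Y' s t) \<le> b * ((t - s) powr \<beta>)\<^sup>2"
      if s: "a \<le> s" "s \<le> t" "t \<le> z" for s t
    proof -
      have s': "0 \<le> s" "t \<le> T" using s st(1) by (auto simp: z_def)
      note 1 = increment_bounds[OF d(1) M less_imp_le[OF K] s'(1) s(2) s'(2) Jb(1)[OF s] p1[OF s] pK[OF s]]
      note 2 = increment_bounds[OF d(2) M less_imp_le[OF K] s'(1) s(2) s'(2) Jb(2)[OF s] p1[OF s] pK[OF s]]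
      show "norm (Y t - Y s) \<le> b * (t - s) powr \<beta>" "norm (Y' t - Y' s) \<le> b * (t - s) powr \<beta>"
        using 1 2 by (auto simp: b_def)
      show "norm (R X Y s t) \<le> b * ((t - s) powr \<beta>)\<^sup>2" "norm (R X' Y' s t) \<le> b * ((t - s) powr \<beta>)\<^sup>2"
        using 1(2) 2(2) mult_right_mono[OF b(2), of "((t - s) powr \<beta>)\<^sup>2"] by auto
    qed
    have inc: "norm (\<Delta> t - \<Delta> s) \<le> C4 * (B + \<rho>) * (t - s) powr \<beta>"
      if B: "0 \<le> B" "\<And>r. a \<le> r \<Longrightarrow> r \<le> z \<Longrightarrow> norm (\<Delta> r) \<le> B"
        and s0: "a \<le> s" "s \<le> t" "t \<le> z" for B s t
    proof -
      define j where "j s t = J X W Y s t - J X' W' Y' s t" for s t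
      define L where "L = C3 * (B + \<rho>) / (1 - (1 + q) / 2)"
      define S where "S = {(s, t). a \<le> s \<and> s \<le> t \<and> t \<le> z}"
      have stepj: "norm (j s t) \<le> ((1 + q) / 2 * L + C3 * (B + \<rho>)) * ((t - s) powr \<beta>) ^ 3"
        if L: "0 \<le> L" "\<And>s t. a \<le> s \<Longrightarrow> s \<le> t \<Longrightarrow> t \<le> z \<Longrightarrow> norm (j s t) \<le> L * ((t - s) powr \<beta>) ^ 3"
          and s1: "a \<le> s" "s \<le> t" "t \<le> z" for L s t
      proof -
        define u where "u = (s + t) / 2"
        have u: "s \<le> u" "u \<le> t" "u - s = (t - s) / 2" "t - u = (t - s) / 2" "u \<le> z" "a \<le> u"
          using s1 by (auto simp: u_def field_simps)
        have T: "0 \<le> s" "u \<le> T" "t \<le> T" using s1 st(1) u by (auto simp: z_def)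
        define p where "p = (t - s) powr \<beta>"
        define p' where "p' = (u - s) powr \<beta>"
        have p': "0 \<le> p'" "p' \<le> p" unfolding p'_def p_def using u s1 beta by (auto intro!: powr_mono2)
        have pe: "p \<le> e" unfolding p_def by (rule p[OF s1])
        have p2: "p'^2 \<le> p^2" using p' by (intro power_mono)
        define E where "E = 2 * c * M * (B + \<rho>) + L * p"
        define E' where "E' = 2 * c * M * (B + \<rho>) + L * p'"
        have "B + \<rho> \<le> (2 * c * M) * (B + \<rho>)" using mult_right_mono[of 1 "2 * c * M" "B + \<rho>"] cM B(1) \<rho> by simp
        moreover have "0 \<le> L * p'" "L * p' \<le> L * p" using L p' by (auto intro: mult_left_mono)
        ultimately have E: "0 \<le> E'" "E' \<le> E" "B \<le> E" "\<rho> \<le> E" "0 \<le> E"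
          using B(1) \<rho> by (auto simp: E_def E'_def)
        have \<Delta>: "norm (Y s - Y' s) \<le> B" "norm (Y u - Y' u) \<le> B"
          using B(2)[of s] B(2)[of u] s1 u by (auto simp: \<Delta>_def)
        note id = increment_diff_bounds[OF d cl M \<rho> B(1) L(1) T(1) u(1) T(2) \<Delta>(1)
           L(2)[OF s1(1) u(1) u(5), unfolded j_def] p1[OF s1(1) u(1) u(5)], folded p'_def, folded E'_def]
        note yr = YR[OF s1(1) u(1) u(5), folded p'_def]
        have "b * p' \<le> b * p" "b * p'^2 \<le> b * p^2" "E' * p' \<le> E * p" "E' * p'^2 \<le> E * p^2"
          using b0 E p' p2 by (auto intro!: mult_mono)
        then have i: "norm (Y u - Y s) \<le> b * p" "norm (Y' u - Y' s) \<le> b * p"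
           "norm (R X' Y' s u) \<le> b * p\<^sup>2" "norm (R X Y s u) \<le> b * p\<^sup>2"
           "norm ((Y u - Y s) - (Y' u - Y' s)) \<le> E * p"
           "norm (R X Y s u - R X' Y' s u) \<le> E * p\<^sup>2"
          using id yr by linarith+
        have "norm (j s t - j s u - j u t) \<le> 12 * c * b\<^sup>2 * M * E * p ^ 3"
          unfolding j_def p_def
          by (rule defect_diff_bound[OF d cl M \<rho> B(1) E(5) b(1) T(1) u(1,2) T(3) \<Delta> E(3,4)])
             (use i in \<open>simp_all add: p_def\<close>)
        then have "norm (j s t) \<le> norm (j s u) + norm (j u t) + 12 * c * b\<^sup>2 * M * E * p ^ 3"
          by (rule norm_le_defect)
        also have "norm (j s u) + norm (j u t) \<le> L * (2 * (((t - s) / 2) powr \<beta>) ^ 3)"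
          using L(2)[OF s1(1) u(1,5)] L(2)[OF u(6,2) s1(3)] unfolding u(3,4) by simp
        also have "\<dots> = q * L * p ^ 3"
          using halving[of "t - s"] s1 unfolding p_def by simp
        also have "12 * c * b\<^sup>2 * M * E * p ^ 3 = (C3 * (B + \<rho>) + C2 * p * L) * p ^ 3"
          by (simp add: E_def C2_def C3_def algebra_simps)
        \<comment> \<open>The shortness of the interval enters here: together with the q L of the
          two halves, the total coefficient of L is q + (1 - q) / 2 = (1 + q) / 2 < 1.\<close>
        also have "\<dots> \<le> (C3 * (B + \<rho>) + (1 - q) / 2 * L) * p ^ 3"
        proof -
          have "C2 * p \<le> (1 - q) / 2" using order_trans[OF mult_left_mono[OF pe] e(3)] C2 by simp
          then show ?thesis using L p' by (intro mult_right_mono add_left_mono) auto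
        qed
        finally show ?thesis unfolding p_def by (simp add: algebra_simps add_divide_distrib diff_divide_distrib)
      qed
      have jb: "norm (j s t) \<le> L * ((t - s) powr \<beta>) ^ 3" if "a \<le> s" "s \<le> t" "t \<le> z" for s t
      proof -
        \<comment> \<open>The two individual Davie bounds give the start 2 K. It does not shrink
          with the data, but the contraction forgets it and leaves a multiple of B + \<rho>.\<close>
        have "(\<lambda>(s, t). norm (j s t)) (s, t) \<le> C3 * (B + \<rho>) / (1 - (1 + q) / 2) * (\<lambda>(s, t). ((t - s) powr \<beta>) ^ 3) (s, t)"
        proof (rule bound_by_contraction[where S = S and ?L0.0 = "2 * K"])
          fix L x assume "0 \<le> L" "\<And>x. x \<in> S \<Longrightarrow> (\<lambda>(s, t). norm (j s t)) x \<le> L * (case x of (s, t) \<Rightarrow> ((t - s) powr \<beta>) ^ 3)" "x \<in> S"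
          then show "(\<lambda>(s, t). norm (j s t)) x \<le> ((1 + q) / 2 * L + C3 * (B + \<rho>)) * (case x of (s, t) \<Rightarrow> ((t - s) powr \<beta>) ^ 3)"
            using stepj[of L] by (fastforce simp: S_def)
        next
          fix x assume "x \<in> S"
          then obtain s t where x: "x = (s, t)" "a \<le> s" "s \<le> t" "t \<le> z" by (auto simp: S_def)
          have "norm (j s t) \<le> norm (J X W Y s t) + norm (J X' W' Y' s t)"
            unfolding j_def by (rule norm_triangle_ineq4)
          then show "(\<lambda>(s, t). norm (j s t)) x \<le> 2 * K * (case x of (s, t) \<Rightarrow> ((t - s) powr \<beta>) ^ 3)"
            using Jb[OF x(2-)] x by simp
        next
          show "0 \<le> C3 * (B + \<rho>)" using C3 B \<rho> by simp
        qed (use q_bounds K that in \<open>auto simp: S_def\<close>)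
        then show ?thesis by (simp add: L_def)
      qed
      have L0: "0 \<le> L" using C3 B \<rho> q_bounds by (auto simp: L_def)
      have T: "0 \<le> s" "t \<le> T" using s0 st by (auto simp: z_def)
      have "norm ((Y t - Y s) - (Y' t - Y' s)) \<le> (2 * c * M * (B + \<rho>) + L * (t - s) powr \<beta>) * (t - s) powr \<beta>"
        by (rule increment_diff_bounds(1)[OF d cl M \<rho> B(1) L0 T(1) s0(2) T(2)
           _ jb[OF s0, unfolded j_def] p1[OF s0]]) (use B s0 in \<open>auto simp: \<Delta>_def\<close>)
      also have "\<dots> \<le> (2 * c * M * (B + \<rho>) + L) * (t - s) powr \<beta>"
        using L0 p1[OF s0] by (intro mult_right_mono add_left_mono) (auto simp: mult_left_le)
      also have "L = 2 * C3 / (1 - q) * (B + \<rho>)"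
        using q_bounds by (simp add: L_def field_simps)
      finally show ?thesis by (simp add: \<Delta>_def C4_def algebra_simps)
    qed
    have sup: "norm (\<Delta> r) \<le> 2 * norm (\<Delta> a) + \<rho>" if "a \<le> r" "r \<le> z" for r
    proof -
      \<comment> \<open>The increment estimate with sup bound L gives L / 2 + \<rho> / 2 because C4
        e \<le> 1/2. The start comes from the increments of both solutions, each at most b.\<close>
      have "norm (\<Delta> r) \<le> (norm (\<Delta> a) + \<rho> / 2) / (1 - 1 / 2) * 1"
      proof (rule bound_by_contraction[where S = "{a..z}" and ?L0.0 = "norm (\<Delta> a) + 2 * b"
            and g = "\<lambda>r. norm (\<Delta> r)" and w = "\<lambda>_. 1"])
        fix L x assume L: "0 \<le> L" "\<And>x. x \<in> {a..z} \<Longrightarrow> norm (\<Delta> x) \<le> L * 1" and x: "x \<in> {a..z}"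
        have "norm (\<Delta> x - \<Delta> a) \<le> C4 * (L + \<rho>) * (x - a) powr \<beta>"
          using L x by (intro inc) auto
        also have "\<dots> \<le> C4 * (L + \<rho>) * e"
          using p[of a x] x C4 L \<rho> by (intro mult_left_mono) auto
        also have "\<dots> = (C4 * e) * (L + \<rho>)" by simp
        also have "\<dots> \<le> 1 / 2 * (L + \<rho>)" using e L \<rho> by (intro mult_right_mono) auto
        finally show "norm (\<Delta> x) \<le> (1 / 2 * L + (norm (\<Delta> a) + \<rho> / 2)) * 1"
          using norm_triangle_ineq[of "\<Delta> x - \<Delta> a" "\<Delta> a"] by (simp add: field_simps)
      next
        fix x assume x: "x \<in> {a..z}"
        have "\<Delta> x = \<Delta> a + (Y x - Y a) - (Y' x - Y' a)" by (simp add: \<Delta>_def)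
        then have "norm (\<Delta> x) \<le> norm (\<Delta> a) + norm (Y x - Y a) + norm (Y' x - Y' a)"
          by (metis add_right_mono norm_triangle_ineq norm_triangle_ineq4 order_trans)
        moreover have "norm (Y x - Y a) \<le> b * 1" "norm (Y' x - Y' a) \<le> b * 1"
          using order_trans[OF YR(1)[of a x] mult_left_mono[OF p1[of a x] b0]]
            order_trans[OF YR(2)[of a x] mult_left_mono[OF p1[of a x] b0]] x by auto
        ultimately show "norm (\<Delta> x) \<le> (norm (\<Delta> a) + 2 * b) * 1" by simp
      qed (use b0 \<rho> that in auto)
      then show ?thesis by simp
    qed
    have z: "a \<le> s" "s \<le> z" "s \<le> t" "t \<le> z" using st by (auto simp: z_def)
    have "norm (\<Delta> t - \<Delta> s) \<le> C4 * ((2 * norm (\<Delta> a) + \<rho>) + \<rho>) * (t - s) powr \<beta>"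
      by (rule inc) (use sup z \<rho> in auto)
    then show ?thesis using sup[OF z(1,2)] by (simp add: \<Delta>_def algebra_simps)
  qed
  show ?thesis
    by (rule that[of l "2 * C4"]) (use l C4 local in auto)
qed

text \<open>The local estimate is chained over N intervals of length l with N l \<ge> T, each at
  most doubling the error. The Hoelder bound for pairs further apart than l follows from the sup
  bound, as (t - s)^\<beta> is then at least l^\<beta>; the constant D covers both cases.\<close>

theorem stability:
  assumes M: "1 \<le> M" and K: "0 < K" and h: "0 < h" and T: "0 \<le> T"
  obtains C where "0 < C"
    "\<And>\<rho> X W X' W' Y Y' s t. driver T M X W \<Longrightarrow> driver T M X' W' \<Longrightarrow> close T \<rho> X W X' W' \<Longrightarrow>
      davie T K h X W Y \<Longrightarrow> davie T K h X' W' Y' \<Longrightarrow> 0 \<le> \<rho> \<Longrightarrow>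
      0 \<le> s \<Longrightarrow> s \<le> t \<Longrightarrow> t \<le> T \<Longrightarrow>
      norm (Y s - Y' s) \<le> C * (norm (Y 0 - Y' 0) + \<rho>) \<and>
      norm ((Y t - Y s) - (Y' t - Y' s)) \<le> C * (norm (Y 0 - Y' 0) + \<rho>) * (t - s) powr \<beta>"
proof -
  obtain l C where l: "0 < l" "1 \<le> C" and loc:
    "\<And>T \<rho> X W X' W' Y Y' a s t. driver T M X W \<Longrightarrow> driver T M X' W' \<Longrightarrow> close T \<rho> X W X' W' \<Longrightarrow>
      davie T K h X W Y \<Longrightarrow> davie T K h X' W' Y' \<Longrightarrow> 0 \<le> \<rho> \<Longrightarrow>
      0 \<le> a \<Longrightarrow> a \<le> s \<Longrightarrow> s \<le> t \<Longrightarrow> t \<le> T \<Longrightarrow> t \<le> a + l \<Longrightarrow>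
      norm (Y s - Y' s) \<le> 2 * norm (Y a - Y' a) + \<rho> \<and>
      norm ((Y t - Y s) - (Y' t - Y' s)) \<le> C * (norm (Y a - Y' a) + \<rho>) * (t - s) powr \<beta>"
    using stability_local[OF M K h] by blast
  obtain N :: nat where N: "T \<le> real N * l" using l ex_less_of_nat_mult less_imp_le by blast
  define D where "D = C * 2 ^ N + 2 * 2 ^ N / l powr \<beta>"
  have DC: "2 ^ N \<le> D" "C * 2 ^ N \<le> D" "2 * 2 ^ N / l powr \<beta> \<le> D"
  proof -
    have "1 * 2 ^ N \<le> C * 2 ^ N" using l by (intro mult_right_mono) auto
    moreover have "0 \<le> 2 * 2 ^ N / l powr \<beta>" using l by auto
    moreover have "0 \<le> C * 2 ^ N" using l by simp
    ultimately show "2 ^ N \<le> D" "C * 2 ^ N \<le> D" "2 * 2 ^ N / l powr \<beta> \<le> D"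
      unfolding D_def by linarith+
  qed
  show ?thesis
  proof (rule that[of D], goal_cases)
    case 1
    show ?case using DC(1) by (rule order.strict_trans2[rotated]) simp
  next
    case (2 \<rho> X W X' W' Y Y' s t)
    define \<Delta> where "\<Delta> r = norm (Y r - Y' r)" for r
    note loc = loc[OF 2(1-6), folded \<Delta>_def]
    \<comment> \<open>Adding \<rho> turns the step 2 \<Delta> + \<rho> into plain doubling: 2
      \<Delta> + \<rho> + \<rho> = 2 (\<Delta> + \<rho>).\<close>
    have ind: "\<Delta> r + \<rho> \<le> 2 ^ n * (\<Delta> 0 + \<rho>)" if "0 \<le> r" "r \<le> T" "r \<le> real n * l" for n r
      using that
    proof (induction n arbitrary: r)
      case (Suc n)
      define a where "a = min r (real n * l)"
      have "\<Delta> a + \<rho> \<le> 2 ^ n * (\<Delta> 0 + \<rho>)" using Suc l by (intro Suc.IH) (auto simp: a_def)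
      moreover have "\<Delta> r \<le> 2 * \<Delta> a + \<rho>"
        using loc[of a r r] Suc.prems l by (auto simp: a_def algebra_simps min_def split: if_splits)
      ultimately show ?case using 2(6) by simp
    qed auto
    have sup: "\<Delta> r + \<rho> \<le> 2 ^ N * (\<Delta> 0 + \<rho>)" if "0 \<le> r" "r \<le> T" for r
      using ind[of r N] that N by simp
    have \<Delta>0: "0 \<le> \<Delta> r" for r by (simp add: \<Delta>_def)
    have 0: "0 \<le> \<Delta> 0 + \<rho>" using 2(6) \<Delta>0[of 0] by simp
    have "\<Delta> s \<le> D * (\<Delta> 0 + \<rho>)"
      using sup[of s] mult_right_mono[OF DC(1) 0] 2(6-9) by linarith
    moreover have "norm ((Y t - Y s) - (Y' t - Y' s)) \<le> D * (\<Delta> 0 + \<rho>) * (t - s) powr \<beta>"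
    proof (cases "t \<le> s + l")
      case True
      have "norm ((Y t - Y s) - (Y' t - Y' s)) \<le> C * (\<Delta> s + \<rho>) * (t - s) powr \<beta>"
        using loc[of s s t] 2(7-9) True by simp
      also have "\<dots> \<le> C * (2 ^ N * (\<Delta> 0 + \<rho>)) * (t - s) powr \<beta>"
        using sup[of s] 2(7-9) l by (intro mult_right_mono mult_left_mono) auto
      also have "\<dots> \<le> D * (\<Delta> 0 + \<rho>) * (t - s) powr \<beta>"
        using mult_right_mono[OF DC(2) 0] by (intro mult_right_mono) (auto simp: mult_ac)
      finally show ?thesis .
    next
      case False
      have "l powr \<beta> \<le> (t - s) powr \<beta>" using False l beta by (intro powr_mono2) auto
      then have 1: "1 \<le> (t - s) powr \<beta> / l powr \<beta>" using l by (simp add: pos_le_divide_eq)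
      have "norm ((Y t - Y s) - (Y' t - Y' s)) \<le> \<Delta> t + \<Delta> s"
        using norm_triangle_ineq4[of "Y t - Y' t" "Y s - Y' s"] by (simp add: \<Delta>_def algebra_simps)
      also have "\<dots> \<le> 2 * 2 ^ N * (\<Delta> 0 + \<rho>) * 1"
        using sup[of s] sup[of t] 2(6-9) by simp
      also have "\<dots> \<le> 2 * 2 ^ N * (\<Delta> 0 + \<rho>) * ((t - s) powr \<beta> / l powr \<beta>)"
        using 1 0 by (intro mult_left_mono) auto
      also have "\<dots> = (2 * 2 ^ N / l powr \<beta>) * (\<Delta> 0 + \<rho>) * (t - s) powr \<beta>" by simp
      also have "\<dots> \<le> D * (\<Delta> 0 + \<rho>) * (t - s) powr \<beta>"
        using DC(3) 0 by (intro mult_right_mono) auto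
      finally show ?thesis .
    qed
    ultimately show ?case by (simp add: \<Delta>_def)
  qed
qed

end

section \<open>Coefficients of class \<open>C\<^sup>3\<^sub>b\<close>\<close>

lemma norm_matrix_vector_le: "norm (A *v x) \<le> norm A * norm x" for A :: "real^'n^'m"
proof -
  have "norm (A *v x) = L2_set (\<lambda>i. norm ((A *v x) $ i)) UNIV" by (rule norm_vec_def)
  also have "\<dots> \<le> L2_set (\<lambda>i. norm (A $ i) * norm x) UNIV"
    by (intro L2_set_mono) (auto simp: matrix_vector_mul_component Cauchy_Schwarz_ineq2)
  also have "\<dots> = norm A * norm x" by (simp add: L2_set_left_distrib norm_vec_def)
  finally show ?thesis .
qed

lemma norm_column_le: "norm (column i A) \<le> norm A" for A :: "real^'n^'m"
  unfolding column_def norm_vec_def[of A] norm_vec_def[of "\<chi> j. A $ j $ i"]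
  by (intro L2_set_mono) (auto intro: order_trans[OF _ component_le_norm_cart])

lemma bounded_linear_column: "bounded_linear (column i :: real^'n^'m \<Rightarrow> real^'m)"
  by (rule bounded_linear_intro[where K = 1]) (auto simp: column_def vec_eq_iff norm_column_le[unfolded column_def])

lemma norm_row_le: "norm (row i A) \<le> norm A" for A :: "real^'n^'m"
  using Finite_Cartesian_Product.norm_nth_le[of A i] by (simp add: row_def)

section \<open>Mean value, second-difference and Taylor estimates\<close>

lemma norm_diff_le_derivative:
  fixes g :: "real \<Rightarrow> 'a::real_normed_vector"
  assumes "\<And>x. (g has_vector_derivative g' x) (at x)" "\<And>x. 0 < x \<Longrightarrow> x < 1 \<Longrightarrow> norm (g' x) \<le> B"
  shows "norm (g 1 - g 0) \<le> B"
proof -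
  have "continuous_on {0..1} g"
    using assms(1) by (meson continuous_at_imp_continuous_on has_vector_derivative_continuous)
  moreover have "((*) B has_vector_derivative B) (at x)" for x :: real
    by (auto intro!: derivative_eq_intros simp: has_vector_derivative_def)
  ultimately have "norm (g 1 - g 0) \<le> B * 1 - B * 0"
    using assms by (intro differentiable_bound_general[where \<phi>' = "\<lambda>_. B" and f' = g']) (auto intro: continuous_intros)
  then show ?thesis by simp
qed

lemma has_vector_derivative_along_line:
  assumes "\<And>x. (g has_derivative blinfun_apply (g1 x)) (at x)"
  shows "((\<lambda>r. g (x + r *\<^sub>R v)) has_vector_derivative g1 (x + r *\<^sub>R v) v) (at r)"
proof -
  have "((\<lambda>r. x + r *\<^sub>R v) has_vector_derivative v) (at r)"
    by (auto intro!: derivative_eq_intros simp: has_vector_derivative_def)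
  from vector_derivative_diff_chain_within[OF this, of g "blinfun_apply (g1 (x + r *\<^sub>R v))"]
  show ?thesis using has_derivative_at_withinI[OF assms] by (simp add: o_def)
qed

text \<open>The increment form of being bounded with a bounded Lipschitz derivative. Stated for
  differences, it passes to products, so the map y \<mapsto> Df(y)(f(y) e_i) can be treated without
  computing its derivative.\<close>

definition lip2 :: "real \<Rightarrow> ('a::real_normed_vector \<Rightarrow> 'b::real_normed_vector) \<Rightarrow> bool" where
  "lip2 c g \<longleftrightarrow> (\<forall>x. norm (g x) \<le> c) \<and> (\<forall>x y. norm (g y - g x) \<le> c * norm (y - x)) \<and>
    (\<forall>x y x' y'. norm ((g y - g x) - (g y' - g x'))
       \<le> c * ((norm (x - x') + norm (y - y')) * norm (y - x) + norm ((y - x) - (y' - x'))))"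

lemma lip2D:
  assumes "lip2 c g"
  shows "norm (g x) \<le> c" "norm (g y - g x) \<le> c * norm (y - x)"
    "norm ((g y - g x) - (g y' - g x'))
       \<le> c * ((norm (x - x') + norm (y - y')) * norm (y - x) + norm ((y - x) - (y' - x')))"
    "0 \<le> c"
  using assms order_trans[OF norm_ge_zero] unfolding lip2_def by blast+

lemma norm_segment_diff:
  fixes x y x' y' :: "'a::real_normed_vector"
  assumes "0 \<le> r" "r \<le> 1"
  shows "norm ((x + r *\<^sub>R (y - x)) - (x' + r *\<^sub>R (y' - x'))) \<le> norm (x - x') + norm (y - y')"
proof -
  have "(x + r *\<^sub>R (y - x)) - (x' + r *\<^sub>R (y' - x')) = (1 - r) *\<^sub>R (x - x') + r *\<^sub>R (y - y')"
    by (simp add: algebra_simps)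
  also have "norm \<dots> \<le> (1 - r) * norm (x - x') + r * norm (y - y')"
    using assms by (intro norm_triangle_le) simp
  also have "\<dots> \<le> 1 * norm (x - x') + 1 * norm (y - y')"
    using assms by (intro add_mono mult_right_mono) auto
  finally show ?thesis by simp
qed

lemma lipschitz_of_derivative:
  assumes "\<And>x. (g has_derivative blinfun_apply (g1 x)) (at x)" "\<And>x. norm (g1 x) \<le> B"
  shows "norm (g y - g x) \<le> B * norm (y - x)"
proof -
  have "norm (g (x + 1 *\<^sub>R (y - x)) - g (x + 0 *\<^sub>R (y - x))) \<le> B * norm (y - x)"
    by (rule norm_diff_le_derivative, rule has_vector_derivative_along_line[OF assms(1)])
       (use assms(2) in \<open>meson mult_right_mono norm_blinfun norm_ge_zero order_trans\<close>)
  then show ?thesis by simp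
qed

text \<open>For the four-point bound the mean value inequality is applied to the difference of g
  along the two segments; its derivative splits into a change of base point, controlled by the
  Lipschitz bound, and a change of direction.\<close>

lemma lip2_of_derivative:
  fixes g :: "'a::real_normed_vector \<Rightarrow> 'b::real_normed_vector"
  assumes g: "\<And>x. (g has_derivative blinfun_apply (g1 x)) (at x)" and B: "\<And>x. norm (g x) \<le> B" "\<And>x. norm (g1 x) \<le> B"
    and L: "\<And>x y. norm (g1 y - g1 x) \<le> B * norm (y - x)"
  shows "lip2 B g"
  unfolding lip2_def
proof (intro conjI allI)
  have B0: "0 \<le> B" using B(1) norm_ge_zero order_trans by blast
  fix x y x' y' :: 'a
  show "norm (g y - g x) \<le> B * norm (y - x)" by (rule lipschitz_of_derivative[OF g B(2)])
  define v v' where "v = y - x" and "v' = y' - x'"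
  define k where "k r = g (x + r *\<^sub>R v) - g (x' + r *\<^sub>R v')" for r
  have "norm (k 1 - k 0) \<le> B * ((norm (x - x') + norm (y - y')) * norm v + norm (v - v'))"
  proof (rule norm_diff_le_derivative)
    show "(k has_vector_derivative g1 (x + r *\<^sub>R v) v - g1 (x' + r *\<^sub>R v') v') (at r)" for r
      unfolding k_def by (intro has_vector_derivative_diff has_vector_derivative_along_line g)
    fix r :: real assume r: "0 < r" "r < 1"
    have "g1 (x + r *\<^sub>R v) v - g1 (x' + r *\<^sub>R v') v' = (g1 (x + r *\<^sub>R v) - g1 (x' + r *\<^sub>R v')) v + g1 (x' + r *\<^sub>R v') (v - v')"
      by (simp add: blinfun.diff_left blinfun.diff_right)
    also have "norm \<dots> \<le> norm (g1 (x + r *\<^sub>R v) - g1 (x' + r *\<^sub>R v')) * norm v + norm (g1 (x' + r *\<^sub>R v')) * norm (v - v')"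
      by (intro norm_triangle_le add_mono norm_blinfun)
    also have "\<dots> \<le> (B * (norm (x - x') + norm (y - y'))) * norm v + B * norm (v - v')"
      using r by (intro add_mono mult_right_mono B(2) order_trans[OF L] mult_left_mono norm_segment_diff[folded v_def v'_def] B0)
         (auto simp: v_def v'_def intro: norm_segment_diff)
    finally show "norm (g1 (x + r *\<^sub>R v) v - g1 (x' + r *\<^sub>R v') v') \<le> B * ((norm (x - x') + norm (y - y')) * norm v + norm (v - v'))"
      by (simp add: algebra_simps)
  qed
  then show "norm ((g y - g x) - (g y' - g x')) \<le> B * ((norm (x - x') + norm (y - y')) * norm (y - x) + norm ((y - x) - (y' - x')))"
    by (simp add: k_def v_def v'_def algebra_simps)
qed (rule B)

lemma lip2_bounded_linear:
  assumes "bounded_linear h" "\<And>a. norm (h a) \<le> norm a" "lip2 c g"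
  shows "lip2 c (\<lambda>x. h (g x))"
  using lip2D[OF assms(3)] assms(2) unfolding lip2_def linear_diff[OF bounded_linear.linear[OF assms(1)], symmetric]
  by (meson order_trans)

text \<open>A product rule for second differences: two terms carry a second difference of one
  factor, two mix first differences. The mixed terms together are bounded by the first summand of E,
  whence the factor 2 + 1 = 3.\<close>

lemma lip2_bilinear:
  assumes bb: "bounded_bilinear pr" and 1: "\<And>a b. norm (pr a b) \<le> norm a * norm b"
    and p: "lip2 c p" and q: "lip2 c q"
  shows "lip2 (3 * c\<^sup>2) (\<lambda>x. pr (p x) (q x))"
  unfolding lip2_def
proof (intro conjI allI)
  interpret bounded_bilinear pr by fact
  note P = lip2D[OF p] and Q = lip2D[OF q]
  have c: "0 \<le> c" by (rule P(4))
  have pr: "norm (pr a b) \<le> A * B" if "norm a \<le> A" "norm b \<le> B" for a b A B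
    by (rule order_trans[OF 1]) (use that order_trans[OF norm_ge_zero that(1)] in \<open>auto intro: mult_mono\<close>)
  fix x y x' y'
  have "norm (pr (p x) (q x)) \<le> c * c" by (rule pr) (rule P Q)+
  also have "\<dots> \<le> 3 * c\<^sup>2" by (simp add: power2_eq_square)
  finally show "norm (pr (p x) (q x)) \<le> 3 * c\<^sup>2" .
  have "pr (p y) (q y) - pr (p x) (q x) = pr (p y - p x) (q y) + pr (p x) (q y - q x)"
    by (simp add: diff_left diff_right)
  also have "norm \<dots> \<le> (c * norm (y - x)) * c + c * (c * norm (y - x))"
    by (intro norm_triangle_le add_mono pr P Q)
  also have "\<dots> = 2 * (c * c * norm (y - x))" by simp
  also have "\<dots> \<le> 3 * (c * c * norm (y - x))" by (intro mult_right_mono) auto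
  finally show "norm (pr (p y) (q y) - pr (p x) (q x)) \<le> 3 * c\<^sup>2 * norm (y - x)" by (simp add: power2_eq_square)
  define E where "E = (norm (x - x') + norm (y - y')) * norm (y - x) + norm ((y - x) - (y' - x'))"
  have "(pr (p y) (q y) - pr (p x) (q x)) - (pr (p y') (q y') - pr (p x') (q x'))
    = pr ((p y - p x) - (p y' - p x')) (q y') + pr (p y - p x) (q y - q y')
      + pr (p x - p x') (q y - q x) + pr (p x') ((q y - q x) - (q y' - q x'))"
    by (simp add: diff_left diff_right)
  also have "norm \<dots> \<le> (c * E) * c + (c * norm (y - x)) * (c * norm (y - y'))
      + (c * norm (x - x')) * (c * norm (y - x)) + c * (c * E)"
    unfolding E_def by (intro norm_triangle_le add_mono pr P Q)
  also have "\<dots> = c * c * (2 * E + (norm (x - x') + norm (y - y')) * norm (y - x))"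
    by (simp add: algebra_simps)
  also have "\<dots> \<le> c * c * (2 * E + E)"
    by (intro mult_left_mono add_left_mono) (auto simp: E_def)
  finally show "norm ((pr (p y) (q y) - pr (p x) (q x)) - (pr (p y') (q y') - pr (p x') (q x')))
     \<le> 3 * c\<^sup>2 * ((norm (x - x') + norm (y - y')) * norm (y - x) + norm ((y - x) - (y' - x')))"
    unfolding E_def[symmetric] by (simp add: power2_eq_square)
qed

lemma has_vector_derivative_scaleR_const: "((\<lambda>r. r *\<^sub>R v) has_vector_derivative v) (at r)"
  by (auto intro!: derivative_eq_intros simp: has_vector_derivative_def)

lemma taylor_remainder_bound:
  assumes g: "\<And>x. (g has_derivative blinfun_apply (g1 x)) (at x)" and L: "lip2 c g1"
  shows "norm (g y - g x - g1 x (y - x)) \<le> c * norm (y - x) ^ 2"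
proof -
  define v where "v = y - x"
  define k where "k r = g (x + r *\<^sub>R v) - r *\<^sub>R g1 x v" for r
  have "norm (k 1 - k 0) \<le> c * norm v ^ 2"
  proof (rule norm_diff_le_derivative)
    show "(k has_vector_derivative g1 (x + r *\<^sub>R v) v - g1 x v) (at r)" for r
      unfolding k_def by (rule has_vector_derivative_diff has_vector_derivative_along_line g has_vector_derivative_scaleR_const)+
    fix r :: real assume r: "0 < r" "r < 1"
    have "norm (g1 (x + r *\<^sub>R v) v - g1 x v) \<le> norm (g1 (x + r *\<^sub>R v) - g1 x) * norm v"
      by (simp add: norm_blinfun flip: blinfun.diff_left)
    also have "\<dots> \<le> (c * norm ((x + r *\<^sub>R v) - x)) * norm v"
      by (intro mult_right_mono lip2D[OF L]) auto
    also have "\<dots> \<le> (c * norm v) * norm v"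
      using r lip2D(4)[OF L] by (intro mult_right_mono mult_left_mono) (auto intro: mult_left_le_one_le)
    finally show "norm (g1 (x + r *\<^sub>R v) v - g1 x v) \<le> c * norm v ^ 2" by (simp add: power2_eq_square)
  qed
  then show ?thesis by (simp add: k_def v_def algebra_simps)
qed

text \<open>The mean value inequality is applied to the difference of the two remainders along their
  segments. The derivative is then a second difference of \<open>g1\<close>, which
  \<open>lip2\<close> controls; for g = f this is where the Lipschitz second derivative is
  used.\<close>

lemma taylor_remainder_diff_bound:
  assumes g: "\<And>x. (g has_derivative blinfun_apply (g1 x)) (at x)" and L: "lip2 c g1"
  shows "norm ((g y - g x - g1 x (y - x)) - (g y' - g x' - g1 x' (y' - x')))
     \<le> 2 * c * ((norm (x - x') + norm (y - y')) * norm (y - x) ^ 2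
              + norm ((y - x) - (y' - x')) * (norm (y - x) + norm (y' - x')))"
proof -
  define v v' where "v = y - x" and "v' = y' - x'"
  define k where "k r = (g (x + r *\<^sub>R v) - r *\<^sub>R g1 x v) - (g (x' + r *\<^sub>R v') - r *\<^sub>R g1 x' v')" for r
  have c: "0 \<le> c" by (rule lip2D[OF L])
  have "norm (k 1 - k 0) \<le> 2 * c * ((norm (x - x') + norm (y - y')) * norm v ^ 2 + norm (v - v') * (norm v + norm v'))"
  proof (rule norm_diff_le_derivative)
    show "(k has_vector_derivative (g1 (x + r *\<^sub>R v) v - g1 x v) - (g1 (x' + r *\<^sub>R v') v' - g1 x' v')) (at r)" for r
      unfolding k_def by (rule has_vector_derivative_diff has_vector_derivative_along_line g has_vector_derivative_scaleR_const)+
    fix r :: real assume r: "0 < r" "r < 1"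
    define z z' where "z = x + r *\<^sub>R v" and "z' = x' + r *\<^sub>R v'"
    have zx: "norm (z - x) \<le> norm v" "norm (z' - x') \<le> norm v'"
      using r by (auto simp: z_def z'_def intro: mult_left_le_one_le)
    have zv: "norm ((z - x) - (z' - x')) \<le> norm (v - v')"
      using r by (simp add: z_def z'_def mult_left_le_one_le flip: scaleR_diff_right)
    have zz: "norm (z - z') \<le> norm (x - x') + norm (y - y')"
      unfolding z_def z'_def v_def v'_def using r by (intro norm_segment_diff) auto
    have "norm ((g1 z - g1 x) - (g1 z' - g1 x')) \<le> c * ((norm (x - x') + norm (z - z')) * norm (z - x) + norm ((z - x) - (z' - x')))"
      by (rule lip2D[OF L])
    also have "\<dots> \<le> c * ((norm (x - x') + (norm (x - x') + norm (y - y'))) * norm v + norm (v - v'))"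
      using c zx zv zz by (intro mult_left_mono add_mono mult_mono) auto
    finally have 1: "norm ((g1 z - g1 x) - (g1 z' - g1 x')) \<le> c * ((2 * norm (x - x') + norm (y - y')) * norm v + norm (v - v'))"
      by simp
    have "norm (g1 z' - g1 x') \<le> c * norm (z' - x')" by (rule lip2D[OF L])
    also have "\<dots> \<le> c * norm v'" using zx c by (intro mult_left_mono)
    finally have 2: "norm (g1 z' - g1 x') \<le> c * norm v'" .
    have "(g1 z v - g1 x v) - (g1 z' v' - g1 x' v') = ((g1 z - g1 x) - (g1 z' - g1 x')) v + (g1 z' - g1 x') (v - v')"
      by (simp add: blinfun.diff_left blinfun.diff_right)
    also have "norm \<dots> \<le> (c * ((2 * norm (x - x') + norm (y - y')) * norm v + norm (v - v'))) * norm v + (c * norm v') * norm (v - v')"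
      by (intro norm_triangle_le add_mono order_trans[OF norm_blinfun] mult_right_mono 1 2 norm_ge_zero)
    also have "\<dots> = c * ((2 * norm (x - x') + norm (y - y')) * norm v ^ 2 + norm (v - v') * (norm v + norm v'))"
      by (simp add: algebra_simps power2_eq_square)
    also have "\<dots> \<le> c * ((2 * norm (x - x') + 2 * norm (y - y')) * norm v ^ 2 + 2 * (norm (v - v') * (norm v + norm v')))"
      using c by (intro mult_left_mono add_mono mult_right_mono) auto
    finally show "norm ((g1 (x + r *\<^sub>R v) v - g1 x v) - (g1 (x' + r *\<^sub>R v') v' - g1 x' v'))
      \<le> 2 * c * ((norm (x - x') + norm (y - y')) * norm v ^ 2 + norm (v - v') * (norm v + norm v'))"
      by (simp add: z_def z'_def algebra_simps)
  qed
  then show ?thesis by (simp add: k_def v_def v'_def algebra_simps)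
qed

lemma row_eq_nth: "row i A = A $ i"
  by (simp add: row_def vec_eq_iff)

section \<open>The coefficients of the rough differential equation\<close>

text \<open>With Y' = f(Y) each summand of \<open>rough_sum\<close> is an \<open>rF\<close> term
  plus an \<open>rG\<close> term, and \<open>rH\<close> is the derivative of \<open>rF\<close> in
  the state variable.\<close>

definition rF :: "(real^'d \<Rightarrow> real^'m^'d) \<Rightarrow> real^'d \<Rightarrow> real^'m \<Rightarrow> real^'d" where
  "rF f y a = f y *v a"

definition rG :: "(real^'d \<Rightarrow> real^'m^'d) \<Rightarrow> real^'d \<Rightarrow> real^'m^'m \<Rightarrow> real^'d" where
  "rG f y w = (\<Sum>i\<in>UNIV. frechet_derivative f (at y) (column i (f y)) *v row i w)"

definition rH :: "(real^'d \<Rightarrow> real^'m^'d) \<Rightarrow> real^'d \<Rightarrow> real^'d \<Rightarrow> real^'m \<Rightarrow> real^'d" where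
  "rH f y v a = frechet_derivative f (at y) v *v a"

text \<open>\<open>f_lip\<close> concerns f as a matrix-valued map: it makes t \<mapsto> f(Y t)
  Hoelder, as required of the derivative of a controlled path.\<close>

locale rde_coefficients =
  rough_coefficients "rF f" "rG f" "rH f" tensor c \<beta>
  for f :: "real^'d \<Rightarrow> real^'m^'d" and c \<beta> +
  assumes f_lip: "norm (f x - f y) \<le> c * norm (x - y)"

text \<open>The bounded third derivative gives \<open>lip2\<close> for Df, the bounded second
  derivative gives it for f, and bilinearity transfers it to the matrices Df(y)(f(y) e_i) that make
  up \<open>rG\<close>.\<close>

lemma C3_b_rde_coefficients:
  fixes f :: "real^'d \<Rightarrow> real^'m^'d"
  assumes f: "C3_b f" and \<beta>: "1/3 < \<beta>" "\<beta> < 1/2"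
  obtains c where "rde_coefficients f c \<beta>"
proof -
  obtain f1 f2 f3 where d: "\<And>x. (f has_derivative blinfun_apply (f1 x)) (at x)"
        "\<And>x. (f1 has_derivative blinfun_apply (f2 x)) (at x)"
        "\<And>x. (f2 has_derivative blinfun_apply (f3 x)) (at x)"
    and b: "bounded (range f)" "bounded (range f1)" "bounded (range f2)" "bounded (range f3)"
    using f unfolding C3_b_def by blast
  obtain B0 B1 B2 B3 where "\<And>x. norm (f x) \<le> B0" "\<And>x. norm (f1 x) \<le> B1" "\<And>x. norm (f2 x) \<le> B2" "\<And>x. norm (f3 x) \<le> B3"
    using b unfolding bounded_iff by auto
  then obtain B where B: "\<And>x. norm (f x) \<le> B" "\<And>x. norm (f1 x) \<le> B" "\<And>x. norm (f2 x) \<le> B" "\<And>x. norm (f3 x) \<le> B"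
    by (meson max.coboundedI1 max.coboundedI2 that[of "max (max B0 B1) (max B2 B3)"])
  have L2: "norm (f2 y - f2 x) \<le> B * norm (y - x)" for x y by (rule lipschitz_of_derivative[OF d(3) B(4)])
  have L1: "norm (f1 y - f1 x) \<le> B * norm (y - x)" for x y by (rule lipschitz_of_derivative[OF d(2) B(3)])
  have f1: "lip2 B f1" by (rule lip2_of_derivative[OF d(2) B(2,3) L2])
  have f0: "lip2 B f" by (rule lip2_of_derivative[OF d(1) B(1,2) L1])
  have fr: "frechet_derivative f (at x) = blinfun_apply (f1 x)" for x
    using frechet_derivative_at[OF d(1)] by simp
  define n where "n = real CARD('m)"
  have n1: "1 \<le> n" by (simp add: n_def Suc_leI)
  have qi: "lip2 (3 * B\<^sup>2) (\<lambda>x. f1 x (column i (f x)))" for i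
    by (intro lip2_bilinear[OF bounded_bilinear_blinfun_apply norm_blinfun] f1
       lip2_bounded_linear[OF bounded_linear_column norm_column_le] f0)
  have sum: "norm (\<Sum>i\<in>UNIV. A i *v row i w) \<le> n * K * norm w" if "\<And>i. norm (A i) \<le> K"
    for A :: "'m \<Rightarrow> real^'m^'d" and w :: "real^'m^'m" and K
  proof -
    have "norm (A i *v row i w) \<le> K * norm w" for i
      by (rule order_trans[OF norm_matrix_vector_le])
         (use that[of i] norm_row_le[of i w] order_trans[OF norm_ge_zero that] in \<open>auto intro: mult_mono\<close>)
    then have "norm (\<Sum>i\<in>UNIV. A i *v row i w) \<le> (\<Sum>i\<in>(UNIV::'m set). K * norm w)"
      by (intro sum_norm_le) auto
    then show ?thesis by (simp add: n_def)
  qed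
  have B0: "0 \<le> B" by (rule order_trans[OF norm_ge_zero B(1)])
  \<comment> \<open>The summands dominate B for f and Df, 2 B for differences of Taylor remainders,
    and 3 B^2 for each of the n columns summed in \<open>rG\<close>; the 1 ensures c \<ge>
    1.\<close>
  define c where "c = 1 + 2 * B + n * (3 * B\<^sup>2)"
  have "0 \<le> n * (3 * B\<^sup>2)" using n1 by simp
  then have c: "1 \<le> c" "B \<le> c" "2 * B \<le> c" "n * (3 * B\<^sup>2) \<le> c" using B0 by (auto simp: c_def)
  have mv: "norm (A *v a) \<le> c * K * norm a" if "norm A \<le> K'" "K' \<le> c * K" for A :: "real^'m^'d" and a K K'
    by (rule order_trans[OF norm_matrix_vector_le]) (use that in \<open>auto intro: mult_right_mono\<close>)
  have Gm: "norm (\<Sum>i\<in>UNIV. A i *v row i w) \<le> c * K * norm w" if "\<And>i. norm (A i) \<le> 3 * B\<^sup>2 * K" "0 \<le> K"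
    for A :: "'m \<Rightarrow> real^'m^'d" and w :: "real^'m^'m" and K
  proof -
    have "norm (\<Sum>i\<in>UNIV. A i *v row i w) \<le> n * (3 * B\<^sup>2 * K) * norm w" by (rule sum[OF that(1)])
    also have "\<dots> = n * (3 * B\<^sup>2) * K * norm w" by simp
    also have "\<dots> \<le> c * K * norm w" using that c by (intro mult_right_mono) auto
    finally show ?thesis .
  qed
  have "rough_coefficients (rF f) (rG f) (rH f) tensor c \<beta>"
  proof (rule rough_coefficients.intro)
    fix x show "linear (rF f x)" unfolding rF_def by (rule matrix_vector_mul_linear)
  next
    fix x show "linear (rG f x)"
      by (rule linearI) (auto simp: rG_def row_eq_nth sum.distrib scaleR_sum_right matrix_vector_right_distrib matrix_vector_mult_scaleR)
  next
    fix x a show "linear (\<lambda>v. rH f x v a)"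
      by (rule linearI) (auto simp: rH_def fr blinfun.add_right blinfun.scaleR_right matrix_vector_mult_add_rdistrib scaleR_matrix_vector_assoc)
  next
    fix x v show "linear (rH f x v)" unfolding rH_def by (rule matrix_vector_mul_linear)
  next
    fix x :: "real^'d" and a show "norm (rF f x a) \<le> c * norm a" using mv[OF B(1), of 1 x a] c by (simp add: rF_def)
  next
    fix x y a show "norm (rF f x a - rF f y a) \<le> c * norm (x - y) * norm a" unfolding rF_def matrix_vector_mult_diff_rdistrib[symmetric]
      by (rule mv[OF lip2D(2)[OF f0]]) (use c in \<open>auto intro: mult_right_mono\<close>)
  next
    fix x w show "norm (rG f x w) \<le> c * norm w" using Gm[of "\<lambda>i. f1 x (column i (f x))" 1 w] lip2D(1)[OF qi] by (simp add: rG_def fr)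
  next
    fix x y w show "norm (rG f x w - rG f y w) \<le> c * norm (x - y) * norm w" unfolding rG_def fr sum_subtractf[symmetric] matrix_vector_mult_diff_rdistrib[symmetric]
      by (rule Gm[OF lip2D(2)[OF qi]]) auto
  next
    fix x y x' y' w
    show "norm ((rG f y w - rG f x w) - (rG f y' w - rG f x' w))
      \<le> c * ((norm (x - x') + norm (y - y')) * norm (y - x) + norm ((y - x) - (y' - x'))) * norm w"
      unfolding rG_def fr sum_subtractf[symmetric] matrix_vector_mult_diff_rdistrib[symmetric]
      by (rule Gm[OF lip2D(3)[OF qi]]) auto
  next
    fix x v a
    have "norm (f1 x v) \<le> c * norm v"
      by (rule order_trans[OF norm_blinfun]) (use B(2)[of x] c in \<open>auto intro: mult_right_mono\<close>)
    then show "norm (rH f x v a) \<le> c * norm v * norm a" unfolding rH_def fr by (intro mv) auto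
  next
    fix x v a y
    have "norm (f1 x v - f1 y v) \<le> norm (f1 x - f1 y) * norm v"
      by (simp add: norm_blinfun flip: blinfun.diff_left)
    also have "\<dots> \<le> c * norm (x - y) * norm v"
      using order_trans[OF lip2D(2)[OF f1] mult_right_mono[OF c(2) norm_ge_zero]] by (intro mult_right_mono) auto
    finally show "norm (rH f x v a - rH f y v a) \<le> c * norm (x - y) * norm v * norm a" unfolding rH_def fr matrix_vector_mult_diff_rdistrib[symmetric] mult.assoc[of c]
      by (intro order_trans[OF mv]) (auto simp: mult_ac)
  next
    fix x y a show "norm (rF f y a - rF f x a - rH f x (y - x) a) \<le> c * norm (y - x) ^ 2 * norm a"
      unfolding rF_def rH_def fr matrix_vector_mult_diff_rdistrib[symmetric]
      by (rule mv[OF taylor_remainder_bound[OF d(1) f1]]) (use c in \<open>auto intro: mult_right_mono\<close>)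
  next
    fix x y x' y' a
    show "norm ((rF f y a - rF f x a - rH f x (y - x) a) - (rF f y' a - rF f x' a - rH f x' (y' - x') a))
      \<le> c * ((norm (x - x') + norm (y - y')) * norm (y - x) ^ 2
              + norm ((y - x) - (y' - x')) * (norm (y - x) + norm (y' - x'))) * norm a"
      unfolding rF_def rH_def fr matrix_vector_mult_diff_rdistrib[symmetric]
      by (rule mv[OF taylor_remainder_diff_bound[OF d(1) f1]]) (use c in \<open>auto intro!: mult_right_mono add_nonneg_nonneg mult_nonneg_nonneg\<close>)
  next
    fix x :: "real^'d" and a b :: "real^'m"
    have r: "row i (tensor a b) = a $ i *\<^sub>R b" for i by (simp add: row_def tensor_def vec_eq_iff)
    have "(\<Sum>i\<in>UNIV. f1 x (column i (f x)) *v (a $ i *\<^sub>R b)) = f1 x (\<Sum>i\<in>UNIV. a $ i *\<^sub>R column i (f x)) *v b"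
    proof -
      have "linear (\<lambda>A::real^'m^'d. A *v b)"
        by (rule linearI) (auto simp: matrix_vector_mult_add_rdistrib scaleR_matrix_vector_assoc)
      from linear_sum[OF this, of "\<lambda>i. f1 x (a $ i *\<^sub>R column i (f x))" UNIV]
      show ?thesis
        by (simp add: blinfun.sum_right blinfun.scaleR_right matrix_vector_mult_scaleR scaleR_matrix_vector_assoc)
    qed
    also have "(\<Sum>i\<in>UNIV. a $ i *\<^sub>R column i (f x)) = f x *v a"
      by (simp add: matrix_mult_sum scalar_mult_eq_scaleR)
    finally show "rG f x (tensor a b) = rH f x (rF f x a) b" by (simp add: rG_def rH_def rF_def fr r)
  qed (use \<beta> c in auto)
  moreover have "norm (f x - f y) \<le> c * norm (x - y)" for x y
    by (rule order_trans[OF lip2D(2)[OF f0] mult_right_mono[OF c(2) norm_ge_zero]])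
  ultimately show ?thesis
    by (intro that[of c] rde_coefficients.intro rde_coefficients_axioms.intro)
qed

section \<open>Rough integrals and the third-order remainder\<close>

definition psum :: "(real \<Rightarrow> real \<Rightarrow> 'a::comm_monoid_add) \<Rightarrow> real list \<Rightarrow> 'a" where
  "psum g p = (\<Sum>k<length p - 1. g (p ! k) (p ! Suc k))"

lemma psum_simps [simp]:
  "psum g [] = 0" "psum g [x] = 0" "psum g (x # y # r) = g x y + psum g (y # r)"
  by (simp_all add: psum_def sum.lessThan_Suc_shift del: sum.lessThan_Suc)

lemma psum_join:
  "p \<noteq> [] \<Longrightarrow> p' \<noteq> [] \<Longrightarrow> last p = hd p' \<Longrightarrow> psum g (p @ tl p') = psum g p + psum g p'"
proof (induction p)
  case (Cons x p)
  show ?case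
  proof (cases p)
    case Nil
    then show ?thesis using Cons.prems by (cases p') auto
  next
    case (Cons y r)
    then show ?thesis using Cons.IH Cons.prems by (simp add: add.assoc)
  qed
qed simp

lemma psum_diff: "psum (\<lambda>u v. g u v - h u v) p = psum g p - psum h p" for g :: "real \<Rightarrow> real \<Rightarrow> 'a::ab_group_add"
  by (simp add: psum_def sum_subtractf)

lemma psum_telescope: "p \<noteq> [] \<Longrightarrow> psum (\<lambda>u v. Y v - Y u) p = Y (last p) - Y (hd p)" for Y :: "real \<Rightarrow> 'a::ab_group_add"
proof (induction p)
  case (Cons x p)
  then show ?case by (cases p) auto
qed simp

lemma successively_join:
  assumes "p \<noteq> []" "p' \<noteq> []" "last p = hd p'" "successively P p" "successively P p'"
  shows "successively P (p @ tl p')"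
  using assms by (cases p'; cases "tl p'") (auto simp: successively_append_iff)

text \<open>For a transitive order, sortedness is a condition on neighbours only, and so is a mesh
  bound. In terms of \<open>successively\<close> both survive joining two partitions at a common
  endpoint.\<close>

lemma partitions_iff:
  "p \<in> partitions s t \<longleftrightarrow> p \<noteq> [] \<and> successively (<) p \<and> hd p = s \<and> last p = t"
  by (auto simp: partitions_def successively_conv_sorted_wrt transp_on_less)

lemma mesh_iff: "(\<forall>k<length p - 1. p ! Suc k - p ! k < \<eta>) \<longleftrightarrow> successively (\<lambda>u v. v - u < \<eta>) p"
  by (auto simp: successively_conv_nth less_diff_conv)

lemma partitions_join:
  assumes "p \<in> partitions s u" "p' \<in> partitions u t"
  shows "p @ tl p' \<in> partitions s t"
proof -
  have "last (p @ tl p') = t" using assms by (cases p'; cases "tl p'") (auto simp: partitions_iff)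
  then show ?thesis using assms by (auto simp: partitions_iff intro: successively_join)
qed

text \<open>Defined by recursion on the two halves, so that an induction over the level is the
  halving argument itself; \<open>tl\<close> drops the repeated midpoint.\<close>

fun dyadic_partition :: "nat \<Rightarrow> real \<Rightarrow> real \<Rightarrow> real list" where
  "dyadic_partition 0 s t = [s, t]"
| "dyadic_partition (Suc n) s t =
     dyadic_partition n s ((s + t) / 2) @ tl (dyadic_partition n ((s + t) / 2) t)"

lemma dyadic_partition: "s < t \<Longrightarrow> dyadic_partition n s t \<in> partitions s t"
proof (induction n arbitrary: s t)
  case (Suc n)
  then show ?case by (auto intro!: partitions_join Suc.IH)
qed (auto simp: partitions_iff)

lemma dyadic_partition_mesh:
  "s < t \<Longrightarrow> successively (\<lambda>u v. v - u = (t - s) / 2 ^ n) (dyadic_partition n s t)"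
proof (induction n arbitrary: s t)
  case (Suc n)
  define m where "m = (s + t) / 2"
  have m: "s < m" "m < t" "(m - s) / 2 ^ n = (t - s) / 2 ^ Suc n" "(t - m) / 2 ^ n = (t - s) / 2 ^ Suc n"
    using Suc.prems by (auto simp: m_def field_simps)
  have "successively (\<lambda>u v. v - u = (t - s) / 2 ^ Suc n) (dyadic_partition n s m @ tl (dyadic_partition n m t))"
    using Suc.IH[OF m(1)] Suc.IH[OF m(2)] dyadic_partition[OF m(1)] dyadic_partition[OF m(2)] unfolding m(3,4)
    by (intro successively_join) (auto simp: partitions_def)
  then show ?case by (simp add: m_def)
qed simp

lemma dyadic_partition_fine:
  assumes "s < t" "(t - s) / 2 ^ n < \<eta>"
  shows "successively (\<lambda>u v. v - u < \<eta>) (dyadic_partition n s t)"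
  using successively_mono[OF dyadic_partition_mesh[OF assms(1), of n]] assms(2) by auto

lemma psum_rough_sum:
  "rough_sum f Y (\<lambda>r. f (Y r)) X W p = psum (\<lambda>u v. rF f (Y u) (X v - X u) + rG f (Y u) (W u v)) p"
  by (simp add: rough_sum_def psum_def rF_def rG_def Let_def)

section \<open>Equivalence of the integral equation and the remainder bound\<close>

context rde_coefficients
begin

text \<open>The increments of Y telescope, so a compensated Riemann sum misses Y t - Y s by exactly
  the sum of \<open>J\<close>. The integral equation thus says that sums of \<open>J\<close> over
  fine partitions vanish.\<close>

lemma rough_sum_eq:
  assumes "p \<in> partitions s t"
  shows "rough_sum f Y (\<lambda>r. f (Y r)) X W p = Y t - Y s - psum (J X W Y) p"
proof -
  have "rough_sum f Y (\<lambda>r. f (Y r)) X W p = psum (\<lambda>u v. (Y v - Y u) - J X W Y u v) p"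
    by (simp add: psum_rough_sum J_def)
  also have "\<dots> = Y t - Y s - psum (J X W Y) p"
    using assms by (subst psum_diff, subst psum_telescope) (auto simp: partitions_def)
  finally show ?thesis .
qed

text \<open>The counterpart of \<open>increment_bounds\<close> without smallness of the interval:
  surplus powers of p are bounded by z = T^\<beta>, at the price of constants that depend on K and
  T.\<close>

lemma davie_increments:
  assumes d: "driver T M X W" and nn: "0 \<le> M" "0 \<le> K" and s: "0 \<le> s" "s \<le> t" "t \<le> T"
    and J: "norm (J X W Y s t) \<le> K * ((t - s) powr \<beta>) ^ 3"
  defines "z \<equiv> T powr \<beta>"
  shows "norm (Y t - Y s) \<le> (c * M + c * M * z + K * z\<^sup>2) * (t - s) powr \<beta>"
    and "norm (R X Y s t) \<le> (c * M + K * z) * ((t - s) powr \<beta>)\<^sup>2"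
proof -
  define p where "p = (t - s) powr \<beta>"
  have p: "0 \<le> p" "p \<le> z" using s beta by (auto simp: p_def z_def intro!: powr_mono2)
  have c0: "0 \<le> c" using c1 by simp
  have X: "norm (X t - X s) \<le> M * p" and W: "norm (W s t) \<le> M * p^2"
    using d s by (auto simp: driver_def p_def)
  have FX: "norm (rF f (Y s) (X t - X s)) \<le> c * (M * p)"
    by (rule order_trans[OF F_bound mult_left_mono[OF X c0]])
  have GW: "norm (rG f (Y s) (W s t)) \<le> c * (M * p^2)"
    by (rule order_trans[OF G_bound mult_left_mono[OF W c0]])
  have p3: "p^3 \<le> z * p^2" using p mult_right_mono[of p z "p^2"] by (simp add: power2_eq_square power3_eq_cube mult.assoc)
  have p2: "p^2 \<le> z * p" using p by (simp add: power2_eq_square mult_right_mono)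
  have "R X Y s t = J X W Y s t + rG f (Y s) (W s t)" by (simp add: R_def J_def)
  then have "norm (R X Y s t) \<le> K * p^3 + c * (M * p^2)"
    using J GW norm_triangle_le add_mono unfolding p_def by metis
  also have "\<dots> \<le> K * (z * p^2) + c * (M * p^2)" using p3 nn by (intro add_right_mono mult_left_mono)
  finally have R: "norm (R X Y s t) \<le> (c * M + K * z) * p^2" by (simp add: algebra_simps)
  then show "norm (R X Y s t) \<le> (c * M + K * z) * ((t - s) powr \<beta>)\<^sup>2" by (simp add: p_def)
  have "Y t - Y s = R X Y s t + rF f (Y s) (X t - X s)" by (simp add: R_def)
  then have "norm (Y t - Y s) \<le> (c * M + K * z) * p^2 + c * (M * p)"
    using R FX norm_triangle_le add_mono by metis
  also have "\<dots> \<le> (c * M + K * z) * (z * p) + c * (M * p)"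
    using p2 p nn c1 by (intro add_right_mono mult_left_mono) auto
  finally show "norm (Y t - Y s) \<le> (c * M + c * M * z + K * z\<^sup>2) * (t - s) powr \<beta>"
    by (simp add: p_def algebra_simps power2_eq_square)
qed

text \<open>Doubling the scale now enlarges the constant, which is harmless because finitely many
  doublings reach T and no uniformity is claimed.\<close>

lemma davie_global:
  assumes d: "driver T M X W" and M: "0 \<le> M" and K: "0 \<le> K" and h: "0 < h" and D: "davie T K h X W Y"
  obtains K' where "0 \<le> K'" "davie T K' T X W Y"
proof -
  have "\<exists>K\<ge>0. davie T K (h * 2 ^ n) X W Y" for n
  proof (induction n)
    case (Suc n)
    then obtain K where K: "0 \<le> K" "davie T K (h * 2 ^ n) X W Y" by blast
    define z b b' where "z = T powr \<beta>" and "b = c * M + c * M * z + K * z\<^sup>2" and "b' = c * M + K * z"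
    have nn: "0 \<le> b" "0 \<le> b'" "0 \<le> c * M * (b\<^sup>2 + b' + b)" using M K c1 by (auto simp: b_def b'_def z_def)
    have "davie T (2 * K + c * M * (b\<^sup>2 + b' + b)) (h * 2 ^ Suc n) X W Y"
      unfolding davie_def
    proof clarify
      fix s t assume st: "0 \<le> s" "s \<le> t" "t \<le> T" "t - s \<le> h * 2 ^ Suc n"
      define u where "u = (s + t) / 2"
      have u: "s \<le> u" "u \<le> t" "u - s = (t - s) / 2" "t - u = (t - s) / 2"
        "u - s \<le> h * 2 ^ n" "t - u \<le> h * 2 ^ n"
        using st by (auto simp: u_def field_simps)
      have J: "norm (J X W Y s u) \<le> K * ((u - s) powr \<beta>) ^ 3" "norm (J X W Y u t) \<le> K * ((t - u) powr \<beta>) ^ 3"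
        using K(2) u st by (auto simp: davie_def)
      have uT: "u \<le> T" using u st by simp
      note i = davie_increments[OF d M K(1) st(1) u(1) uT J(1), folded z_def, folded b_def b'_def]
      have "norm (J X W Y s t) \<le> norm (J X W Y s u) + norm (J X W Y u t) + c * M * (b\<^sup>2 + b' + b) * ((t - s) powr \<beta>) ^ 3"
        by (rule norm_le_defect, rule defect_bound[OF d M nn(1,2) st(1) u(1,2) st(3) i])
      moreover have "K * ((u - s) powr \<beta>) ^ 3 \<le> K * ((t - s) powr \<beta>) ^ 3" "K * ((t - u) powr \<beta>) ^ 3 \<le> K * ((t - s) powr \<beta>) ^ 3"
        using u(1,2) st beta K by (auto intro!: mult_left_mono power_mono powr_mono2)
      ultimately show "norm (J X W Y s t) \<le> (2 * K + c * M * (b\<^sup>2 + b' + b)) * ((t - s) powr \<beta>) ^ 3"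
        using J by (simp add: algebra_simps)
    qed
    then show ?case using nn K by (intro exI[of _ "2 * K + c * M * (b\<^sup>2 + b' + b)"]) auto
  qed (use K D in auto)
  moreover obtain n where "T / h < 2 ^ n" using real_arch_pow[of 2] by auto
  ultimately obtain K' where "0 \<le> K'" "davie T K' (h * 2 ^ n) X W Y" by blast
  moreover have "T \<le> h * 2 ^ n" using \<open>T / h < 2 ^ n\<close> h by (simp add: field_simps)
  ultimately show ?thesis by (intro that[of K']) (auto simp: davie_def)
qed

text \<open>Of the exponent 3\<beta> one power is spent on the total length t of the gaps; the rest,
  3\<beta> - 1 > 0, makes the sum small with the mesh.\<close>

lemma sum_gaps_bound:
  assumes p: "p \<in> partitions 0 t" and fine: "successively (\<lambda>u v. v - u < \<eta>) p"
    and J: "\<And>u v. 0 \<le> u \<Longrightarrow> u \<le> v \<Longrightarrow> v \<le> t \<Longrightarrow> norm (g u v) \<le> K * ((v - u) powr \<beta>) ^ 3" and K: "0 \<le> K"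
  shows "norm (psum g p) \<le> K * \<eta> powr (3 * \<beta> - 1) * t"
proof -
  have 1: "p ! i < p ! j" if "i < j" "j < length p" for i j
    using p that by (auto simp: partitions_def sorted_wrt_iff_nth_less)
  have "p ! 0 = 0" "p ! (length p - 1) = t" "p \<noteq> []" using p by (auto simp: partitions_def hd_conv_nth last_conv_nth)
  then have 2: "0 \<le> p ! i" "p ! i \<le> t" if "i < length p" for i
    using 1[of 0 i] 1[of i "length p - 1"] that by (cases "i = 0"; cases "i = length p - 1"; force)+
  have "norm (psum g p) \<le> (\<Sum>k<length p - 1. K * \<eta> powr (3 * \<beta> - 1) * (p ! Suc k - p ! k))"
    unfolding psum_def
  proof (rule sum_norm_le)
    fix k assume k: "k \<in> {..<length p - 1}"
    define u v where "u = p ! k" and "v = p ! Suc k"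
    have uv: "0 \<le> u" "u < v" "v \<le> t" using 1[of k "Suc k"] 2[of k] 2[of "Suc k"] k by (auto simp: u_def v_def)
    have e: "v - u < \<eta>" using fine k unfolding mesh_iff[symmetric] u_def v_def by simp
    have "norm (g u v) \<le> K * ((v - u) powr \<beta>) ^ 3" using J uv by simp
    also have "((v - u) powr \<beta>) ^ 3 = (v - u) powr (3 * \<beta>)" using uv by (simp add: powr_power)
    also have "\<dots> = (v - u) powr (3 * \<beta> - 1) * (v - u)" using uv by (simp add: powr_diff)
    also have "K * \<dots> \<le> K * (\<eta> powr (3 * \<beta> - 1) * (v - u))"
      using uv e K beta by (intro mult_left_mono mult_right_mono powr_mono2) auto
    finally show "norm (g (p ! k) (p ! Suc k)) \<le> K * \<eta> powr (3 * \<beta> - 1) * (p ! Suc k - p ! k)"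
      by (simp add: u_def v_def)
  qed
  also have "\<dots> = K * \<eta> powr (3 * \<beta> - 1) * t"
    using psum_telescope[of p "\<lambda>x. x"] p by (simp add: sum_distrib_left[symmetric] psum_def partitions_def)
  finally show ?thesis .
qed

lemma davie_imp_rde_solution:
  assumes d: "driver T M X W" and M: "0 \<le> M" and K: "0 \<le> K" and h: "0 < h" and D: "davie T K h X W Y"
  shows "rde_solution \<beta> f X W (Y 0) T Y"
proof -
  obtain K where K: "0 \<le> K" and D: "davie T K T X W Y" by (rule davie_global[OF d M K h D])
  have J: "norm (J X W Y s t) \<le> K * ((t - s) powr \<beta>) ^ 3" if "0 \<le> s" "s \<le> t" "t \<le> T" for s t
    using D that by (auto simp: davie_def)
  obtain b where b: "0 \<le> b" "\<And>s t. 0 \<le> s \<Longrightarrow> s \<le> t \<Longrightarrow> t \<le> T \<Longrightarrow> norm (Y t - Y s) \<le> b * (t - s) powr \<beta>"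
    using davie_increments(1)[OF d M K _ _ _ J] M K c1
    by (intro that[of "c * M + c * M * T powr \<beta> + K * (T powr \<beta>)\<^sup>2"]) auto
  have Y: "norm (Y t - Y s) \<le> b * \<bar>t - s\<bar> powr \<beta>" if "s \<in> {0..T}" "t \<in> {0..T}" for s t
    using b(2)[of s t] b(2)[of t s] that by (cases "s \<le> t") (auto simp: norm_minus_commute)
  have "norm (f (Y t) - f (Y s)) \<le> (c * b) * \<bar>t - s\<bar> powr \<beta>" if "s \<in> {0..T}" "t \<in> {0..T}" for s t
    using order_trans[OF f_lip mult_left_mono[OF Y[OF that], of c]] c1 by (simp add: mult.assoc)
  moreover have "\<exists>C. \<forall>s t. 0 \<le> s \<and> s < t \<and> t \<le> T \<longrightarrow> norm (Y t - Y s - f (Y s) *v (X t - X s)) \<le> C * (t - s) powr (2 * \<beta>)"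
  proof (intro exI allI impI)
    fix s t assume "0 \<le> s \<and> s < t \<and> t \<le> T"
    then show "norm (Y t - Y s - f (Y s) *v (X t - X s)) \<le> (c * M + K * T powr \<beta>) * (t - s) powr (2 * \<beta>)"
      using davie_increments(2)[OF d M K _ _ _ J, of s t] powr_power[of "t - s" \<beta> 2] by (simp add: R_def rF_def)
  qed
  ultimately have con: "controlled \<beta> X T Y (\<lambda>t. f (Y t))"
    using Y unfolding controlled_def holder_on_def by blast
  have "has_rough_integral f Y (\<lambda>r. f (Y r)) X W 0 t (Y t - Y 0)" if t: "t \<in> {0..T}" for t
    unfolding has_rough_integral_def
  proof (intro allI impI)
    fix e :: real assume e: "0 < e"
    \<comment> \<open>The target value of \<eta>^(3\<beta> - 1): it makes K x t < e, and the added
      ones cover K = 0 and t = 0.\<close>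
    define x where "x = e / ((K + 1) * (t + 1))"
    have x: "0 < x" using e K t by (auto simp: x_def)
    define \<eta> where "\<eta> = x powr (1 / (3 * \<beta> - 1))"
    have \<eta>: "0 < \<eta>" "\<eta> powr (3 * \<beta> - 1) = x" using x beta by (auto simp: \<eta>_def powr_powr)
    have "norm (rough_sum f Y (\<lambda>r. f (Y r)) X W p - (Y t - Y 0)) < e"
      if p: "p \<in> partitions 0 t" "\<forall>k<length p - 1. p ! Suc k - p ! k < \<eta>" for p
    proof -
      have "norm (psum (J X W Y) p) \<le> K * x * t"
        using sum_gaps_bound[OF p(1) p(2)[unfolded mesh_iff] _ K, of "J X W Y"] J t \<eta> by auto
      also have "K * t < (K + 1) * (t + 1)" using K t by (simp add: algebra_simps)
      then have "K * t * x < (K + 1) * (t + 1) * x" using x by (rule mult_strict_right_mono)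
      then have "K * x * t < e" using K t by (simp add: x_def mult_ac)
      finally show ?thesis by (simp add: rough_sum_eq[OF p(1)])
    qed
    then show "\<exists>\<eta>>0. \<forall>p\<in>partitions 0 t. (\<forall>k<length p - 1. p ! Suc k - p ! k < \<eta>) \<longrightarrow>
       norm (rough_sum f Y (\<lambda>r. f (Y r)) X W p - (Y t - Y 0)) < e"
      using \<eta> by blast
  qed
  then show ?thesis using con by (simp add: rde_solution_def)
qed

text \<open>A sewing argument. The controlled structure makes the defect of \<open>J\<close> third
  order, so dyadic sums of \<open>J\<close> over [s,t] differ from \<open>J\<close> at (s,t) by at
  most K (t - s)^(3\<beta>), uniformly in the level; the integral equation sends these sums to
  0.\<close>

lemma rde_solution_imp_davie:
  assumes d: "driver T M X W" and M: "0 \<le> M" and T: "0 \<le> T" and r: "rde_solution \<beta> f X W \<xi> T Y"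
  obtains K where "0 \<le> K" "davie T K T X W Y" "Y 0 = \<xi>"
proof -
  have con: "controlled \<beta> X T Y (\<lambda>t. f (Y t))"
    and int: "\<And>t. t \<in> {0..T} \<Longrightarrow> has_rough_integral f Y (\<lambda>r. f (Y r)) X W 0 t (Y t - \<xi>)"
    using r by (auto simp: rde_solution_def)
  obtain b0 where b0: "\<And>s t. s \<in> {0..T} \<Longrightarrow> t \<in> {0..T} \<Longrightarrow> norm (Y t - Y s) \<le> b0 * \<bar>t - s\<bar> powr \<beta>"
    using con unfolding controlled_def holder_on_def by blast
  obtain b1 where b1: "\<And>s t. 0 \<le> s \<Longrightarrow> s < t \<Longrightarrow> t \<le> T \<Longrightarrow> norm (Y t - Y s - f (Y s) *v (X t - X s)) \<le> b1 * (t - s) powr (2 * \<beta>)"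
    using con unfolding controlled_def by blast
  have Y: "norm (Y t - Y s) \<le> \<bar>b0\<bar> * (t - s) powr \<beta>" if "0 \<le> s" "s \<le> t" "t \<le> T" for s t
    using order_trans[OF b0[of s t] mult_right_mono[OF abs_ge_self]] that by auto
  have R: "norm (R X Y s t) \<le> \<bar>b1\<bar> * ((t - s) powr \<beta>)\<^sup>2" if "0 \<le> s" "s \<le> t" "t \<le> T" for s t
  proof (cases "s = t")
    case False
    then have "norm (R X Y s t) \<le> b1 * (t - s) powr (2 * \<beta>)"
      using b1[of s t] that by (simp add: R_def rF_def)
    also have "\<dots> \<le> \<bar>b1\<bar> * (t - s) powr (2 * \<beta>)" by (intro mult_right_mono) auto
    finally show ?thesis using False by (simp add: powr_power)
  qed (simp add: R_def rF_def)
  define B where "B = c * M * (\<bar>b0\<bar>\<^sup>2 + \<bar>b1\<bar> + \<bar>b0\<bar>)"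
  have B: "0 \<le> B" using M c1 by (simp add: B_def)
  have defect: "norm (J X W Y s t - J X W Y s u - J X W Y u t) \<le> B * ((t - s) powr \<beta>) ^ 3"
    if "0 \<le> s" "s \<le> u" "u \<le> t" "t \<le> T" for s u t
    unfolding B_def using that by (intro defect_bound[OF d M] Y R) auto
  define K where "K = B / (1 - q)"
  have K: "0 \<le> K" using B q_bounds by (simp add: K_def)
  \<comment> \<open>K is again a fixed point, now of K \<mapsto> q K + B, hence the same constant
    serves every level.\<close>
  have dy: "norm (psum (J X W Y) (dyadic_partition n s t) - J X W Y s t) \<le> K * ((t - s) powr \<beta>) ^ 3"
    if "0 \<le> s" "s < t" "t \<le> T" for n s t
    using that
  proof (induction n arbitrary: s t)
    case (Suc n)
    define u where "u = (s + t) / 2"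
    have u: "s < u" "u < t" "u - s = (t - s) / 2" "t - u = (t - s) / 2"
      using Suc.prems by (auto simp: u_def field_simps)
    define A where "A s t = psum (J X W Y) (dyadic_partition n s t)" for s t
    have 1: "norm (A s u - J X W Y s u) \<le> K * (((t - s) / 2) powr \<beta>) ^ 3"
      using Suc.IH[of s u] Suc.prems u unfolding A_def u(3) by simp
    have 2: "norm (A u t - J X W Y u t) \<le> K * (((t - s) / 2) powr \<beta>) ^ 3"
      using Suc.IH[of u t] Suc.prems u unfolding A_def u(4) by simp
    have "psum (J X W Y) (dyadic_partition (Suc n) s t) = A s u + A u t"
      using dyadic_partition[OF u(1), of n] dyadic_partition[OF u(2), of n]
      by (simp add: A_def flip: u_def) (rule psum_join; auto simp: partitions_def)
    then have "psum (J X W Y) (dyadic_partition (Suc n) s t) - J X W Y s t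
       = (A s u - J X W Y s u) + (A u t - J X W Y u t) - (J X W Y s t - J X W Y s u - J X W Y u t)" by simp
    also have "norm \<dots> \<le> K * (((t - s) / 2) powr \<beta>) ^ 3 + K * (((t - s) / 2) powr \<beta>) ^ 3 + B * ((t - s) powr \<beta>) ^ 3"
      by (intro order_trans[OF norm_triangle_ineq4] add_mono order_trans[OF norm_triangle_ineq] 1 2 defect)
         (use Suc.prems u in auto)
    also have "\<dots> = K * (2 * (((t - s) / 2) powr \<beta>) ^ 3) + B * ((t - s) powr \<beta>) ^ 3" by simp
    also have "\<dots> = (K * q + B) * ((t - s) powr \<beta>) ^ 3"
      using halving[of "t - s"] Suc.prems by (simp add: algebra_simps)
    also have "K * q + B = K" using q_bounds unfolding K_def by (simp add: field_simps)
    finally show ?case .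
  qed (use K in simp)
  have "norm (J X W Y s t) \<le> K * ((t - s) powr \<beta>) ^ 3" if st: "0 \<le> s" "s \<le> t" "t \<le> T" for s t
  proof (cases "s = t")
    case True
    have "norm (W t t) \<le> M * ((t - t) powr \<beta>)\<^sup>2" using d st True unfolding driver_def by blast
    then have "J X W Y s t = 0" using True linear_0[OF linear_F] linear_0[OF linear_G] by (simp add: J_def)
    then show ?thesis using K by simp
  next
    case False
    then have st': "s < t" using st by simp
    show ?thesis
    proof (rule field_le_epsilon)
      fix e :: real assume "0 < e"
      then have e: "0 < e / 2" by simp
      obtain \<eta>1 where \<eta>1: "0 < \<eta>1" "\<And>p. p \<in> partitions 0 s \<Longrightarrow> successively (\<lambda>u v. v - u < \<eta>1) p \<Longrightarrow>
          norm (rough_sum f Y (\<lambda>r. f (Y r)) X W p - (Y s - \<xi>)) < e / 2"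
        using int[of s, unfolded has_rough_integral_def mesh_iff] e st by (meson atLeastAtMost_iff order_trans)
      obtain \<eta>2 where \<eta>2: "0 < \<eta>2" "\<And>p. p \<in> partitions 0 t \<Longrightarrow> successively (\<lambda>u v. v - u < \<eta>2) p \<Longrightarrow>
          norm (rough_sum f Y (\<lambda>r. f (Y r)) X W p - (Y t - \<xi>)) < e / 2"
        using int[of t, unfolded has_rough_integral_def mesh_iff] e st by (meson atLeastAtMost_iff order_trans)
      define \<eta> where "\<eta> = min \<eta>1 \<eta>2"
      have \<eta>: "0 < \<eta>" using \<eta>1 \<eta>2 by (simp add: \<eta>_def)
      obtain n where "t / \<eta> < 2 ^ n" using real_arch_pow[of 2] by auto
      then have "t / 2 ^ n < \<eta>" using \<eta> by (simp add: field_simps)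
      moreover have "s / 2 ^ n \<le> t / 2 ^ n" "(t - s) / 2 ^ n \<le> t / 2 ^ n" using st by (auto intro: divide_right_mono)
      ultimately have n: "s / 2 ^ n < \<eta>" "(t - s) / 2 ^ n < \<eta>" by auto
      \<comment> \<open>For s = 0 the interval is degenerate: \<open>dyadic_partition\<close> would
        repeat the point 0, while \<open>[0]\<close> is a genuine partition of [0,0].\<close>
      define P where "P = (if s = 0 then [0] else dyadic_partition n 0 s)"
      define Q where "Q = dyadic_partition n s t"
      have P: "P \<in> partitions 0 s" "successively (\<lambda>u v. v - u < \<eta>) P"
        using dyadic_partition[of 0 s n] dyadic_partition_fine[of 0 s n \<eta>] n(1) st
        by (auto simp: P_def partitions_iff)
      have Q: "Q \<in> partitions s t" "successively (\<lambda>u v. v - u < \<eta>) Q"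
        using dyadic_partition[OF st'] dyadic_partition_fine[OF st' n(2)] by (auto simp: Q_def)
      have PQ: "P @ tl Q \<in> partitions 0 t" "successively (\<lambda>u v. v - u < \<eta>) (P @ tl Q)"
        using partitions_join[OF P(1) Q(1)] successively_join[of P Q, OF _ _ _ P(2) Q(2)] P(1) Q(1)
        by (auto simp: partitions_def)
      have e1: "norm (rough_sum f Y (\<lambda>r. f (Y r)) X W P - (Y s - \<xi>)) < e / 2"
        by (rule \<eta>1(2)[OF P(1)], rule successively_mono[OF P(2)]) (auto simp: \<eta>_def)
      have e2: "norm (rough_sum f Y (\<lambda>r. f (Y r)) X W (P @ tl Q) - (Y t - \<xi>)) < e / 2"
        by (rule \<eta>2(2)[OF PQ(1)], rule successively_mono[OF PQ(2)]) (auto simp: \<eta>_def)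
      have "psum (J X W Y) (P @ tl Q) = psum (J X W Y) P + psum (J X W Y) Q"
        using P(1) Q(1) by (intro psum_join) (auto simp: partitions_def)
      \<comment> \<open>The integral equation is posed from time 0, so the sum over [s,t] is
        recovered from a partition of [0,s] and its extension to [0,t], each with error below e /
        2.\<close>
      then have "psum (J X W Y) Q = (rough_sum f Y (\<lambda>r. f (Y r)) X W P - (Y s - \<xi>)) - (rough_sum f Y (\<lambda>r. f (Y r)) X W (P @ tl Q) - (Y t - \<xi>))"
        unfolding rough_sum_eq[OF P(1)] rough_sum_eq[OF PQ(1)] by simp
      then have "norm (psum (J X W Y) Q) < e"
        using e1 e2 norm_triangle_ineq4 by (smt (verit) field_sum_of_halves)
      moreover have "norm (psum (J X W Y) Q - J X W Y s t) \<le> K * ((t - s) powr \<beta>) ^ 3"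
        unfolding Q_def by (rule dy[OF st(1) st' st(3)])
      ultimately show "norm (J X W Y s t) \<le> K * ((t - s) powr \<beta>) ^ 3 + e"
        using norm_triangle_ineq4[of "psum (J X W Y) Q" "psum (J X W Y) Q - J X W Y s t"] by simp
    qed
  qed
  then have "davie T K T X W Y" by (simp add: davie_def)
  moreover have "Y 0 = \<xi>"
  proof -
    \<comment> \<open>The one-point partition \<open>[0]\<close> of [0,0] has an empty sum, which
      must approximate Y 0 - \<xi> within every e.\<close>
    have "norm (Y 0 - \<xi>) \<le> 0"
    proof (rule field_le_epsilon)
      fix e :: real assume "0 < e"
      then obtain \<eta> where "\<And>p. p \<in> partitions 0 0 \<Longrightarrow> successively (\<lambda>u v. v - u < \<eta>) p \<Longrightarrow>
          norm (rough_sum f Y (\<lambda>r. f (Y r)) X W p - (Y 0 - \<xi>)) < e"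
        using int[of 0, unfolded has_rough_integral_def mesh_iff] T by (meson atLeastAtMost_iff order_refl)
      from this[of "[0]"] show "norm (Y 0 - \<xi>) \<le> 0 + e" by (simp add: partitions_iff psum_rough_sum norm_minus_commute)
    qed
    then show ?thesis by simp
  qed
  ultimately show ?thesis using K that by blast
qed

end

section \<open>Smooth drivers\<close>

text \<open>The right-hand side is globally Lipschitz in the state on each bounded time interval, so
  the iterates converge on all of [0,\<infinity>) and one solution serves every T, with no gluing of
  local ones.\<close>

lemma picard_existence:
  fixes g :: "real \<Rightarrow> 'e::banach \<Rightarrow> 'e"
  assumes cont: "\<And>Y T. continuous_on {0..T} Y \<Longrightarrow> continuous_on {0..T} (\<lambda>s. g s (Y s))"
    and lip: "\<And>T. \<exists>L>0. \<forall>t\<in>{0..T}. \<forall>x y. norm (g t x - g t y) \<le> L * norm (x - y)"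
  obtains Y where "\<And>T. continuous_on {0..T} Y"
    "\<And>t. 0 \<le> t \<Longrightarrow> ((\<lambda>s. g s (Y s)) has_integral (Y t - \<xi>)) {0..t}"
proof -
  define P where "P = rec_nat (\<lambda>_. \<xi>) (\<lambda>_ p t. \<xi> + integral {0..t} (\<lambda>s. g s (p s)))"
  have P0: "P 0 t = \<xi>" and PS: "P (Suc n) t = \<xi> + integral {0..t} (\<lambda>s. g s (P n s))" for n t
    by (simp_all add: P_def)
  have Pc: "continuous_on {0..T} (P n)" for n T
  proof (induction n)
    case 0 show ?case by (simp add: P0[abs_def])
  next
    case (Suc n)
    show ?case unfolding PS[abs_def]
      by (intro continuous_intros indefinite_integral_continuous_1 integrable_continuous_real cont Suc)
  qed
  \<comment> \<open>The limit written as a telescoping series: T does not occur in it, and the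
    Weierstrass test gives uniform convergence on each [0,T].\<close>
  define Y where "Y t = \<xi> + (\<Sum>i. P (Suc i) t - P i t)" for t
  have unif: "uniform_limit {0..T} P Y sequentially" for T
  proof -
    obtain L where L: "L > 0" "\<And>t x y. 0 \<le> t \<Longrightarrow> t \<le> T \<Longrightarrow> norm (g t x - g t y) \<le> L * norm (x - y)"
      using lip[of T] by auto
    have "bounded ((\<lambda>t. P 1 t - P 0 t) ` {0..T})"
      by (intro compact_imp_bounded compact_continuous_image continuous_intros Pc) auto
    then obtain B where B: "0 < B" "\<And>t. 0 \<le> t \<Longrightarrow> t \<le> T \<Longrightarrow> norm (P 1 t - P 0 t) \<le> B"
      by (auto simp: bounded_pos)
    \<comment> \<open>The weight exp(2 L t) makes the iteration contract on an interval of any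
      length: integrating L exp(2 L s) returns the weight with factor 1/2.\<close>
    have step: "norm (P (Suc n) t - P n t) \<le> B * exp (2 * L * t) / 2 ^ n" if "0 \<le> t" "t \<le> T" for n t
      using that
    proof (induction n arbitrary: t)
      case 0
      have "1 \<le> exp (2 * L * t)" using L 0 by simp
      then have "B * 1 \<le> B * exp (2 * L * t)" using B(1) by (intro mult_left_mono) auto
      then show ?case using B(2)[OF 0] by simp
    next
      case (Suc n)
      let ?h = "\<lambda>s. L * (B * exp (2 * L * s) / 2 ^ n)"
      have i: "(\<lambda>s. g s (P n s)) integrable_on {0..t}" for n
        by (intro integrable_continuous_real cont Pc)
      have h: "(?h has_integral (B * exp (2 * L * t) / 2 ^ Suc n - B * exp (2 * L * 0) / 2 ^ Suc n)) {0..t}"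
        using L Suc.prems
        by (intro fundamental_theorem_of_calculus)
           (auto intro!: derivative_eq_intros simp: has_real_derivative_iff_has_vector_derivative[symmetric])
      have "P (Suc (Suc n)) t - P (Suc n) t = integral {0..t} (\<lambda>s. g s (P (Suc n) s) - g s (P n s))"
        unfolding PS[of "Suc n"] by (subst integral_diff[OF i i]) (simp add: PS)
      also have "norm \<dots> \<le> integral {0..t} ?h"
      proof (rule integral_norm_bound_integral)
        show "(\<lambda>s. g s (P (Suc n) s) - g s (P n s)) integrable_on {0..t}" by (intro integrable_diff i)
        show "?h integrable_on {0..t}" using h by (rule has_integral_integrable)
        fix s assume s: "s \<in> {0..t}"
        show "norm (g s (P (Suc n) s) - g s (P n s)) \<le> ?h s"
          using s Suc.prems L(1) Suc.IH[of s] by (intro order_trans[OF L(2)] mult_left_mono) auto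
      qed
      also have "\<dots> \<le> B * exp (2 * L * t) / 2 ^ Suc n"
        using integral_unique[OF h] B by simp
      finally show ?case .
    qed
    have "uniform_limit {0..T} (\<lambda>n t. \<Sum>i<n. P (Suc i) t - P i t) (\<lambda>t. \<Sum>i. P (Suc i) t - P i t) sequentially"
    proof (rule Weierstrass_m_test[where M = "\<lambda>n. B * exp (2 * L * T) * (1 / 2) ^ n"])
      show "summable (\<lambda>n. B * exp (2 * L * T) * (1 / 2) ^ n)" by (intro summable_mult summable_geometric) simp
      fix n t assume t: "t \<in> {0..T}"
      have "norm (P (Suc n) t - P n t) \<le> B * exp (2 * L * t) / 2 ^ n" using step t by auto
      also have "\<dots> \<le> B * exp (2 * L * T) / 2 ^ n"
        using t B L by (intro divide_right_mono mult_left_mono) auto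
      finally show "norm (P (Suc n) t - P n t) \<le> B * exp (2 * L * T) * (1 / 2) ^ n"
        by (simp add: power_one_over)
    qed
    moreover have "(\<Sum>i<n. P (Suc i) t - P i t) = P n t - \<xi>" for n t
      by (subst sum_lessThan_telescope) (simp add: P0)
    ultimately have "uniform_limit {0..T} (\<lambda>n t. P n t - \<xi>) (\<lambda>t. Y t - \<xi>) sequentially"
      by (simp add: Y_def)
    then show ?thesis by (simp add: uniform_limit_iff dist_norm)
  qed
  have Yc: "continuous_on {0..T} Y" for T
    by (rule uniform_limit_theorem[OF always_eventually unif]) (auto intro: Pc)
  have "((\<lambda>s. g s (Y s)) has_integral (Y t - \<xi>)) {0..t}" if t: "0 \<le> t" for t
  proof -
    obtain L where L: "L > 0" "\<And>s x y. 0 \<le> s \<Longrightarrow> s \<le> t \<Longrightarrow> norm (g s x - g s y) \<le> L * norm (x - y)"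
      using lip[of t] by auto
    have i: "(\<lambda>s. g s (Z s)) integrable_on {0..t}" if "continuous_on {0..t} Z" for Z
      by (intro integrable_continuous_real cont that)
    have "norm (Y t - \<xi> - integral {0..t} (\<lambda>s. g s (Y s))) \<le> 0"
    proof (rule field_le_epsilon)
      fix e :: real assume e: "0 < e"
      define e' where "e' = e / (1 + L * t)"
      have e': "0 < e'" using e L t by (auto simp: e'_def intro!: divide_pos_pos add_pos_nonneg)
      have "\<forall>\<^sub>F n in sequentially. \<forall>s\<in>{0..t}. dist (P n s) (Y s) < e'" by (rule uniform_limitD[OF unif e'])
      then obtain n where n: "\<And>m s. n \<le> m \<Longrightarrow> s \<in> {0..t} \<Longrightarrow> dist (P m s) (Y s) < e'"
        unfolding eventually_sequentially by meson
      have "integral {0..t} (\<lambda>s. g s (P n s)) - integral {0..t} (\<lambda>s. g s (Y s)) = integral {0..t} (\<lambda>s. g s (P n s) - g s (Y s))"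
        by (rule integral_diff[symmetric]) (auto intro: i Pc Yc)
      also have "norm \<dots> \<le> (L * e') * (t - 0)"
      proof (rule integral_bound)
        fix s assume s: "s \<in> {0..t}"
        show "norm (g s (P n s) - g s (Y s)) \<le> L * e'"
          using n[OF order_refl s] s L(1) by (intro order_trans[OF L(2)] mult_left_mono) (auto simp: dist_norm)
      qed (auto intro!: t continuous_intros cont Pc Yc)
      finally have 1: "norm (integral {0..t} (\<lambda>s. g s (P n s)) - integral {0..t} (\<lambda>s. g s (Y s))) \<le> L * e' * t" by simp
      have 2: "norm (Y t - P (Suc n) t) \<le> e'" using n[of "Suc n" t] t by (simp add: dist_norm norm_minus_commute)
      have "Y t - \<xi> - integral {0..t} (\<lambda>s. g s (Y s)) = (Y t - P (Suc n) t) + (integral {0..t} (\<lambda>s. g s (P n s)) - integral {0..t} (\<lambda>s. g s (Y s)))"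
        by (simp add: PS)
      also have "norm \<dots> \<le> e' + L * e' * t" by (intro norm_triangle_le add_mono 1 2)
      also have "\<dots> = e' * (1 + L * t)" by (simp add: algebra_simps)
      also have "\<dots> = e" using L t unfolding e'_def by (intro nonzero_eq_divide_eq[THEN iffD1]) (auto simp: add_nonneg_eq_0_iff)
      finally show "norm (Y t - \<xi> - integral {0..t} (\<lambda>s. g s (Y s))) \<le> 0 + e" by simp
    qed
    then have "Y t - \<xi> = integral {0..t} (\<lambda>s. g s (Y s))" by simp
    then show ?thesis using integrable_integral[OF i[OF Yc]] by simp
  qed
  then show ?thesis using that[OF Yc] by blast
qed

lemma norm_tensor: "norm (tensor x y) \<le> norm x * norm y"
proof -
  have "norm (tensor x y) = L2_set (\<lambda>i. norm (x $ i *\<^sub>R y)) UNIV"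
    unfolding norm_vec_def[of "tensor x y"]
    by (intro L2_set_cong arg_cong[where f = norm]) (auto simp: tensor_def vec_eq_iff)
  also have "\<dots> = norm x * norm y" by (simp add: L2_set_left_distrib norm_vec_def[of x])
  finally show ?thesis by simp
qed

lemma bounded_bilinear_tensor: "bounded_bilinear tensor"
  by (rule bounded_bilinear.intro)
     (auto simp: tensor_def vec_eq_iff algebra_simps intro!: exI[of _ 1] norm_tensor[unfolded tensor_def])

section \<open>Continuously differentiable paths and their canonical lifts\<close>

locale smooth_driver =
  fixes X X' :: "real \<Rightarrow> real^'m"
  assumes deriv: "(X has_vector_derivative X' t) (at t)" and cont: "continuous_on UNIV X'"
begin

definition area :: "real \<Rightarrow> real \<Rightarrow> real^'m^'m" where
  "area s t = integral {s..t} (\<lambda>r. tensor (X r - X s) (X' r))"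

lemma vector_derivative_eq: "vector_derivative X (at t) = X' t"
  by (rule vector_derivative_at[OF deriv])

lemma cont_X: "continuous_on S X"
  using deriv by (meson continuous_at_imp_continuous_on has_vector_derivative_continuous)

lemma cont_X': "continuous_on S X'"
  using cont continuous_on_subset by blast

lemma X_integral: "s \<le> t \<Longrightarrow> (X' has_integral (X t - X s)) {s..t}"
  by (rule fundamental_theorem_of_calculus) (auto intro: deriv has_vector_derivative_at_within)

text \<open>By additivity of the integral only [u,t] remains, where the two integrands differ by the
  constant X u - X s in the first tensor factor.\<close>

lemma area_chen:
  assumes "s \<le> u" "u \<le> t"
  shows "area s t - area s u - area u t = tensor (X u - X s) (X t - X u)"
proof -
  interpret bounded_bilinear "tensor :: real^'m \<Rightarrow> real^'m \<Rightarrow> real^'m^'m" by (rule bounded_bilinear_tensor)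
  have i: "(\<lambda>r. tensor (X r - X s) (X' r)) integrable_on {a..b}" for a b s
    by (intro integrable_continuous_real continuous_intros continuous_on cont_X cont_X')
  have "area s t - area s u = integral {u..t} (\<lambda>r. tensor (X r - X s) (X' r))"
    unfolding area_def using Henstock_Kurzweil_Integration.integral_combine[OF assms i] by (simp add: algebra_simps)
  also have "\<dots> - area u t = integral {u..t} (\<lambda>r. tensor (X r - X s) (X' r) - tensor (X r - X u) (X' r))"
    unfolding area_def by (rule integral_diff[symmetric]) (rule i)+
  also have "\<dots> = integral {u..t} (\<lambda>r. tensor (X u - X s) (X' r))"
    by (intro integral_cong) (simp add: diff_left[symmetric])
  also have "\<dots> = tensor (X u - X s) (X t - X u)"
    using has_integral_linear[OF X_integral[OF assms(2)] bounded_linear_right] by (intro integral_unique) (simp add: o_def)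
  finally show ?thesis .
qed

lemma derivative_bounded:
  obtains B where "0 \<le> B" "\<And>t. t \<in> {a..b} \<Longrightarrow> norm (X' t) \<le> B"
proof -
  have "bounded (X' ` {a..b})" by (intro compact_imp_bounded compact_continuous_image cont_X') auto
  then obtain B where "0 < B" "\<forall>x\<in>{a..b}. norm (X' x) \<le> B" by (auto simp: bounded_pos)
  then show ?thesis by (intro that[of B]) auto
qed

lemma increment_bound:
  assumes "\<And>t. t \<in> {a..b} \<Longrightarrow> norm (X' t) \<le> B" "a \<le> s" "s \<le> t" "t \<le> b"
  shows "norm (X t - X s) \<le> B * (t - s)"
  using integral_bound[of s t X' B] integral_unique[OF X_integral[of s t]] assms cont_X' by auto

lemma area_bound:
  assumes B: "\<And>t. t \<in> {a..b} \<Longrightarrow> norm (X' t) \<le> B" "0 \<le> B" and s: "a \<le> s" "s \<le> t" "t \<le> b"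
  shows "norm (area s t) \<le> B\<^sup>2 * (t - s)\<^sup>2"
proof -
  interpret bounded_bilinear "tensor :: real^'m \<Rightarrow> real^'m \<Rightarrow> real^'m^'m" by (rule bounded_bilinear_tensor)
  have "norm (area s t) \<le> (B * (t - s) * B) * (t - s)"
    unfolding area_def
  proof (rule integral_bound[OF s(2)])
    show "continuous_on {s..t} (\<lambda>r. tensor (X r - X s) (X' r))"
      by (intro continuous_intros continuous_on cont_X cont_X')
    fix r assume r: "r \<in> {s..t}"
    have "norm (tensor (X r - X s) (X' r)) \<le> norm (X r - X s) * norm (X' r)" by (rule norm_tensor)
    also have "\<dots> \<le> (B * (r - s)) * B"
      using r s B by (intro mult_mono increment_bound[OF B(1)]) auto
    also have "\<dots> \<le> (B * (t - s)) * B" using r B by (intro mult_right_mono mult_left_mono) auto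
    finally show "norm (tensor (X r - X s) (X' r)) \<le> B * (t - s) * B" .
  qed
  then show ?thesis by (simp add: power2_eq_square mult_ac)
qed

end

lemma ode_solution_initial:
  assumes "ode_solution f X \<xi> T Y" "0 \<le> T"
  shows "Y 0 = \<xi>"
proof -
  have "((\<lambda>s. f (Y s) *v vector_derivative X (at s)) has_integral (Y 0 - \<xi>)) {0..0}"
    using assms unfolding ode_solution_def by (meson atLeastAtMost_iff order_refl)
  from has_integral_unique[OF this has_integral_null_real] show ?thesis by simp
qed

section \<open>Ordinary differential equations along a smooth path\<close>

locale smooth_rde = rde_coefficients f c \<beta> + smooth_driver X X'
  for f :: "real^'d \<Rightarrow> real^'m^'d" and c \<beta> :: real and X X' :: "real \<Rightarrow> real^'m"
begin

text \<open>A Lipschitz path is \<beta>-Hoelder because t - s \<le> T^(1-\<beta>) (t - s)^\<beta>.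
  This M depends on the derivative and so serves statements about a single approximation only;
  uniform sizes come from convergence.\<close>

lemma driver_area:
  assumes T: "0 \<le> T"
  obtains M where "1 \<le> M" "driver T M X area"
proof -
  obtain B where B: "0 \<le> B" "\<And>t. t \<in> {0..T} \<Longrightarrow> norm (X' t) \<le> B" using derivative_bounded by blast
  define z where "z = T powr (1 - \<beta>)"
  define M where "M = 1 + B * z + (B * z)\<^sup>2"
  have z: "0 \<le> z" by (simp add: z_def)
  have le: "t - s \<le> z * (t - s) powr \<beta>" if "0 \<le> s" "s \<le> t" "t \<le> T" for s t
  proof (cases "s = t")
    case False
    then have "t - s = (t - s) powr (1 - \<beta>) * (t - s) powr \<beta>" using that by (simp flip: powr_add)
    also have "\<dots> \<le> z * (t - s) powr \<beta>"
      using that beta unfolding z_def by (intro mult_right_mono powr_mono2) auto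
    finally show ?thesis .
  qed simp
  have "norm (X t - X s) \<le> M * (t - s) powr \<beta> \<and> norm (area s t) \<le> M * ((t - s) powr \<beta>)\<^sup>2"
    if s: "0 \<le> s" "s \<le> t" "t \<le> T" for s t
  proof
    have b: "B * (t - s) \<le> B * z * (t - s) powr \<beta>" using mult_left_mono[OF le[OF s] B(1)] by (simp add: mult.assoc)
    have "norm (X t - X s) \<le> B * (t - s)" using increment_bound[OF B(2)] s by blast
    also note b
    also have "B * z * (t - s) powr \<beta> \<le> M * (t - s) powr \<beta>" by (intro mult_right_mono) (auto simp: M_def)
    finally show "norm (X t - X s) \<le> M * (t - s) powr \<beta>" .
    have "norm (area s t) \<le> (B * (t - s))\<^sup>2" using area_bound[OF B(2,1)] s by (simp add: power_mult_distrib)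
    also have "\<dots> \<le> (B * z * (t - s) powr \<beta>)\<^sup>2" using b B s by (intro power_mono) auto
    also have "\<dots> = (B * z)\<^sup>2 * ((t - s) powr \<beta>)\<^sup>2" by (simp add: power_mult_distrib)
    also have "\<dots> \<le> M * ((t - s) powr \<beta>)\<^sup>2" using B z by (intro mult_right_mono) (auto simp: M_def)
    finally show "norm (area s t) \<le> M * ((t - s) powr \<beta>)\<^sup>2" .
  qed
  moreover have "1 \<le> M" using B z by (simp add: M_def)
  ultimately show ?thesis using area_chen by (intro that[of M]) (auto simp: driver_def)
qed

lemma continuous_coefficient: "continuous_on S Y \<Longrightarrow> continuous_on S (\<lambda>s. f (Y s) *v X' s)"
proof -
  assume Y: "continuous_on S Y"
  have "continuous_on UNIV f"
    unfolding continuous_on_iff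
  proof (intro ballI allI impI)
    fix x :: "real^'d" and e :: real assume "0 < e"
    then show "\<exists>d>0. \<forall>x'\<in>UNIV. dist x' x < d \<longrightarrow> dist (f x') (f x) < e"
      using f_lip c1 by (intro exI[of _ "e / c"])
       (auto simp: dist_norm field_simps intro!: divide_pos_pos order.strict_trans1[OF f_lip])
  qed
  then have fY: "continuous_on S (\<lambda>s. f (Y s))" using Y continuous_on_compose2 by blast
  show ?thesis
    unfolding matrix_vector_mult_def
    by (intro continuous_on_vec_lambda continuous_intros fY cont_X')
qed

text \<open>The first-order error is the integral of (f(Y r) - f(Y s)) X' r, and the area is a
  double integral; both are quadratic in t - s. This is the starting bound that
  \<open>apriori\<close> asks for, with L depending on the path.\<close>

lemma ode_solution_defect:
  assumes Y: "ode_solution f X \<xi> T Y"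
  obtains L where "\<And>s t. 0 \<le> s \<Longrightarrow> s \<le> t \<Longrightarrow> t \<le> T \<Longrightarrow> norm (J X area Y s t) \<le> L * (t - s)\<^sup>2"
proof -
  obtain B where B: "0 \<le> B" "\<And>t. t \<in> {0..T} \<Longrightarrow> norm (X' t) \<le> B" using derivative_bounded by blast
  have Yc: "continuous_on {0..T} Y" and
    int: "\<And>t. t \<in> {0..T} \<Longrightarrow> ((\<lambda>s. f (Y s) *v X' s) has_integral (Y t - \<xi>)) {0..t}"
    using Y by (auto simp: ode_solution_def vector_derivative_eq)
  have c0: "0 \<le> c" using c1 by simp
  have cont: "continuous_on {s..t} (\<lambda>s. f (Y s) *v X' s)" if "0 \<le> s" "t \<le> T" for s t
    using that by (intro continuous_coefficient continuous_on_subset[OF Yc]) auto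
  have inc: "((\<lambda>s. f (Y s) *v X' s) has_integral (Y t - Y s)) {s..t}" if "0 \<le> s" "s \<le> t" "t \<le> T" for s t
  proof -
    have "integral {0..s} (\<lambda>s. f (Y s) *v X' s) + integral {s..t} (\<lambda>s. f (Y s) *v X' s) = integral {0..t} (\<lambda>s. f (Y s) *v X' s)"
      using that by (intro Henstock_Kurzweil_Integration.integral_combine integrable_continuous_real cont) auto
    then have "integral {s..t} (\<lambda>s. f (Y s) *v X' s) = Y t - Y s"
      using integral_unique[OF int[of s]] integral_unique[OF int[of t]] that by (simp add: algebra_simps)
    then show ?thesis using integrable_integral[OF integrable_continuous_real[OF cont[of s t]]] that by simp
  qed
  have Yb: "norm (Y t - Y s) \<le> c * B * (t - s)" if "0 \<le> s" "s \<le> t" "t \<le> T" for s t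
    using that B c1
    by (subst integral_unique[OF inc, symmetric]; (intro integral_bound cont order_trans[OF F_bound[unfolded rF_def]] mult_left_mono)?) auto
  have "norm (J X area Y s t) \<le> (c * (c * B) * B + c * B\<^sup>2) * (t - s)\<^sup>2" if st: "0 \<le> s" "s \<le> t" "t \<le> T" for s t
  proof -
    have fX: "((\<lambda>r. f (Y s) *v X' r) has_integral (f (Y s) *v (X t - X s))) {s..t}"
      using has_integral_linear[OF X_integral[OF st(2)] matrix_vector_mul_bounded_linear] by (simp add: o_def)
    have "((\<lambda>r. f (Y r) *v X' r - f (Y s) *v X' r) has_integral (Y t - Y s - f (Y s) *v (X t - X s))) {s..t}"
      by (intro has_integral_diff inc fX st)
    then have "norm (Y t - Y s - f (Y s) *v (X t - X s)) \<le> (c * (c * B * (t - s)) * B) * (t - s)"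
    proof (subst integral_unique[symmetric], assumption, intro integral_bound)
      show "continuous_on {s..t} (\<lambda>r. f (Y r) *v X' r - f (Y s) *v X' r)"
        by (intro continuous_on_diff cont st continuous_coefficient continuous_on_const)
      fix r assume r: "r \<in> {s..t}"
      have "norm (Y r - Y s) \<le> c * B * (r - s)" using Yb[of s r] r st by auto
      also have "\<dots> \<le> c * B * (t - s)" using r B c0 by (intro mult_left_mono) auto
      finally have y: "norm (Y r - Y s) \<le> c * B * (t - s)" .
      have "norm (f (Y r) *v X' r - f (Y s) *v X' r) \<le> c * norm (Y r - Y s) * norm (X' r)"
        using F_lip[of "Y r" "X' r" "Y s"] by (simp add: rF_def)
      also have "\<dots> \<le> c * (c * B * (t - s)) * B"
        using y c0 st r B by (intro mult_mono mult_left_mono mult_nonneg_nonneg) auto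
      finally show "norm (f (Y r) *v X' r - f (Y s) *v X' r) \<le> c * (c * B * (t - s)) * B" .
    qed (use st in auto)
    moreover have "norm (rG f (Y s) (area s t)) \<le> c * (B\<^sup>2 * (t - s)\<^sup>2)"
      using st by (intro order_trans[OF G_bound] mult_left_mono area_bound[OF B(2,1)] c0) auto
    ultimately have "norm (J X area Y s t) \<le> (c * (c * B * (t - s)) * B) * (t - s) + c * (B\<^sup>2 * (t - s)\<^sup>2)"
      unfolding J_def rF_def
      using norm_triangle_ineq4[of "Y t - Y s - f (Y s) *v (X t - X s)" "rG f (Y s) (area s t)"] by linarith
    then show ?thesis by (simp add: algebra_simps power2_eq_square)
  qed
  then show ?thesis using that by blast
qed

text \<open>Stability for a driver compared with itself, \<rho> = 0, in place of a Gronwall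
  argument.\<close>

lemma ode_solution_unique:
  assumes Y: "ode_solution f X \<xi> T Y" "ode_solution f X \<xi> T Z" and t: "0 \<le> t" "t \<le> T"
  shows "Y t = Z t"
proof -
  have T: "0 \<le> T" using t by simp
  obtain M where M: "1 \<le> M" "driver T M X area" by (rule driver_area[OF T])
  obtain K h where K: "0 < K" "0 < h" and ap: "\<And>T X W Y L. driver T M X W \<Longrightarrow>
      (\<And>s t. 0 \<le> s \<Longrightarrow> s \<le> t \<Longrightarrow> t \<le> T \<Longrightarrow> norm (J X W Y s t) \<le> L * (t - s)\<^sup>2) \<Longrightarrow> davie T K h X W Y"
    using apriori[OF M(1)] by blast
  have D: "davie T K h X area Y" if "ode_solution f X \<xi> T Y" for Y
    using ode_solution_defect[OF that] ap[OF M(2)] by metis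
  have cl: "close T 0 X area X area" by (simp add: close_def)
  have 0: "Y 0 = \<xi>" "Z 0 = \<xi>" using Y T by (auto intro: ode_solution_initial)
  obtain C where "norm (Y t - Z t) \<le> C * (norm (Y 0 - Z 0) + 0)"
    using stability[OF M(1) K T] M(2) cl D[OF Y(1)] D[OF Y(2)] t by (metis order_refl)
  then show ?thesis by (simp add: 0)
qed

lemma ode_flow:
  "\<exists>!Y. (\<forall>s<0. Y s = 0) \<and> (\<forall>T>0. ode_solution f X \<xi> T Y)"
proof (rule ex_ex1I)
  have "\<exists>L>0. \<forall>t\<in>{0..T}. \<forall>x y. norm (f x *v X' t - f y *v X' t) \<le> L * norm (x - y)" for T
  proof -
    obtain B where B: "0 \<le> B" "\<And>t. t \<in> {0..T} \<Longrightarrow> norm (X' t) \<le> B" using derivative_bounded by blast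
    have "norm (f x *v X' t - f y *v X' t) \<le> c * (B + 1) * norm (x - y)" if "t \<in> {0..T}" for t x y
    proof -
      have "norm (f x *v X' t - f y *v X' t) \<le> c * norm (x - y) * norm (X' t)"
        using F_lip[of x "X' t" y] by (simp add: rF_def)
      also have "\<dots> \<le> c * norm (x - y) * (B + 1)"
        using B(2)[OF that] c1 by (intro mult_left_mono) auto
      finally show ?thesis by (simp add: mult_ac)
    qed
    moreover have "0 < c * (B + 1)" using B c1 by simp
    ultimately show ?thesis by blast
  qed
  then obtain Y where Y: "\<And>T. continuous_on {0..T} Y"
    "\<And>t. 0 \<le> t \<Longrightarrow> ((\<lambda>s. f (Y s) *v X' s) has_integral (Y t - \<xi>)) {0..t}"
    using picard_existence[of "\<lambda>s y. f y *v X' s" \<xi>] continuous_coefficient by blast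
  define Z where "Z t = (if t < 0 then 0 else Y t)" for t
  have "ode_solution f X \<xi> T Z" for T
    unfolding ode_solution_def vector_derivative_eq
  proof (intro conjI ballI)
    show "continuous_on {0..T} Z" using Y(1)[of T] by (rule continuous_on_eq) (auto simp: Z_def)
    fix t assume t: "t \<in> {0..T}"
    have "((\<lambda>s. f (Z s) *v X' s) has_integral (Y t - \<xi>)) {0..t}"
      by (rule has_integral_eq[OF _ Y(2)]) (use t in \<open>auto simp: Z_def\<close>)
    then show "((\<lambda>s. f (Z s) *v X' s) has_integral (Z t - \<xi>)) {0..t}" using t by (simp add: Z_def)
  qed
  then show "\<exists>Y. (\<forall>s<0. Y s = 0) \<and> (\<forall>T>0. ode_solution f X \<xi> T Y)" by (intro exI[of _ Z]) (simp add: Z_def)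
next
  fix Y Z assume Y: "(\<forall>s<0. Y s = 0) \<and> (\<forall>T>0. ode_solution f X \<xi> T Y)"
     and Z: "(\<forall>s<0. Z s = 0) \<and> (\<forall>T>0. ode_solution f X \<xi> T Z)"
  have "Y t = Z t" for t
  proof (cases "t < 0")
    case False
    then show ?thesis using ode_solution_unique[of \<xi> "t + 1" Y Z t] Y Z by simp
  qed (use Y Z in simp)
  then show "Y = Z" by blast
qed

end

section \<open>The Brownian rough path as a limit of smooth lifts\<close>

text \<open>The oriented integral is also differentiated at negative times: the auxiliary interval
  [a,b] contains 0 and has t in its interior.\<close>

lemma has_vector_derivative_interval_integral:
  fixes g :: "real \<Rightarrow> 'e::euclidean_space"
  assumes "continuous_on UNIV g"
  shows "((\<lambda>t. LBINT r=ereal 0..ereal t. g r) has_vector_derivative g t) (at t)"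
proof -
  define a b where "a = min 0 t - 1" and "b = max 0 t + 1"
  have ab: "a < t" "t < b" "a \<le> 0" "0 \<le> b" by (auto simp: a_def b_def)
  have "((\<lambda>u. LBINT y=ereal 0..ereal u. g y) has_vector_derivative g t) (at t within {a..b})"
    by (rule interval_integral_FTC2) (use ab assms continuous_on_subset in auto)
  moreover have "at t within {a..b} = at t" using ab by (intro at_within_interior) auto
  ultimately show ?thesis by simp
qed

lemma smooth_driver_smooth_approx:
  assumes "continuous_on UNIV \<omega>"
  shows "smooth_driver (smooth_approx \<delta> \<omega>) (\<lambda>t. (1 / \<delta>) *\<^sub>R (\<omega> (\<delta> + t) - \<omega> t))"
proof
  have c: "continuous_on UNIV (\<lambda>r. \<omega> (\<delta> + r) - \<omega> r)"
    by (intro continuous_intros continuous_on_compose2[OF assms] assms) auto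
  then show "continuous_on UNIV (\<lambda>t. (1 / \<delta>) *\<^sub>R (\<omega> (\<delta> + t) - \<omega> t))"
    by (rule continuous_on_scaleR[OF continuous_on_const])
  show "(smooth_approx \<delta> \<omega> has_vector_derivative (1 / \<delta>) *\<^sub>R (\<omega> (\<delta> + t) - \<omega> t)) (at t)" for t
    unfolding smooth_approx_def[abs_def]
    by (rule bounded_linear.has_vector_derivative[OF bounded_linear_scaleR_right has_vector_derivative_interval_integral[OF c]])
qed

lemma smooth_area_eq:
  assumes "continuous_on UNIV \<omega>"
  shows "smooth_area \<delta> \<omega> = smooth_driver.area (smooth_approx \<delta> \<omega>) (\<lambda>t. (1 / \<delta>) *\<^sub>R (\<omega> (\<delta> + t) - \<omega> t))"
  by (intro ext) (simp add: smooth_area_def smooth_driver.area_def[OF smooth_driver_smooth_approx[OF assms]]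
     smooth_driver.vector_derivative_eq[OF smooth_driver_smooth_approx[OF assms]])

text \<open>This identifies the first level of the limit in \<open>good_paths\<close> with the path
  itself: the metric sees only increments, and the definition leaves X open.\<close>

lemma smooth_approx_tendsto:
  assumes "continuous_on UNIV \<omega>"
  shows "(\<lambda>i::nat. smooth_approx (1 / 2 ^ i) \<omega> t) \<longlonglongrightarrow> \<omega> t - \<omega> 0"
proof -
  define I where "I t = (LBINT r=ereal 0..ereal t. \<omega> r)" for t
  have I: "(I has_vector_derivative \<omega> t) (at t)" for t
    unfolding I_def[abs_def] by (rule has_vector_derivative_interval_integral[OF assms])
  \<comment> \<open>With I an antiderivative of \<omega>, the integral of \<omega>(\<delta> + r) -
    \<omega>(r) over [0,t] is I(\<delta> + t) - I(t) - I(\<delta>) + I(0): two difference quotients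
    of I after division by \<delta>.\<close>
  have eq: "smooth_approx \<delta> \<omega> t = (I (t + \<delta>) - I t) /\<^sub>R \<delta> - (I (0 + \<delta>) - I 0) /\<^sub>R \<delta>" for \<delta> t
  proof -
    have "((\<lambda>r. I (\<delta> + r) - I r) has_vector_derivative \<omega> (\<delta> + r) - \<omega> r) (at r within S)" for r S
    proof -
      have "((\<lambda>r. \<delta> + r) has_vector_derivative 1) (at r)"
        by (auto intro!: derivative_eq_intros simp: has_vector_derivative_def)
      from vector_diff_chain_at[OF this, of I "\<omega> (\<delta> + r)"] I
      have "((\<lambda>r. I (\<delta> + r)) has_vector_derivative \<omega> (\<delta> + r)) (at r)" by (simp add: o_def)
      from has_vector_derivative_diff[OF this I] show ?thesis by (rule has_vector_derivative_at_within)
    qed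
    moreover have "continuous_on S (\<lambda>r. \<omega> (\<delta> + r) - \<omega> r)" for S
      by (rule continuous_on_subset[OF _ subset_UNIV])
        (intro continuous_intros continuous_on_compose2[OF assms] assms; auto)
    ultimately have "(LBINT r=ereal 0..ereal t. \<omega> (\<delta> + r) - \<omega> r) = (I (\<delta> + t) - I t) - (I (\<delta> + 0) - I 0)"
      by (intro interval_integral_FTC_finite)
    then show ?thesis by (simp add: smooth_approx_def scaleR_diff_right add.commute divide_inverse)
  qed
  have lim: "(\<lambda>i. (I (t + 1 / 2 ^ i) - I t) /\<^sub>R (1 / 2 ^ i)) \<longlonglongrightarrow> \<omega> t" for t
  proof (rule vec_tendstoI)
    fix k
    have "DERIV (\<lambda>t. I t $ k) t :> \<omega> t $ k"
      using bounded_linear.has_vector_derivative[OF bounded_linear_vec_nth I]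
      by (simp add: has_real_derivative_iff_has_vector_derivative)
    then have "((\<lambda>h. (I (t + h) $ k - I t $ k) / h) \<longlongrightarrow> \<omega> t $ k) (at 0)" by (simp add: DERIV_def)
    moreover have "filterlim (\<lambda>i::nat. 1 / 2 ^ i :: real) (at 0) sequentially"
      unfolding filterlim_at using LIMSEQ_realpow_zero[of "1/2"] by (auto simp: power_one_over)
    ultimately have "(\<lambda>i. (I (t + 1 / 2 ^ i) $ k - I t $ k) / (1 / 2 ^ i)) \<longlonglongrightarrow> \<omega> t $ k"
      by (rule filterlim_compose)
    then show "(\<lambda>i. ((I (t + 1 / 2 ^ i) - I t) /\<^sub>R (1 / 2 ^ i)) $ k) \<longlonglongrightarrow> \<omega> t $ k"
      by (simp add: mult.commute)
  qed
  show ?thesis unfolding eq by (intro tendsto_diff lim)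
qed

section \<open>Convergence in the rough path metric and the limiting area\<close>

lemma rough_dist_leD:
  assumes "rough_dist \<beta> T1 T2 (X, V) (Y, W) \<le> ennreal e" "0 \<le> e" and st: "T1 \<le> s" "s < t" "t \<le> T2"
  shows "norm ((X t - X s) - (Y t - Y s)) \<le> e * (t - s) powr \<beta>"
    and "norm (V s t - W s t) \<le> e * ((t - s) powr \<beta>)\<^sup>2"
proof -
  define a where "a = norm (X t - X s - Y t + Y s) / (t - s) powr \<beta>"
  define b where "b = norm (V s t - W s t) / (t - s) powr (2 * \<beta>)"
  have "ennreal (a + b) \<le> rough_dist \<beta> T1 T2 (X, V) (Y, W)"
    unfolding rough_dist_def a_def b_def
    by simp (rule SUP_upper2[of "(s, t)"], use st in auto)
  then have "ennreal (a + b) \<le> ennreal e" using assms(1) by (rule order_trans)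
  then have "a + b \<le> e" using assms(2) by simp
  moreover have "0 \<le> a" "0 \<le> b" by (auto simp: a_def b_def)
  ultimately have "a \<le> e" "b \<le> e" by auto
  then have "norm (X t - X s - Y t + Y s) \<le> e * (t - s) powr \<beta>" "norm (V s t - W s t) \<le> e * (t - s) powr (2 * \<beta>)"
    using st by (auto simp: a_def b_def pos_divide_le_eq)
  moreover have "(t - s) powr (2 * \<beta>) = ((t - s) powr \<beta>)\<^sup>2" using st by (simp add: powr_power)
  ultimately show "norm ((X t - X s) - (Y t - Y s)) \<le> e * (t - s) powr \<beta>"
    "norm (V s t - W s t) \<le> e * ((t - s) powr \<beta>)\<^sup>2" by (simp_all add: algebra_simps)
qed

lemma rough_dist_eventually:
  assumes "(\<lambda>i. rough_dist \<beta> T1 T2 (X i, V i) (Y, W)) \<longlonglongrightarrow> 0" "0 < e"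
  shows "\<forall>\<^sub>F i in sequentially. \<forall>s t. T1 \<le> s \<and> s < t \<and> t \<le> T2 \<longrightarrow>
     norm ((X i t - X i s) - (Y t - Y s)) \<le> e * (t - s) powr \<beta> \<and>
     norm (V i s t - W s t) \<le> e * ((t - s) powr \<beta>)\<^sup>2"
proof -
  have "\<forall>\<^sub>F i in sequentially. rough_dist \<beta> T1 T2 (X i, V i) (Y, W) < ennreal e"
    using assms by (intro order_tendstoD) auto
  then show ?thesis
  proof eventually_elim
    case (elim i)
    then show ?case using rough_dist_leD[OF less_imp_le[OF elim]] assms(2) by auto
  qed
qed

lemma tendsto_of_eventually_norm_le:
  fixes a :: "nat \<Rightarrow> 'a::real_normed_vector"
  assumes "\<And>e. 0 < e \<Longrightarrow> \<forall>\<^sub>F i in sequentially. norm (a i - l) \<le> e * p"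
  shows "a \<longlonglongrightarrow> l"
proof (rule tendstoI)
  fix e :: real assume "0 < e"
  then have "0 < e / (\<bar>p\<bar> + 1)" by simp
  from assms[OF this] show "\<forall>\<^sub>F i in sequentially. dist (a i) l < e"
  proof eventually_elim
    case (elim i)
    also have "e / (\<bar>p\<bar> + 1) * p \<le> e / (\<bar>p\<bar> + 1) * \<bar>p\<bar>" using \<open>0 < e\<close> by (intro mult_left_mono) auto
    also have "\<dots> < e" using \<open>0 < e\<close> by (simp add: field_simps)
    finally show ?case by (simp add: dist_norm)
  qed
qed

lemma rough_dist_tendsto:
  assumes "(\<lambda>i. rough_dist \<beta> T1 T2 (X i, V i) (Y, W)) \<longlonglongrightarrow> 0" "T1 \<le> s" "s < t" "t \<le> T2"
  shows "(\<lambda>i. X i t - X i s) \<longlonglongrightarrow> Y t - Y s" and "(\<lambda>i. V i s t) \<longlonglongrightarrow> W s t"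
proof -
  note ev = rough_dist_eventually[OF assms(1)]
  show "(\<lambda>i. X i t - X i s) \<longlonglongrightarrow> Y t - Y s"
    by (rule tendsto_of_eventually_norm_le[where p = "(t - s) powr \<beta>"], rule eventually_mono[OF ev]) (use assms in auto)
  show "(\<lambda>i. V i s t) \<longlonglongrightarrow> W s t"
    by (rule tendsto_of_eventually_norm_le[where p = "((t - s) powr \<beta>)\<^sup>2"], rule eventually_mono[OF ev]) (use assms in auto)
qed

text \<open>Chen's relation with all three times equal. It supplies the value at s = t, which the
  metric does not see.\<close>

lemma rough_path_diagonal:
  assumes "rough_path \<beta> T1 T2 X W" "T1 \<le> s" "s \<le> T2"
  shows "W s s = 0"
proof -
  have "W s s - W s s - W s s = tensor (X s - X s) (X s - X s)"
    using assms unfolding rough_path_def by blast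
  then show ?thesis by (simp add: tensor_def vec_eq_iff)
qed

lemma smooth_area_diagonal: "smooth_area \<delta> x s s = 0"
  by (simp add: smooth_area_def)

text \<open>This justifies the definite description of \<open>brownian_area\<close>. The hypothesis
  allows a different limit for every n and \<beta>, but metric convergence implies pointwise
  convergence of the areas, so all limits agree on s < t.\<close>

lemma limit_area_unique:
  fixes x :: "real \<Rightarrow> real^'m"
  assumes x: "continuous_on UNIV x" "x 0 = 0"
    and good: "\<And>(n::nat) \<beta>. 1/3 < \<beta> \<Longrightarrow> \<beta> < 1/2 \<Longrightarrow>
     \<exists>X W. rough_path \<beta> (- real n) (real n) X W \<and>
        (\<lambda>i::nat. rough_dist \<beta> (- real n) (real n) (smooth_lift (1 / 2 ^ i) x) (X, W)) \<longlonglongrightarrow> 0"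
  shows "\<exists>!W. (\<forall>s t. t < s \<longrightarrow> W s t = 0) \<and>
     (\<forall>(n::nat) \<beta>. 1/3 < \<beta> \<and> \<beta> < 1/2 \<longrightarrow>
        rough_path \<beta> (- real n) (real n) x W \<and>
        (\<lambda>i::nat. rough_dist \<beta> (- real n) (real n) (smooth_lift (1 / 2 ^ i) x) (x, W)) \<longlonglongrightarrow> 0)"
    (is "\<exists>!W. ?P W")
proof (rule ex_ex1I)
  \<comment> \<open>The pointwise limit mentions neither n nor \<beta>, hence gives one candidate
    for all windows and exponents.\<close>
  define W where "W s t = (if s \<le> t then lim (\<lambda>i. smooth_area (1 / 2 ^ i) x s t) else 0)" for s t
  have "rough_path \<beta> (- real n) (real n) x W \<and>
        (\<lambda>i::nat. rough_dist \<beta> (- real n) (real n) (smooth_lift (1 / 2 ^ i) x) (x, W)) \<longlonglongrightarrow> 0"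
    if \<beta>: "1/3 < \<beta>" "\<beta> < 1/2" for n \<beta>
  proof -
    obtain X0 W0 where r: "rough_path \<beta> (- real n) (real n) X0 W0"
      and l: "(\<lambda>i::nat. rough_dist \<beta> (- real n) (real n) (smooth_lift (1 / 2 ^ i) x) (X0, W0)) \<longlonglongrightarrow> 0"
      using good[OF \<beta>] by blast
    note lim = rough_dist_tendsto[OF l[unfolded smooth_lift_def]]
    have X: "x t - x s = X0 t - X0 s" if "- real n \<le> s" "s < t" "t \<le> real n" for s t
    proof -
      have "(\<lambda>i::nat. smooth_approx (1 / 2 ^ i) x t - smooth_approx (1 / 2 ^ i) x s) \<longlonglongrightarrow> (x t - x 0) - (x s - x 0)"
        by (intro tendsto_diff smooth_approx_tendsto x)
      then show ?thesis using LIMSEQ_unique[OF lim(1)[OF that]] x by simp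
    qed
    then have X: "x t - x s = X0 t - X0 s" if "s \<in> {- real n..real n}" "t \<in> {- real n..real n}" for s t
    proof (cases s t rule: linorder_cases)
      case less
      then show ?thesis using X[of s t] that by simp
    next
      case greater
      then have "x s - x t = X0 s - X0 t" using X[of t s] that by simp
      then show ?thesis by (metis minus_diff_eq)
    qed simp
    have W: "W s t = W0 s t" if "- real n \<le> s" "s \<le> t" "t \<le> real n" for s t
    proof (cases "s = t")
      case True
      then show ?thesis using rough_path_diagonal[OF r, of s] that by (simp add: W_def smooth_area_diagonal)
    next
      case False
      then show ?thesis using limI[OF lim(2)[of s t]] that by (simp add: W_def)
    qed
    have "rough_path \<beta> (- real n) (real n) x W"
      unfolding rough_path_def
    proof (intro conjI allI impI)
      show "holder_on \<beta> {- real n..real n} x" using r X by (simp add: rough_path_def holder_on_def)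
      show "\<exists>C. \<forall>s t. - real n \<le> s \<and> s < t \<and> t \<le> real n \<longrightarrow> norm (W s t) \<le> C * (t - s) powr (2 * \<beta>)"
        using r W unfolding rough_path_def by auto
      fix s u t assume s: "- real n \<le> s \<and> s \<le> u \<and> u \<le> t \<and> t \<le> real n"
      then have "W0 s t - W0 s u - W0 u t = tensor (X0 u - X0 s) (X0 t - X0 u)"
        using r unfolding rough_path_def by blast
      moreover have "x u - x s = X0 u - X0 s" "x t - x u = X0 t - X0 u" by (rule X; use s in simp)+
      ultimately show "W s t - W s u - W u t = tensor (x u - x s) (x t - x u)"
        using s W[of s t] W[of s u] W[of u t] by auto
    qed
    moreover have "rough_dist \<beta> (- real n) (real n) (Z, V) (x, W) = rough_dist \<beta> (- real n) (real n) (Z, V) (X0, W0)" for Z V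
    proof -
      have "Z t - Z s - x t + x s = Z t - Z s - X0 t + X0 s" if "- real n \<le> s" "s < t" "t \<le> real n" for s t
        using X[of s t] that by (simp add: algebra_simps)
      note eq = this
      show ?thesis
        unfolding rough_dist_def prod.case by (rule SUP_cong) (auto simp: eq W)
    qed
    ultimately show ?thesis using l by (simp add: smooth_lift_def)
  qed
  then show "\<exists>W. ?P W" by (intro exI[of _ W]) (auto simp: W_def)
next
  fix V W assume VW: "?P V" "?P W"
  have "V s t = W s t" for s t
  proof (cases s t rule: linorder_cases)
    case greater then show ?thesis using VW by simp
  next
    case equal
    obtain n :: nat where "\<bar>s\<bar> \<le> real n" using real_arch_simple by blast
    then have "V s s = 0" "W s s = 0"
      \<comment> \<open>Any exponent strictly between 1/3 and 1/2 will do; 2/5 is one.\<close>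
      using VW rough_path_diagonal[of "2/5" "- real n" "real n" x _ s] by auto
    then show ?thesis using equal by simp
  next
    case less
    obtain n :: nat where n: "max \<bar>s\<bar> \<bar>t\<bar> \<le> real n" using real_arch_simple by blast
    have "(\<lambda>i. smooth_area (1 / 2 ^ i) x s t) \<longlonglongrightarrow> U s t" if "?P U" for U
    proof -
      have "(\<lambda>i::nat. rough_dist (2/5) (- real n) (real n) (smooth_approx (1 / 2 ^ i) x, smooth_area (1 / 2 ^ i) x) (x, U)) \<longlonglongrightarrow> 0"
        using that by (simp add: smooth_lift_def)
      from rough_dist_tendsto(2)[OF this, of s t] show ?thesis using n less by (auto simp: abs_le_iff)
    qed
    from LIMSEQ_unique[OF this[OF VW(1)] this[OF VW(2)]] show ?thesis .
  qed
  then show "V = W" by blast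
qed

text \<open>Off \<open>good_paths\<close> the path is replaced by zero, whose lifts vanish for every
  \<delta> and converge trivially. Thus the area is well defined for every \<omega> in \<Omega>, not
  just almost surely.\<close>

lemma brownian_rough_path:
  fixes \<Omega> :: "(real \<Rightarrow> real^'m) set"
  assumes \<Omega>: "\<Omega> \<subseteq> C0" and \<omega>: "\<omega> \<in> \<Omega>"
  shows "continuous_on UNIV (path_version \<Omega> \<omega>)"
    and "1/3 < \<beta> \<Longrightarrow> \<beta> < 1/2 \<Longrightarrow> rough_path \<beta> (- real n) (real n) (path_version \<Omega> \<omega>) (brownian_area \<Omega> \<omega>)"
    and "1/3 < \<beta> \<Longrightarrow> \<beta> < 1/2 \<Longrightarrow> (\<lambda>i::nat. rough_dist \<beta> (- real n) (real n)
            (smooth_lift (1 / 2 ^ i) (path_version \<Omega> \<omega>)) (path_version \<Omega> \<omega>, brownian_area \<Omega> \<omega>)) \<longlonglongrightarrow> 0"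
proof -
  define x where "x = path_version \<Omega> \<omega>"
  have x: "continuous_on UNIV x" "x 0 = 0"
    using \<Omega> \<omega> by (auto simp: x_def path_version_def C0_def)
  then show "continuous_on UNIV (path_version \<Omega> \<omega>)" by (simp add: x_def)
  have "\<exists>X W. rough_path \<beta> (- real n) (real n) X W \<and>
        (\<lambda>i::nat. rough_dist \<beta> (- real n) (real n) (smooth_lift (1 / 2 ^ i) x) (X, W)) \<longlonglongrightarrow> 0"
    if \<beta>: "1/3 < \<beta>" "\<beta> < 1/2" for n \<beta>
  proof (cases "\<omega> \<in> good_paths \<Omega>")
    case True
    then show ?thesis using \<beta> by (simp add: good_paths_def x_def path_version_def)
  next
    case False
    then have "smooth_lift \<delta> x = (\<lambda>_. 0, \<lambda>_ _. 0)" for \<delta>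
      by (auto simp: smooth_lift_def smooth_area_def smooth_approx_def x_def path_version_def tensor_def
          zero_vec_def[symmetric] intro!: ext)
    moreover have "(SUP x\<in>S. 0::ennreal) = 0" for S :: "(real \<times> real) set" by (cases "S = {}") (auto simp: bot_ennreal)
    ultimately show ?thesis
      by (intro exI[of _ "\<lambda>_. 0"] exI[of _ "\<lambda>_ _. 0"])
         (auto simp: rough_path_def holder_on_def rough_dist_def tensor_def zero_vec_def[symmetric] case_prod_unfold
           intro!: exI[of _ 0])
  qed
  from theI'[OF limit_area_unique[OF x this], folded brownian_area_def[of \<Omega> \<omega>, folded x_def]]
  show "1/3 < \<beta> \<Longrightarrow> \<beta> < 1/2 \<Longrightarrow> rough_path \<beta> (- real n) (real n) (path_version \<Omega> \<omega>) (brownian_area \<Omega> \<omega>)"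
    and "1/3 < \<beta> \<Longrightarrow> \<beta> < 1/2 \<Longrightarrow> (\<lambda>i::nat. rough_dist \<beta> (- real n) (real n)
            (smooth_lift (1 / 2 ^ i) (path_version \<Omega> \<omega>)) (path_version \<Omega> \<omega>, brownian_area \<Omega> \<omega>)) \<longlonglongrightarrow> 0"
    by (simp_all add: x_def)
qed

section \<open>Passage to the limit\<close>

lemma ennreal_tendsto_0I:
  fixes g :: "nat \<Rightarrow> ennreal"
  assumes "\<And>e. 0 < e \<Longrightarrow> \<forall>\<^sub>F i in sequentially. g i \<le> ennreal e"
  shows "g \<longlonglongrightarrow> 0"
proof (rule order_tendstoI)
  fix a :: ennreal assume "0 < a"
  then obtain b where b: "0 < b" "b < a" using dense by blast
  then have "b \<noteq> \<infinity>" by auto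
  then have eb: "ennreal (enn2real b) = b" by (simp add: less_top)
  then have "0 < enn2real b" using b(1) by (metis ennreal_0 enn2real_nonneg less_le order_less_irrefl)
  from assms[OF this] show "\<forall>\<^sub>F i in sequentially. g i < a"
    by eventually_elim (use eb b in auto)
qed simp

context rde_coefficients
begin

lemma F_tendsto:
  assumes "y \<longlonglongrightarrow> y'" "a \<longlonglongrightarrow> a'"
  shows "(\<lambda>i. rF f (y i) (a i)) \<longlonglongrightarrow> rF f y' a'"
proof (rule LIM_zero_cancel, rule Lim_null_comparison)
  show "\<forall>\<^sub>F i in sequentially. norm (rF f (y i) (a i) - rF f y' a') \<le> c * norm (y i - y') * norm (a i) + c * norm (a i - a')"
    using F_diff_bound by auto
  have "(\<lambda>i. c * norm (y i - y') * norm (a i) + c * norm (a i - a')) \<longlonglongrightarrow> c * norm (y' - y') * norm a' + c * norm (a' - a')"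
    by (intro tendsto_intros assms)
  then show "(\<lambda>i. c * norm (y i - y') * norm (a i) + c * norm (a i - a')) \<longlonglongrightarrow> 0" by simp
qed

lemma G_tendsto:
  assumes "y \<longlonglongrightarrow> y'" "a \<longlonglongrightarrow> a'"
  shows "(\<lambda>i. rG f (y i) (a i)) \<longlonglongrightarrow> rG f y' a'"
proof (rule LIM_zero_cancel, rule Lim_null_comparison)
  show "\<forall>\<^sub>F i in sequentially. norm (rG f (y i) (a i) - rG f y' a') \<le> c * norm (y i - y') * norm (a i) + c * norm (a i - a')"
    using G_diff_bound by auto
  have "(\<lambda>i. c * norm (y i - y') * norm (a i) + c * norm (a i - a')) \<longlonglongrightarrow> c * norm (y' - y') * norm a' + c * norm (a' - a')"
    by (intro tendsto_intros assms)
  then show "(\<lambda>i. c * norm (y i - y') * norm (a i) + c * norm (a i - a')) \<longlonglongrightarrow> 0" by simp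
qed

lemma driver_mono: "driver T M X W \<Longrightarrow> M \<le> M' \<Longrightarrow> driver T M' X W"
  unfolding driver_def by (meson mult_right_mono order_trans powr_ge_zero zero_le_power2)

lemma close_triangle:
  assumes "close T a X V Y W" "close T b X' V' Y W"
  shows "close T (a + b) X V X' V'"
  unfolding close_def
proof (intro allI impI)
  fix s t assume st: "0 \<le> s \<and> s \<le> t \<and> t \<le> T"
  have 1: "norm ((X t - X s) - (Y t - Y s)) \<le> a * (t - s) powr \<beta>" "norm (V s t - W s t) \<le> a * ((t - s) powr \<beta>)\<^sup>2"
    and 2: "norm ((X' t - X' s) - (Y t - Y s)) \<le> b * (t - s) powr \<beta>" "norm (V' s t - W s t) \<le> b * ((t - s) powr \<beta>)\<^sup>2"
    using assms st by (auto simp: close_def)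
  show "norm ((X t - X s) - (X' t - X' s)) \<le> (a + b) * (t - s) powr \<beta> \<and> norm (V s t - V' s t) \<le> (a + b) * ((t - s) powr \<beta>)\<^sup>2"
    using norm_triangle_ineq4[of "(X t - X s) - (Y t - Y s)" "(X' t - X' s) - (Y t - Y s)"]
      norm_triangle_ineq4[of "V s t - W s t" "V' s t - W s t"] 1 2 by (simp add: algebra_simps)
qed

lemma driver_of_close:
  assumes d: "driver T M X W" and cl: "close T e X' W' X W"
    and chen: "\<And>s u t. s \<le> u \<Longrightarrow> u \<le> t \<Longrightarrow> W' s t - W' s u - W' u t = tensor (X' u - X' s) (X' t - X' u)"
  shows "driver T (M + e) X' W'"
  unfolding driver_def
proof (intro conjI allI impI; (elim conjE)?)
  fix s t assume st: "0 \<le> s" "s \<le> t" "t \<le> T"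
  have 1: "norm (X t - X s) \<le> M * (t - s) powr \<beta>" "norm (W s t) \<le> M * ((t - s) powr \<beta>)\<^sup>2"
    and 2: "norm ((X' t - X' s) - (X t - X s)) \<le> e * (t - s) powr \<beta>" "norm (W' s t - W s t) \<le> e * ((t - s) powr \<beta>)\<^sup>2"
    using d cl st by (auto simp: driver_def close_def)
  show "norm (X' t - X' s) \<le> (M + e) * (t - s) powr \<beta>"
    using norm_triangle_ineq[of "X t - X s" "(X' t - X' s) - (X t - X s)"] 1 2 by (simp add: algebra_simps)
  show "norm (W' s t) \<le> (M + e) * ((t - s) powr \<beta>)\<^sup>2"
    using norm_triangle_ineq[of "W s t" "W' s t - W s t"] 1 2 by (simp add: algebra_simps)
qed (use chen in auto)

text \<open>The two bounds hold with different constants and at different scales; both are weakened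
  to the common constant L and scale h, after which stability applies with \<rho> = 0 and equal
  initial values.\<close>

lemma davie_unique:
  assumes d: "driver T M X W" and Y: "0 \<le> K" "davie T K T X W Y" and Z: "0 \<le> K'" "0 < h" "davie T K' h X W Z"
    and 0: "Y 0 = Z 0" and t: "0 \<le> t" "t \<le> T"
  shows "Y t = Z t"
proof -
  have T: "0 \<le> T" using t by simp
  define L where "L = K + K' + 1"
  have D: "davie T L h X W U" if "davie T k h' X W U" "k \<le> L" "min h T \<le> h'" for k h' U
    unfolding davie_def
  proof (intro allI impI)
    fix s t assume "0 \<le> s \<and> s \<le> t \<and> t \<le> T \<and> t - s \<le> h"
    then have "norm (J X W U s t) \<le> k * ((t - s) powr \<beta>) ^ 3" using that by (auto simp: davie_def)
    also have "\<dots> \<le> L * ((t - s) powr \<beta>) ^ 3" using that by (intro mult_right_mono) auto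
    finally show "norm (J X W U s t) \<le> L * ((t - s) powr \<beta>) ^ 3" .
  qed
  have DY: "davie T L h X W Y" using Y Z by (intro D[of K T]) (auto simp: L_def)
  have DZ: "davie T L h X W Z" using Y Z by (intro D[of K' h]) (auto simp: L_def)
  have d': "driver T (max 1 M) X W" by (rule driver_mono[OF d]) simp
  have cl: "close T 0 X W X W" by (simp add: close_def)
  have L: "0 < L" using Y Z by (simp add: L_def)
  obtain C where "norm (Y t - Z t) \<le> C * (norm (Y 0 - Z 0) + 0)"
    using stability[OF max.cobounded1 L Z(2) T, of M] d' cl DY DZ t by (metis order_refl)
  then show ?thesis by (simp add: 0)
qed

end

text \<open>A rough path \<open>(x, A)\<close> that is the limit of the canonical lifts \<open>(X i, V i)\<close> of smooth paths.\<close>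

locale smooth_approximation = rde_coefficients f c \<beta>
  for f :: "real^'d \<Rightarrow> real^'m^'d" and c \<beta> :: real +
  fixes x :: "real \<Rightarrow> real^'m" and A :: "real \<Rightarrow> real \<Rightarrow> real^'m^'m"
    and X X' :: "nat \<Rightarrow> real \<Rightarrow> real^'m" and V :: "nat \<Rightarrow> real \<Rightarrow> real \<Rightarrow> real^'m^'m"
    and \<xi>s :: "nat \<Rightarrow> real^'d" and \<xi> :: "real^'d" and Y :: "nat \<Rightarrow> real \<Rightarrow> real^'d"
  assumes smooth: "\<And>i. smooth_driver (X i) (X' i)"
    and area: "\<And>i. V i = smooth_driver.area (X i) (X' i)"
    and limit: "\<And>T. 0 < T \<Longrightarrow> \<exists>M\<ge>1. driver T M x A"
    and conv: "\<And>T e. 0 < T \<Longrightarrow> 0 < e \<Longrightarrow> \<forall>\<^sub>F i in sequentially. close T e (X i) (V i) x A"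
    and initial: "\<xi>s \<longlonglongrightarrow> \<xi>"
    and Y_neg: "\<And>i s. s < 0 \<Longrightarrow> Y i s = 0"
    and Y: "\<And>i T. 0 < T \<Longrightarrow> ode_solution f (X i) (\<xi>s i) T (Y i)"
begin

lemma smooth_rde: "smooth_rde f c \<beta> (X i) (X' i)"
  by (intro smooth_rde.intro rde_coefficients_axioms smooth)

lemma chen: "s \<le> u \<Longrightarrow> u \<le> t \<Longrightarrow> V i s t - V i s u - V i u t = tensor (X i u - X i s) (X i t - X i u)"
  unfolding area by (rule smooth_driver.area_chen[OF smooth])

lemma Y_initial: "Y i 0 = \<xi>s i"
  using ode_solution_initial[OF Y[of 1]] by simp

text \<open>Eventually the approximations are within distance 1 of the limit and so have size at
  most M + 1. The quadratic bound on \<open>J\<close> depends on i, but the K and h of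
  \<open>apriori\<close> depend on M + 1 alone.\<close>

lemma uniform_bounds:
  assumes T: "0 < T"
  obtains M K h where "1 \<le> M" "0 < K" "0 < h" "driver T M x A"
    "\<forall>\<^sub>F i in sequentially. driver T M (X i) (V i) \<and> davie T K h (X i) (V i) (Y i)"
proof -
  obtain M where M: "1 \<le> M" "driver T M x A" using limit[OF T] by blast
  have M1: "1 \<le> M + 1" using M by simp
  obtain K h where K: "0 < K" "0 < h" and ap: "\<And>T X W Y L. driver T (M + 1) X W \<Longrightarrow>
      (\<And>s t. 0 \<le> s \<Longrightarrow> s \<le> t \<Longrightarrow> t \<le> T \<Longrightarrow> norm (J X W Y s t) \<le> L * (t - s)\<^sup>2) \<Longrightarrow> davie T K h X W Y"
    using apriori[OF M1] by blast
  have "\<forall>\<^sub>F i in sequentially. driver T (M + 1) (X i) (V i) \<and> davie T K h (X i) (V i) (Y i)"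
    using conv[OF T zero_less_one]
  proof eventually_elim
    case (elim i)
    have d: "driver T (M + 1) (X i) (V i)" by (rule driver_of_close[OF M(2) elim chen])
    obtain L where "\<And>s t. 0 \<le> s \<Longrightarrow> s \<le> t \<Longrightarrow> t \<le> T \<Longrightarrow> norm (J (X i) (V i) (Y i) s t) \<le> L * (t - s)\<^sup>2"
      using smooth_rde.ode_solution_defect[OF smooth_rde Y[OF T]] unfolding area by blast
    from ap[OF d this] d show ?case by blast
  qed
  moreover have "driver T (M + 1) x A" by (rule driver_mono[OF M(2)]) simp
  ultimately show ?thesis using that M1 K by blast
qed

text \<open>Approximations are compared with each other, which presupposes no solution of the
  limiting equation; existence of that solution is a consequence.\<close>

lemma Y_Cauchy:
  assumes t: "0 \<le> t"
  shows "Cauchy (\<lambda>i. Y i t)"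
proof (rule metric_CauchyI)
  fix e :: real assume e: "0 < e"
  define T where "T = t + 1"
  have T: "0 < T" using t by (simp add: T_def)
  obtain M K h where M: "1 \<le> M" "0 < K" "0 < h"
    and ev: "\<forall>\<^sub>F i in sequentially. driver T M (X i) (V i) \<and> davie T K h (X i) (V i) (Y i)"
    by (rule uniform_bounds[OF T])
  obtain C where C: "0 < C" and stab: "\<And>\<rho> X W X' W' Y Y' s t. driver T M X W \<Longrightarrow> driver T M X' W' \<Longrightarrow> close T \<rho> X W X' W' \<Longrightarrow>
      davie T K h X W Y \<Longrightarrow> davie T K h X' W' Y' \<Longrightarrow> 0 \<le> \<rho> \<Longrightarrow>
      0 \<le> s \<Longrightarrow> s \<le> t \<Longrightarrow> t \<le> T \<Longrightarrow>
      norm (Y s - Y' s) \<le> C * (norm (Y 0 - Y' 0) + \<rho>) \<and>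
      norm ((Y t - Y s) - (Y' t - Y' s)) \<le> C * (norm (Y 0 - Y' 0) + \<rho>) * (t - s) powr \<beta>"
    using stability[OF M less_imp_le[OF T]] by blast
  \<comment> \<open>The initial values contribute r and the drivers r + r, so the total is 3 C r <
    e.\<close>
  define r where "r = e / (4 * C)"
  have r: "0 < r" using e C by (simp add: r_def)
  have "\<forall>\<^sub>F i in sequentially. dist (\<xi>s i) \<xi> < r / 2" using initial r by (intro tendstoD) auto
  moreover note conv[OF T r] ev
  ultimately have "\<forall>\<^sub>F i in sequentially. dist (\<xi>s i) \<xi> < r / 2 \<and> close T r (X i) (V i) x A \<and>
       driver T M (X i) (V i) \<and> davie T K h (X i) (V i) (Y i)"
    by eventually_elim blast
  then obtain N where N: "\<And>i. N \<le> i \<Longrightarrow> dist (\<xi>s i) \<xi> < r / 2 \<and> close T r (X i) (V i) x A \<and>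
       driver T M (X i) (V i) \<and> davie T K h (X i) (V i) (Y i)"
    unfolding eventually_sequentially by blast
  have "dist (Y i t) (Y j t) < e" if "N \<le> i" "N \<le> j" for i j
  proof -
    note i = N[OF that(1)] and j = N[OF that(2)]
    have "close T (r + r) (X i) (V i) (X j) (V j)" using i j by (blast intro: close_triangle)
    then have "norm (Y i t - Y j t) \<le> C * (norm (Y i 0 - Y j 0) + (r + r))"
      using stab[of "X i" "V i" "X j" "V j" "r + r" "Y i" "Y j" t t] i j r t by (simp add: T_def)
    also have "norm (Y i 0 - Y j 0) < r / 2 + r / 2"
      unfolding Y_initial dist_norm[symmetric] using i j dist_triangle_less_add[of "\<xi>s i" \<xi> "r / 2" "\<xi>s j" "r / 2"] by (simp add: dist_commute)
    then have "C * (norm (Y i 0 - Y j 0) + (r + r)) < C * (r + (r + r))" using C by simp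
    also have "\<dots> < e" using C e by (simp add: r_def)
    finally show ?thesis by (simp add: dist_norm)
  qed
  then show "\<exists>N. \<forall>m\<ge>N. \<forall>n\<ge>N. dist (Y m t) (Y n t) < e" by blast
qed

definition Z :: "real \<Rightarrow> real^'d" where
  "Z t = (if t < 0 then 0 else lim (\<lambda>i. Y i t))"

lemma Y_tendsto: "0 \<le> t \<Longrightarrow> (\<lambda>i. Y i t) \<longlonglongrightarrow> Z t"
  using Cauchy_convergent[OF Y_Cauchy[of t]] by (simp add: Z_def convergent_LIMSEQ_iff)

lemma Z_initial: "Z 0 = \<xi>"
  using LIMSEQ_unique[OF Y_tendsto[of 0]] initial by (simp add: Y_initial)

lemma driver_tendsto:
  assumes "0 \<le> s" "s \<le> t"
  shows "(\<lambda>i. X i t - X i s) \<longlonglongrightarrow> x t - x s" and "(\<lambda>i. V i s t) \<longlonglongrightarrow> A s t"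
proof -
  have T: "0 < t + 1" using assms by simp
  show "(\<lambda>i. X i t - X i s) \<longlonglongrightarrow> x t - x s"
    by (rule tendsto_of_eventually_norm_le[where p = "(t - s) powr \<beta>"], rule eventually_mono[OF conv[OF T]])
       (use assms in \<open>auto simp: close_def\<close>)
  show "(\<lambda>i. V i s t) \<longlonglongrightarrow> A s t"
    by (rule tendsto_of_eventually_norm_le[where p = "((t - s) powr \<beta>)\<^sup>2"], rule eventually_mono[OF conv[OF T]])
       (use assms in \<open>auto simp: close_def\<close>)
qed

text \<open>\<open>J\<close> at (s,t) depends continuously on finitely many values of the solution
  and the driver, so the uniform bound survives pointwise convergence.\<close>

lemma davie_limit:
  assumes ev: "\<forall>\<^sub>F i in sequentially. davie T K h (X i) (V i) (Y i)"
  shows "davie T K h x A Z"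
  unfolding davie_def
proof (intro allI impI)
  fix s t assume st: "0 \<le> s \<and> s \<le> t \<and> t \<le> T \<and> t - s \<le> h"
  have "(\<lambda>i. J (X i) (V i) (Y i) s t) \<longlonglongrightarrow> J x A Z s t"
    unfolding J_def using st by (intro tendsto_diff F_tendsto G_tendsto Y_tendsto driver_tendsto) auto
  moreover have "\<forall>\<^sub>F i in sequentially. norm (J (X i) (V i) (Y i) s t) \<le> K * ((t - s) powr \<beta>) ^ 3"
    using ev by eventually_elim (use st in \<open>auto simp: davie_def\<close>)
  ultimately show "norm (J x A Z s t) \<le> K * ((t - s) powr \<beta>) ^ 3"
    by (intro tendsto_upperbound[OF tendsto_norm]) auto
qed

lemma Z_solution:
  assumes T: "0 < T"
  shows "rde_solution \<beta> f x A \<xi> T Z"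
proof -
  obtain M K h where M: "1 \<le> M" "0 < K" "0 < h" "driver T M x A"
    and ev: "\<forall>\<^sub>F i in sequentially. driver T M (X i) (V i) \<and> davie T K h (X i) (V i) (Y i)"
    by (rule uniform_bounds[OF T])
  have "davie T K h x A Z" by (rule davie_limit[OF eventually_mono[OF ev]]) simp
  from davie_imp_rde_solution[OF M(4) _ _ M(3) this] M show ?thesis by (simp add: Z_initial)
qed

text \<open>The constant obtained for a competing solution U is not controlled by M, but any finite
  constant suffices for uniqueness.\<close>

lemma Z_unique:
  assumes U: "\<And>s. s < 0 \<Longrightarrow> U s = 0" "\<And>T. 0 < T \<Longrightarrow> rde_solution \<beta> f x A \<xi> T U"
  shows "U = Z"
proof
  fix t
  show "U t = Z t"
  proof (cases "t < 0")
    case False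
    define T where "T = t + 1"
    have T: "0 < T" "0 \<le> t" "t \<le> T" using False by (auto simp: T_def)
    obtain M K h where M: "1 \<le> M" "0 < K" "0 < h" "driver T M x A"
      and ev: "\<forall>\<^sub>F i in sequentially. driver T M (X i) (V i) \<and> davie T K h (X i) (V i) (Y i)"
      by (rule uniform_bounds[OF T(1)])
    have D: "davie T K h x A Z" by (rule davie_limit[OF eventually_mono[OF ev]]) simp
    obtain K' where K': "0 \<le> K'" "davie T K' T x A U" "U 0 = \<xi>"
      using rde_solution_imp_davie[OF M(4) _ _ U(2)[OF T(1)]] M T by auto
    show ?thesis
      by (rule davie_unique[OF M(4) K'(1,2) _ M(3) D _ T(2,3)]) (use M K' in \<open>auto simp: Z_initial\<close>)
  qed (simp add: U Z_def)
qed

text \<open>Convergence in Hoelder norm asks this of every i, including those before the uniform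
  bounds set in, so each smooth driver is treated with its own constants.\<close>

lemma holder_Y:
  assumes T: "0 < T"
  shows "holder_on \<beta> {0..T} (Y i)"
proof -
  interpret i: smooth_rde f c \<beta> "X i" "X' i" by (rule smooth_rde)
  obtain M where M: "1 \<le> M" "driver T M (X i) i.area" using i.driver_area less_imp_le[OF T] by blast
  obtain K h where K: "0 < K" "0 < h" and ap: "\<And>T X W Y L. driver T M X W \<Longrightarrow>
      (\<And>s t. 0 \<le> s \<Longrightarrow> s \<le> t \<Longrightarrow> t \<le> T \<Longrightarrow> norm (J X W Y s t) \<le> L * (t - s)\<^sup>2) \<Longrightarrow> davie T K h X W Y"
    using apriori[OF M(1)] by blast
  have "davie T K h (X i) i.area (Y i)" using i.ode_solution_defect[OF Y[OF T]] ap[OF M(2)] by metis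
  then have "rde_solution \<beta> f (X i) i.area (Y i 0) T (Y i)"
    using M K by (intro davie_imp_rde_solution[OF M(2) _ _ K(2)]) auto
  then show ?thesis by (simp add: rde_solution_def controlled_def)
qed

text \<open>The limit \<open>Z\<close> satisfies the same Davie bound as the approximations, so
  \<open>stability\<close> compares them directly, with the distance of the drivers as
  \<rho>.\<close>

lemma convergence:
  assumes T: "0 < T"
  shows "converges_in_holder \<beta> 0 T Y Z"
  unfolding converges_in_holder_def
proof (intro conjI allI)
  show "holder_on \<beta> {0..T} (Y i)" for i by (rule holder_Y[OF T])
  show "holder_on \<beta> {0..T} Z" using Z_solution[OF T] by (simp add: rde_solution_def controlled_def)
  obtain M K h where M: "1 \<le> M" "0 < K" "0 < h" and d: "driver T M x A"
    and ev: "\<forall>\<^sub>F i in sequentially. driver T M (X i) (V i) \<and> davie T K h (X i) (V i) (Y i)"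
    by (rule uniform_bounds[OF T])
  have D: "davie T K h x A Z" by (rule davie_limit[OF eventually_mono[OF ev]]) simp
  obtain C where C: "0 < C" and stab: "\<And>\<rho> X W X' W' Y Y' s t. driver T M X W \<Longrightarrow> driver T M X' W' \<Longrightarrow> close T \<rho> X W X' W' \<Longrightarrow>
      davie T K h X W Y \<Longrightarrow> davie T K h X' W' Y' \<Longrightarrow> 0 \<le> \<rho> \<Longrightarrow>
      0 \<le> s \<Longrightarrow> s \<le> t \<Longrightarrow> t \<le> T \<Longrightarrow>
      norm (Y s - Y' s) \<le> C * (norm (Y 0 - Y' 0) + \<rho>) \<and>
      norm ((Y t - Y s) - (Y' t - Y' s)) \<le> C * (norm (Y 0 - Y' 0) + \<rho>) * (t - s) powr \<beta>"
    using stability[OF M less_imp_le[OF T]] by blast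
  show "(\<lambda>i. holder_norm \<beta> 0 T (\<lambda>t. Y i t - Z t)) \<longlonglongrightarrow> 0"
  proof (rule ennreal_tendsto_0I)
    fix e :: real assume e: "0 < e"
    \<comment> \<open>Initial values and drivers contribute C (r + r) = e / 2; the Hoelder norm is a
      sum of two suprema, each at most e / 2.\<close>
    define r where "r = e / (4 * C)"
    have r: "0 < r" using e C by (simp add: r_def)
    have "\<forall>\<^sub>F i in sequentially. dist (\<xi>s i) \<xi> < r" using initial r by (intro tendstoD) auto
    then show "\<forall>\<^sub>F i in sequentially. holder_norm \<beta> 0 T (\<lambda>t. Y i t - Z t) \<le> ennreal e"
      using conv[OF T r] ev
    proof eventually_elim
      case (elim i)
      have le: "C * (norm (Y i 0 - Z 0) + r) \<le> e / 2"
      proof -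
        have "C * (norm (Y i 0 - Z 0) + r) \<le> C * (r + r)"
          using elim(1) C by (intro mult_left_mono) (auto simp: Y_initial Z_initial dist_norm)
        then show ?thesis using C by (simp add: r_def)
      qed
      have b: "norm (Y i s - Z s) \<le> e / 2 \<and> norm ((Y i t - Y i s) - (Z t - Z s)) \<le> e / 2 * (t - s) powr \<beta>"
        if "0 \<le> s" "s \<le> t" "t \<le> T" for s t
        using stab[of "X i" "V i" x A r "Y i" Z s t] elim d D r that le
          mult_right_mono[OF le, of "(t - s) powr \<beta>"] by fastforce
      have "(SUP t\<in>{0..T}. ennreal (norm (Y i t - Z t))) \<le> ennreal (e / 2)"
        by (rule SUP_least) (use b in \<open>auto intro!: ennreal_leI\<close>)
      moreover have "(SUP (s, t)\<in>{(s, t). 0 \<le> s \<and> s < t \<and> t \<le> T}.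
        ennreal (norm ((Y i t - Z t) - (Y i s - Z s)) / (t - s) powr \<beta>)) \<le> ennreal (e / 2)"
      proof (rule SUP_least, clarify, rule ennreal_leI)
        fix s t assume st: "0 \<le> s" "s < t" "t \<le> T"
        have "(Y i t - Z t) - (Y i s - Z s) = (Y i t - Y i s) - (Z t - Z s)" by simp
        moreover have "norm ((Y i t - Y i s) - (Z t - Z s)) / (t - s) powr \<beta> \<le> e / 2"
          using b[of s t] st by (simp add: pos_divide_le_eq)
        ultimately show "norm ((Y i t - Z t) - (Y i s - Z s)) / (t - s) powr \<beta> \<le> e / 2" by metis
      qed
      ultimately have "holder_norm \<beta> 0 T (\<lambda>t. Y i t - Z t) \<le> ennreal (e / 2) + ennreal (e / 2)"
        unfolding holder_norm_def by (rule add_mono)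
      also have "\<dots> = ennreal e" using e by (simp flip: ennreal_plus)
      finally show ?case .
    qed
  qed
qed

end

section \<open>Application to the Brownian rough path\<close>

lemma rough_path_driver:
  fixes f :: "real^'d \<Rightarrow> real^'m^'d" and x :: "real \<Rightarrow> real^'m"
  assumes "rde_coefficients f c \<beta>" and r: "rough_path \<beta> T1 T2 x A" and T: "T1 \<le> 0" "T \<le> T2"
  shows "\<exists>M\<ge>1. rough_coefficients.driver tensor \<beta> T M x A"
proof -
  interpret rde_coefficients f c \<beta> by fact
  obtain C1 where C1: "\<And>s t. s \<in> {T1..T2} \<Longrightarrow> t \<in> {T1..T2} \<Longrightarrow> norm (x t - x s) \<le> C1 * \<bar>t - s\<bar> powr \<beta>"
    using r unfolding rough_path_def holder_on_def by blast
  obtain C2 where C2: "\<And>s t. T1 \<le> s \<and> s < t \<and> t \<le> T2 \<Longrightarrow> norm (A s t) \<le> C2 * (t - s) powr (2 * \<beta>)"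
    using r unfolding rough_path_def by blast
  define M where "M = max 1 (max C1 C2)"
  have M: "1 \<le> M" "C1 \<le> M" "C2 \<le> M" by (auto simp: M_def)
  have "norm (x t - x s) \<le> M * (t - s) powr \<beta> \<and> norm (A s t) \<le> M * ((t - s) powr \<beta>)\<^sup>2"
    if st: "0 \<le> s" "s \<le> t" "t \<le> T" for s t
  proof
    have "norm (x t - x s) \<le> C1 * (t - s) powr \<beta>" using C1[of s t] st T by auto
    also have "\<dots> \<le> M * (t - s) powr \<beta>" using M by (intro mult_right_mono) auto
    finally show "norm (x t - x s) \<le> M * (t - s) powr \<beta>" .
    show "norm (A s t) \<le> M * ((t - s) powr \<beta>)\<^sup>2"
    proof (cases "s = t")
      case True
      then show ?thesis using rough_path_diagonal[OF r, of s] st T by simp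
    next
      case False
      have "norm (A s t) \<le> C2 * (t - s) powr (2 * \<beta>)" using C2[of s t] False st T by auto
      also have "\<dots> \<le> M * (t - s) powr (2 * \<beta>)" using M by (intro mult_right_mono) auto
      finally show ?thesis using False by (simp add: powr_power)
    qed
  qed
  moreover have "A s t - A s u - A u t = tensor (x u - x s) (x t - x u)" if "0 \<le> s" "s \<le> u" "u \<le> t" "t \<le> T" for s u t
    using r that T unfolding rough_path_def by auto
  ultimately show ?thesis using M(1) by (intro exI[of _ M]) (auto simp: driver_def)
qed

theorem theorem20:
  fixes P :: "(real \<Rightarrow> real^'m) measure"
    and \<Omega> :: "(real \<Rightarrow> real^'m) set"
    and f :: "real^'d \<Rightarrow> real^'m^'d"
    and T \<beta> :: real
  assumes "two_sided_wiener_measure P"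
    and "canonical_path_set P \<Omega>"
    and "C3_b f"
    and "0 < T"
    and "1/3 < \<beta>" and "\<beta> < 1/2"
  shows "\<exists>\<delta> :: nat \<Rightarrow> real. \<delta> = (\<lambda>i. 1 / 2 ^ i) \<and> (\<forall>i. 0 < \<delta> i) \<and> \<delta> \<longlonglongrightarrow> 0 \<and>
    (\<forall>(\<xi>\<delta> :: nat \<Rightarrow> real^'d) \<xi>. \<xi>\<delta> \<longlonglongrightarrow> \<xi> \<longrightarrow>
      (\<forall>\<omega>\<in>\<Omega>. converges_in_holder \<beta> 0 T
         (\<lambda>i t. \<phi>\<^sub>\<delta> \<Omega> f (\<delta> i) t \<omega> (\<xi>\<delta> i)) (\<lambda>t. \<phi>\<^sub>0 \<Omega> \<beta> f t \<omega> \<xi>)))"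
proof (intro exI conjI allI impI ballI)
  show "(\<lambda>i. 1 / 2 ^ i) = (\<lambda>i::nat. 1 / 2 ^ i :: real)" ..
  show "0 < (1 / 2 ^ i :: real)" for i by simp
  show "(\<lambda>i::nat. 1 / 2 ^ i :: real) \<longlonglongrightarrow> 0"
    using LIMSEQ_realpow_zero[of "1/2"] by (simp add: power_one_over)
  fix \<xi>\<delta> :: "nat \<Rightarrow> real^'d" and \<xi> \<omega>
  assume \<xi>: "\<xi>\<delta> \<longlonglongrightarrow> \<xi>" and \<omega>: "\<omega> \<in> \<Omega>"
  have \<Omega>: "\<Omega> \<subseteq> C0" using assms(2) by (simp add: canonical_path_set_def)
  define x where "x = path_version \<Omega> \<omega>"
  define A where "A = brownian_area \<Omega> \<omega>"
  note brownian = brownian_rough_path[OF \<Omega> \<omega>, folded x_def A_def]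
  obtain c where c: "rde_coefficients f c \<beta>" by (rule C3_b_rde_coefficients[OF assms(3,5,6)])
  interpret rde_coefficients f c \<beta> by (rule c)
  define X where "X i = smooth_approx (1 / 2 ^ i) x" for i :: nat
  define X' where "X' i t = (1 / (1 / 2 ^ i)) *\<^sub>R (x (1 / 2 ^ i + t) - x t)" for i :: nat and t
  define Y where "Y i t = \<phi>\<^sub>\<delta> \<Omega> f (1 / 2 ^ i) t \<omega> (\<xi>\<delta> i)" for i :: nat and t
  have sm: "smooth_driver (X i) (X' i)" for i
    unfolding X_def X'_def[abs_def] by (rule smooth_driver_smooth_approx[OF brownian(1)])
  have Y: "(\<forall>s<0. Y i s = 0) \<and> (\<forall>T>0. ode_solution f (X i) (\<xi>\<delta> i) T (Y i))" for i
    unfolding Y_def[abs_def] \<phi>\<^sub>\<delta>_def x_def[symmetric] X_def[symmetric]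
    by (rule theI'[OF smooth_rde.ode_flow[OF smooth_rde.intro[OF c sm]]])
  interpret smooth_approximation f c \<beta> x A X X' "\<lambda>i. smooth_area (1 / 2 ^ i) x" \<xi>\<delta> \<xi> Y
  proof (intro smooth_approximation.intro smooth_approximation_axioms.intro c)
    show "smooth_area (1 / 2 ^ i) x = smooth_driver.area (X i) (X' i)" for i
      unfolding X_def X'_def[abs_def] by (rule smooth_area_eq[OF brownian(1)])
    fix T :: real assume T: "0 < T"
    \<comment> \<open>Convergence is available on the windows [-n,n]; one containing [0,T] is
      chosen.\<close>
    obtain n :: nat where n: "T \<le> real n" using real_arch_simple by blast
    show "\<exists>M\<ge>1. driver T M x A"
      by (rule rough_path_driver[OF c brownian(2)[OF assms(5,6), of n]]) (use n in auto)
    fix e :: real assume e: "0 < e"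
    have "(\<lambda>i. rough_dist \<beta> (- real n) (real n) (X i, smooth_area (1 / 2 ^ i) x) (x, A)) \<longlonglongrightarrow> 0"
      using brownian(3)[OF assms(5,6), of n] by (simp add: smooth_lift_def X_def)
    from rough_dist_eventually[OF this e]
    show "\<forall>\<^sub>F i in sequentially. close T e (X i) (smooth_area (1 / 2 ^ i) x) x A"
    proof eventually_elim
      case (elim i)
      show ?case
        unfolding close_def
      proof (intro allI impI)
        fix s t assume st: "0 \<le> s \<and> s \<le> t \<and> t \<le> T"
        show "norm ((X i t - X i s) - (x t - x s)) \<le> e * (t - s) powr \<beta> \<and>
          norm (smooth_area (1 / 2 ^ i) x s t - A s t) \<le> e * ((t - s) powr \<beta>)\<^sup>2"
        \<comment> \<open>The metric controls s < t only; on the diagonal both areas are 0.\<close>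
        proof (cases "s = t")
          case True
          then show ?thesis
            using rough_path_diagonal[OF brownian(2)[OF assms(5,6), of n], of s] st n by (simp add: smooth_area_diagonal)
        next
          case False
          then show ?thesis using elim[rule_format, of s t] st n by simp
        qed
      qed
    qed
  qed (use sm Y \<xi> in auto)
  \<comment> \<open>The limit of the approximations is the unique global solution, so the
    description defining the rough flow evaluates to it.\<close>
  have "(THE U. (\<forall>s<0. U s = 0) \<and> (\<forall>T>0. rde_solution \<beta> f x A \<xi> T U)) = Z"
    by (rule the_equality) (use Z_solution Z_unique in \<open>auto simp: Z_def\<close>)
  then have "\<phi>\<^sub>0 \<Omega> \<beta> f t \<omega> \<xi> = Z t" for t
    by (simp add: \<phi>\<^sub>0_def x_def A_def)
  then show "converges_in_holder \<beta> 0 T (\<lambda>i t. \<phi>\<^sub>\<delta> \<Omega> f (1 / 2 ^ i) t \<omega> (\<xi>\<delta> i)) (\<lambda>t. \<phi>\<^sub>0 \<Omega> \<beta> f t \<omega> \<xi>)"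
    using convergence[OF assms(4)] by (simp add: Y_def[abs_def])
qed

end
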